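(* For $n=1,2,\ldots$, the formal power series $\psi_n$ satisfy the recurrence relations $$\psi_{n+1}(s;x|q,t)=\prod_{i=1}^n\frac{(tx_{n+1}/x_i;q)_\infty}{(qx_{n+1}/x_i;q)_\infty}\frac{(qs_{n+1}/ts_i;q)_\infty}{(qs_{n+1}/s_i;q)_\infty}\cdot K^{(x;s|q,t)}(qs_{n+1}/t)\,K^{(s;x|q,q/t)}(tx_{n+1})\,\psi_n(s;x|q,t),$$ where on the left $x=(x_1,\ldots,x_{n+1})$, $s=(s_1,\ldots,s_{n+1})$, while in $\psi_n$ and in the operators $K$ on the right $x=(x_1,\ldots,x_n)$, $s=(s_1,\ldots,s_n)$.
   Context: Fix $q,t\in\mathbb{C}^*$ with $|q|<1$; $(z;q)_\infty=\prod_{k\ge0}(1-q^kz)$, $(z;q)_k=(z;q)_\infty/(q^kz;q)_\infty$. $M_n$ is the set of strictly upper triangular $n\times n$ matrices with entries in $\mathbb{N}=\{0,1,\ldots\}$, and $$c_n(\theta;s|q,t)=\prod_{k=2}^{n}\prod_{1\le i<j\le k}\frac{(q^{\sum_{a>k}(\theta_{i,a}-\theta_{j,a})}ts_j/s_i;q)_{\theta_{i,k}}}{(q^{\sum_{a>k}(\theta_{i,a}-\theta_{j,a})}qs_j/s_i;q)_{\theta_{i,k}}}\cdot\prod_{k=2}^{n}\prod_{1\le i\le j<k}\frac{(q^{-\theta_{j,k}+\sum_{a>k}(\theta_{i,a}-\theta_{j,a})}qs_j/ts_i;q)_{\theta_{i,k}}}{(q^{-\theta_{j,k}+\sum_{a>k}(\theta_{i,a}-\theta_{j,a})}s_j/s_i;q)_{\theta_{i,k}}}$$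 with $\sum_{a>k}=\sum_{a=k+1}^n$, $$p_n(x;s|q,t)=\sum_{\theta\in M_n}c_n(\theta;s|q,t)\prod_{1\le i<j\le n}(x_j/x_i)^{\theta_{ij}},\qquad \psi_n(x;s|q,t)=\prod_{1\le i<j\le n}\frac{(qx_j/tx_i;q)_\infty}{(qx_j/x_i;q)_\infty}\,p_n(x;s|q,t),$$ regarded as formal power series in $(x_2/x_1,\ldots,x_n/x_{n-1};s_2/s_1,\ldots,s_n/s_{n-1})$. $\psi_n(s;x|q,t)$ is obtained by exchanging $x$ and $s$. In $n$ variables, $$K^{(x;s|q,t)}(u)=\sum_{\nu\in\mathbb{N}^n}\prod_{i=1}^n(u/s_i)^{\nu_i}\prod_{i=1}^n\frac{(t;q)_{\nu_i}}{(q;q)_{\nu_i}}\prod_{1\le i<j\le n}\frac{(tx_j/x_i;q)_{\nu_i}}{(qx_j/x_i;q)_{\nu_i}}\frac{(q^{-\nu_j+1}x_j/tx_i;q)_{\nu_i}}{(q^{-\nu_j}x_j/x_i;q)_{\nu_i}}\;T_{q,x}^{-\nu},$$ where $T_{q,x}^{-\nu}=\prod_iT_{q,x_i}^{-\nu_i}$ and $T_{q,x_i}$ is the $q$-shift $x_i\mapsto qx_i$. $K^{(s;x|q,q/t)}(u)$ is obtained by exchanging $x$ and $s$ and replacing $t$ by $q/t$. The product of operators is composition: $T_{q,x}^{-\nu}$ in the left operator also acts on the factors $(tx_{n+1}/x_i)^{\nu_i}$ coming from the right operator ($x_{n+1}$ and $s_{n+1}$ are not shifted). The identity is one of formal power series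 in the ratios $x_{i+1}/x_i$, $s_{i+1}/s_i$ $(1\le i\le n)$. *)

theory Defs
  imports "HOL-Analysis.Analysis" "HOL-Library.Poly_Mapping"
begin

section \<open>Multivariate formal power series\<close>

text \<open>
  Formal power series with coefficients in \<open>'a\<close> in commuting variables indexed by \<open>'v\<close>; a
  monomial is a finitely supported exponent vector. The index type may be infinite: a power series
  in some of the variables is one whose coefficients vanish at all monomials involving others.
\<close>

typedef ('v, 'a) mfps = "UNIV :: (('v \<Rightarrow>\<^sub>0 nat) \<Rightarrow> 'a) set"
  morphisms mfps_nth Abs_mfps by simp

lemma mfps_nth_Abs [simp]: "mfps_nth (Abs_mfps f) = f"
  by (simp add: Abs_mfps_inverse)

lemma mfps_eqI: "(\<And>m. mfps_nth f m = mfps_nth g m) \<Longrightarrow> f = g"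
  by (metis mfps_nth_inject ext)

lemma mfps_eq_iff: "f = g \<longleftrightarrow> (\<forall>m. mfps_nth f m = mfps_nth g m)"
  by (auto intro: mfps_eqI)

definition splits :: "('v \<Rightarrow>\<^sub>0 nat) \<Rightarrow> (('v \<Rightarrow>\<^sub>0 nat) \<times> ('v \<Rightarrow>\<^sub>0 nat)) set"
  where "splits m = {(a, b). a + b = m}"

lemma mem_splits [simp]: "(a, b) \<in> splits m \<longleftrightarrow> a + b = m"
  by (simp add: splits_def)

lemma finite_splits [simp, intro]: "finite (splits m)"
proof -
  define B where "B = Max (insert 0 (Poly_Mapping.lookup m ` Poly_Mapping.keys m))"
  define F where "F = {f. \<forall>x. (x \<in> Poly_Mapping.keys m \<longrightarrow> f x \<in> {..B}) \<and> (x \<notin> Poly_Mapping.keys m \<longrightarrow> f x = 0)}"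
  have fin: "finite F"
    unfolding F_def by (rule finite_set_of_finite_funs) auto
  have B: "Poly_Mapping.lookup m x \<le> B" if "x \<in> Poly_Mapping.keys m" for x
    unfolding B_def using that by (intro Max_ge) auto
  have in_F: "Poly_Mapping.lookup a \<in> F" if ab: "a + b = m" for a b
  proof -
    have le: "Poly_Mapping.lookup a x \<le> Poly_Mapping.lookup m x" for x
      unfolding ab[symmetric] lookup_add by simp
    have "Poly_Mapping.lookup a x \<le> B" if "x \<in> Poly_Mapping.keys m" for x
      using le B[OF that] by (rule order_trans)
    moreover have "Poly_Mapping.lookup a x = 0" if "x \<notin> Poly_Mapping.keys m" for x
      using le[of x] that by (simp add: in_keys_iff)
    ultimately show ?thesis by (simp add: F_def)
  qed
  have "(Poly_Mapping.lookup \<circ> fst) ` splits m \<subseteq> F"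
    by (auto simp: splits_def intro: in_F)
  with fin have "finite ((Poly_Mapping.lookup \<circ> fst) ` splits m)"
    by (rule rev_finite_subset)
  moreover have "inj_on (Poly_Mapping.lookup \<circ> fst) (splits m)"
    by (auto simp: inj_on_def splits_def)
  ultimately show ?thesis
    by (rule finite_imageD)
qed

lemma add_eq_0_poly_mapping_iff [simp]: "a + b = 0 \<longleftrightarrow> a = 0 \<and> b = 0"
  for a b :: "'v \<Rightarrow>\<^sub>0 nat"
  by (simp add: poly_mapping_eq_iff fun_eq_iff lookup_add all_conj_distrib)

lemma splits_0 [simp]: "splits (0 :: 'v \<Rightarrow>\<^sub>0 nat) = {(0, 0)}"
  by (auto simp: splits_def)

instantiation mfps :: (type, zero) zero
begin
definition zero_mfps where "0 = Abs_mfps (\<lambda>_. 0)"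
instance ..
end

instantiation mfps :: (type, "{zero, one}") one
begin
definition one_mfps where "1 = Abs_mfps (\<lambda>m. if m = 0 then 1 else 0)"
instance ..
end

instantiation mfps :: (type, plus) plus
begin
definition plus_mfps where "f + g = Abs_mfps (\<lambda>m. mfps_nth f m + mfps_nth g m)"
instance ..
end

instantiation mfps :: (type, minus) minus
begin
definition minus_mfps where "f - g = Abs_mfps (\<lambda>m. mfps_nth f m - mfps_nth g m)"
instance ..
end

instantiation mfps :: (type, uminus) uminus
begin
definition uminus_mfps where "- f = Abs_mfps (\<lambda>m. - mfps_nth f m)"
instance ..
end

instantiation mfps :: (type, comm_semiring_0) times
begin
definition times_mfps
  where "f * g = Abs_mfps (\<lambda>m. \<Sum>(a, b)\<in>splits m. mfps_nth f a * mfps_nth g b)"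
instance ..
end

lemma mfps_nth_0 [simp]: "mfps_nth 0 m = 0"
  by (simp add: zero_mfps_def)

lemma mfps_nth_1: "mfps_nth 1 m = (if m = 0 then 1 else 0)"
  by (simp add: one_mfps_def)

lemma mfps_nth_add [simp]: "mfps_nth (f + g) m = mfps_nth f m + mfps_nth g m"
  by (simp add: plus_mfps_def)

lemma mfps_nth_diff [simp]: "mfps_nth (f - g) m = mfps_nth f m - mfps_nth g m"
  by (simp add: minus_mfps_def)

lemma mfps_nth_uminus [simp]: "mfps_nth (- f) m = - mfps_nth f m"
  by (simp add: uminus_mfps_def)

lemma mfps_nth_mult: "mfps_nth (f * g) m = (\<Sum>(a, b)\<in>splits m. mfps_nth f a * mfps_nth g b)"
  by (simp add: times_mfps_def)

lemma mfps_nth_mult_0 [simp]: "mfps_nth (f * g) 0 = mfps_nth f 0 * mfps_nth g 0"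
  by (simp add: mfps_nth_mult)

lemma mfps_mult_commute: "f * g = g * (f :: ('v, 'a :: comm_semiring_0) mfps)"
proof (rule mfps_eqI)
  fix m
  show "mfps_nth (f * g) m = mfps_nth (g * f) m"
    unfolding mfps_nth_mult
    by (rule sum.reindex_bij_witness[of _ prod.swap prod.swap])
       (auto simp: splits_def mult.commute add.commute)
qed

lemma mfps_mult_assoc: "(f * g) * h = f * (g * (h :: ('v, 'a :: comm_semiring_0) mfps))"
proof (rule mfps_eqI)
  fix m
  let ?t = "\<lambda>a b c. mfps_nth f a * mfps_nth g b * mfps_nth h c"
  have "mfps_nth ((f * g) * h) m = (\<Sum>p\<in>splits m. \<Sum>r\<in>splits (fst p). ?t (fst r) (snd r) (snd p))"
    by (simp add: mfps_nth_mult sum_distrib_right case_prod_beta)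
  also have "\<dots> = (\<Sum>(p, r)\<in>Sigma (splits m) (\<lambda>p. splits (fst p)). ?t (fst r) (snd r) (snd p))"
    by (rule sum.Sigma) auto
  also have "\<dots> = (\<Sum>(p, r)\<in>Sigma (splits m) (\<lambda>p. splits (snd p)). ?t (fst p) (fst r) (snd r))"
    by (rule sum.reindex_bij_witness
          [of _ "\<lambda>(p, r). ((fst p + fst r, snd r), (fst p, fst r))"
                "\<lambda>(p, r). ((fst r, snd r + snd p), (snd r, snd p))"])
       (auto simp: splits_def add_ac)
  also have "\<dots> = (\<Sum>p\<in>splits m. \<Sum>r\<in>splits (snd p). ?t (fst p) (fst r) (snd r))"
    by (rule sum.Sigma[symmetric]) auto
  also have "\<dots> = mfps_nth (f * (g * h)) m"
    by (simp add: mfps_nth_mult sum_distrib_left case_prod_beta mult.assoc)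
  finally show "mfps_nth ((f * g) * h) m = mfps_nth (f * (g * h)) m" .
qed

definition mfps_const :: "'a :: zero \<Rightarrow> ('v, 'a) mfps"
  where "mfps_const c = Abs_mfps (\<lambda>m. if m = 0 then c else 0)"

definition mfps_var :: "'v \<Rightarrow> ('v, 'a :: {zero, one}) mfps"
  where "mfps_var v = Abs_mfps (\<lambda>m. if m = Poly_Mapping.single v 1 then 1 else 0)"

lemma mfps_nth_const: "mfps_nth (mfps_const c) m = (if m = 0 then c else 0)"
  by (simp add: mfps_const_def)

lemma mfps_nth_const_mult [simp]:
  "mfps_nth (mfps_const c * f) m = c * mfps_nth (f :: ('v, 'a :: comm_semiring_0) mfps) m"
proof -
  have "mfps_nth (mfps_const c * f) m = (\<Sum>p\<in>splits m. if p = (0, m) then c * mfps_nth f m else 0)"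
    unfolding mfps_nth_mult by (rule sum.cong) (auto simp: mfps_nth_const splits_def split: if_splits)
  then show ?thesis by simp
qed

lemma mfps_const_1: "mfps_const 1 = 1"
  by (simp add: mfps_const_def one_mfps_def)

instance mfps :: (type, comm_ring_1) comm_ring_1
proof
  fix f g h :: "('a, 'b) mfps"
  show "f * g * h = f * (g * h)" by (rule mfps_mult_assoc)
  show "f * g = g * f" by (rule mfps_mult_commute)
  show "1 * f = f" by (rule mfps_eqI) (simp flip: mfps_const_1)
  show "(f + g) * h = f * h + g * h"
    by (rule mfps_eqI) (simp add: mfps_nth_mult distrib_right sum.distrib case_prod_beta)
  show "(0 :: ('a, 'b) mfps) \<noteq> 1"
    by (auto simp: mfps_eq_iff mfps_nth_1)
qed (auto intro!: mfps_eqI simp: algebra_simps)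

lemma mfps_const_mult: "mfps_const (a * b) = mfps_const a * (mfps_const b :: ('v, 'a :: comm_ring_1) mfps)"
  by (rule mfps_eqI) (simp add: mfps_nth_const)

lemma mfps_nth_sum: "mfps_nth (\<Sum>k\<in>A. F k) m = (\<Sum>k\<in>A. mfps_nth (F k :: ('v, 'a :: comm_ring_1) mfps) m)"
  by (induction A rule: infinite_finite_induct) auto

subsection \<open>Division\<close>

text \<open>
  As for univariate series over a field, exactly the series with nonzero constant term are
  invertible; the inverse of any other series is set to \<open>0\<close>.
\<close>

instantiation mfps :: (type, field) inverse
begin
definition inverse_mfps :: "('a, 'b) mfps \<Rightarrow> ('a, 'b) mfps"
  where "inverse f = (if mfps_nth f 0 = 0 then 0 else (THE g. f * g = 1))"
definition divide_mfps where "f div g = f * inverse (g :: ('a, 'b) mfps)"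
instance ..
end

definition total_degree :: "('v \<Rightarrow>\<^sub>0 nat) \<Rightarrow> nat"
  where "total_degree m = (\<Sum>v\<in>Poly_Mapping.keys m. Poly_Mapping.lookup m v)"

lemma total_degree_add: "total_degree (a + b) = total_degree a + total_degree b"
proof -
  have *: "total_degree c = (\<Sum>v\<in>Poly_Mapping.keys a \<union> Poly_Mapping.keys b. Poly_Mapping.lookup c v)" if "Poly_Mapping.keys c \<subseteq> Poly_Mapping.keys a \<union> Poly_Mapping.keys b" for c
    unfolding total_degree_def using that by (intro sum.mono_neutral_left) (auto simp: in_keys_iff)
  show ?thesis
    using Poly_Mapping.keys_add[of a b] by (simp add: * lookup_add sum.distrib)
qed

lemma total_degree_eq_0_iff [simp]: "total_degree m = 0 \<longleftrightarrow> m = 0"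
  by (auto simp: total_degree_def in_keys_iff intro!: poly_mapping_eqI)

lemma mfps_power_nth_eq_0:
  fixes f :: "('v, 'a :: comm_ring_1) mfps"
  assumes "mfps_nth f 0 = 0" "total_degree m < k"
  shows "mfps_nth (f ^ k) m = 0"
  using assms(2)
proof (induction k arbitrary: m)
  case (Suc k)
  have "mfps_nth f a * mfps_nth (f ^ k) b = 0" if "a + b = m" for a b
  proof (cases "a = 0")
    case False
    then have "total_degree a > 0"
      by (metis gr_zeroI total_degree_eq_0_iff)
    then have "total_degree b < k"
      using Suc.prems that by (auto simp: total_degree_add)
    with Suc.IH show ?thesis by simp
  qed (use assms in auto)
  then show ?case
    by (auto simp: mfps_nth_mult intro!: sum.neutral)
qed simp

lemma mfps_unit_ex:
  fixes f :: "('v, 'a :: field) mfps"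
  assumes "mfps_nth f 0 \<noteq> 0"
  shows "\<exists>g. f * g = 1"
proof -
  define c where "c = inverse (mfps_nth f 0)"
  define h where "h = 1 - mfps_const c * f"
  have h0: "mfps_nth h 0 = 0"
    using assms by (simp add: h_def c_def mfps_nth_1 mfps_nth_const)
  define g where "g = Abs_mfps (\<lambda>m. mfps_nth (\<Sum>k\<le>total_degree m. h ^ k) m)"
  have g: "mfps_nth g m = mfps_nth (\<Sum>k\<le>N. h ^ k) m" if "total_degree m \<le> N" for m N
    unfolding g_def mfps_nth_Abs mfps_nth_sum using that
    by (intro sum.mono_neutral_left) (auto intro!: mfps_power_nth_eq_0 h0)
  have "(1 - h) * g = 1"
  proof (rule mfps_eqI)
    fix m :: "'v \<Rightarrow>\<^sub>0 nat"
    let ?N = "total_degree m"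
    have "mfps_nth ((1 - h) * g) m = mfps_nth ((1 - h) * (\<Sum>k\<le>?N. h ^ k)) m"
      unfolding mfps_nth_mult by (intro sum.cong) (auto simp: g[of _ ?N] total_degree_add)
    also have "(1 - h) * (\<Sum>k\<le>?N. h ^ k) = 1 - h ^ Suc ?N"
      by (simp only: sum_gp_basic)
    also have "mfps_nth \<dots> m = mfps_nth 1 m"
      using mfps_power_nth_eq_0[OF h0, of m "Suc ?N"] by simp
    finally show "mfps_nth ((1 - h) * g) m = mfps_nth 1 m" .
  qed
  then have "f * (mfps_const c * g) = 1"
    by (simp add: h_def mult_ac)
  then show ?thesis ..
qed

lemma mfps_inverse_right:
  fixes f :: "('v, 'a :: field) mfps"
  assumes "mfps_nth f 0 \<noteq> 0"
  shows "f * inverse f = 1"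
proof -
  obtain g where g: "f * g = 1"
    using mfps_unit_ex[OF assms] ..
  have "h = g" if "f * h = 1" for h
  proof -
    have "h = (f * g) * h"
      by (simp add: g)
    also have "\<dots> = g * (f * h)"
      by (simp only: mult_ac)
    finally show ?thesis
      by (simp add: that)
  qed
  then have "(THE g. f * g = 1) = g"
    using g by blast
  with g assms show ?thesis by (simp add: inverse_mfps_def)
qed

subsection \<open>Coefficientwise convergence\<close>

text \<open>
  The topology is that of coefficientwise convergence with respect to the given topology (not the
  discrete one) on the coefficients, so that infinite products such as \<open>\<Prod>k. 1 - q ^ k z\<close> with
  \<open>\<bar>q\<bar> < 1\<close> converge.
\<close>

instantiation mfps :: (type, topological_space) topological_space
begin
definition open_mfps :: "('a, 'b) mfps set \<Rightarrow> bool"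
  where "open U \<longleftrightarrow> (\<exists>V. open V \<and> U = mfps_nth -` V)"
instance
proof
  show "open (UNIV :: ('a, 'b) mfps set)"
    unfolding open_mfps_def by (intro exI[of _ UNIV]) auto
  show "open (S \<inter> T)" if "open S" "open T" for S T :: "('a, 'b) mfps set"
    using that unfolding open_mfps_def by (metis open_Int vimage_Int)
  show "open (\<Union>K)" if "\<forall>S\<in>K. open S" for K :: "('a, 'b) mfps set set"
  proof -
    from that obtain V where "\<And>S. S \<in> K \<Longrightarrow> open (V S) \<and> S = mfps_nth -` V S"
      unfolding open_mfps_def by metis
    then have "open (\<Union>S\<in>K. V S)" "\<Union>K = mfps_nth -` (\<Union>S\<in>K. V S)"
      by auto
    then show ?thesis unfolding open_mfps_def by blast
  qed
qed
end

lemma tendsto_mfps_iff: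
  "(f \<longlongrightarrow> l) F \<longleftrightarrow> (\<forall>m. ((\<lambda>x. mfps_nth (f x) m) \<longlongrightarrow> mfps_nth l m) F)"
proof -
  have "(f \<longlongrightarrow> l) F \<longleftrightarrow> ((\<lambda>x. mfps_nth (f x)) \<longlongrightarrow> mfps_nth l) F"
  proof
    assume L: "(f \<longlongrightarrow> l) F"
    show "((\<lambda>x. mfps_nth (f x)) \<longlongrightarrow> mfps_nth l) F"
    proof (rule topological_tendstoI)
      fix V assume "open V" "mfps_nth l \<in> V"
      then have "open (mfps_nth -` V)" "l \<in> mfps_nth -` V"
        unfolding open_mfps_def by blast+
      from topological_tendstoD[OF L this] show "\<forall>\<^sub>F x in F. mfps_nth (f x) \<in> V"
        by simp
    qed
  next
    assume L: "((\<lambda>x. mfps_nth (f x)) \<longlongrightarrow> mfps_nth l) F"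
    show "(f \<longlongrightarrow> l) F"
    proof (rule topological_tendstoI)
      fix U assume "open U" "l \<in> U"
      then obtain V where "open V" "U = mfps_nth -` V" "mfps_nth l \<in> V"
        unfolding open_mfps_def by blast
      with topological_tendstoD[OF L, of V] show "\<forall>\<^sub>F x in F. f x \<in> U"
        by simp
    qed
  qed
  also have "\<dots> \<longleftrightarrow> limitin (product_topology (\<lambda>_. euclidean) UNIV) (\<lambda>x. mfps_nth (f x)) (mfps_nth l) F"
    by (simp add: euclidean_product_topology)
  also have "\<dots> \<longleftrightarrow> (\<forall>m. ((\<lambda>x. mfps_nth (f x) m) \<longlongrightarrow> mfps_nth l m) F)"
    by (simp add: limitin_componentwise)
  finally show ?thesis .
qed

instance mfps :: (type, t2_space) t2_space
proof
  fix f g :: "('a, 'b) mfps"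
  assume "f \<noteq> g"
  then obtain m where "mfps_nth f m \<noteq> mfps_nth g m"
    by (auto simp: mfps_eq_iff)
  then obtain U V where UV: "open U" "open V" "mfps_nth f m \<in> U" "mfps_nth g m \<in> V" "U \<inter> V = {}"
    by (metis hausdorff)
  have op: "open {h :: ('a, 'b) mfps. mfps_nth h m \<in> W}" if "open W" for W
    unfolding open_mfps_def
  proof (intro exI conjI)
    show "open ((\<lambda>h :: ('a \<Rightarrow>\<^sub>0 nat) \<Rightarrow> 'b. h m) -` W)"
      using that by (intro open_vimage continuous_on_product_coordinates)
  qed auto
  show "\<exists>U V. open U \<and> open V \<and> f \<in> U \<and> g \<in> V \<and> U \<inter> V = {}"
    by (intro exI[of _ "{h. mfps_nth h m \<in> U}"] exI[of _ "{h. mfps_nth h m \<in> V}"])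
       (use UV op in auto)
qed

lemma has_sum_mfps_iff:
  fixes f :: "'i \<Rightarrow> ('v, 'a :: {comm_ring_1, topological_space}) mfps"
  shows "(f has_sum s) A \<longleftrightarrow> (\<forall>m. ((\<lambda>i. mfps_nth (f i) m) has_sum mfps_nth s m) A)"
  by (simp add: has_sum_def tendsto_mfps_iff mfps_nth_sum)

subsection \<open>Rescaling the variables\<close>

text \<open>The substitution \<open>v \<mapsto> c v \<cdot> v\<close>.\<close>

definition mfps_rescale :: "('v \<Rightarrow> 'a) \<Rightarrow> ('v, 'a :: comm_ring_1) mfps \<Rightarrow> ('v, 'a) mfps"
  where "mfps_rescale c f =
    Abs_mfps (\<lambda>m. (\<Prod>v\<in>Poly_Mapping.keys m. c v ^ Poly_Mapping.lookup m v) * mfps_nth f m)"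

lemma mfps_rescale_mult: "mfps_rescale c (f * g) = mfps_rescale c f * mfps_rescale c g"
proof (rule mfps_eqI)
  fix m
  have ev: "(\<Prod>v\<in>Poly_Mapping.keys (a + b). c v ^ Poly_Mapping.lookup (a + b) v) =
      (\<Prod>v\<in>Poly_Mapping.keys a. c v ^ Poly_Mapping.lookup a v) * (\<Prod>v\<in>Poly_Mapping.keys b. c v ^ Poly_Mapping.lookup b v)" for a b
  proof -
    have *: "(\<Prod>v\<in>Poly_Mapping.keys d. c v ^ Poly_Mapping.lookup d v) = (\<Prod>v\<in>Poly_Mapping.keys a \<union> Poly_Mapping.keys b. c v ^ Poly_Mapping.lookup d v)"
      if "Poly_Mapping.keys d \<subseteq> Poly_Mapping.keys a \<union> Poly_Mapping.keys b" for d
      using that by (intro prod.mono_neutral_left) (auto simp: in_keys_iff)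
    show ?thesis
      unfolding *[OF Poly_Mapping.keys_add] *[of a, OF Un_upper1] *[of b, OF Un_upper2]
      by (simp add: lookup_add power_add prod.distrib)
  qed
  show "mfps_nth (mfps_rescale c (f * g)) m = mfps_nth (mfps_rescale c f * mfps_rescale c g) m"
    unfolding mfps_rescale_def mfps_nth_mult mfps_nth_Abs sum_distrib_left
    by (rule sum.cong) (auto simp: splits_def ev mult_ac)
qed

lemma mfps_rescale_1: "mfps_rescale c 1 = 1"
  by (rule mfps_eqI) (simp add: mfps_rescale_def mfps_nth_1)

lemma mfps_rescale_var: "mfps_rescale c (mfps_var v) = mfps_const (c v) * mfps_var v"
  by (rule mfps_eqI) (simp add: mfps_rescale_def mfps_var_def)

section \<open>The ring of power series in the ratios of the variables\<close>

text \<open>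
  The two alphabets are \<open>x = (x\<^sub>1, x\<^sub>2, \<dots>)\<close> and \<open>s = (s\<^sub>1, s\<^sub>2, \<dots>)\<close>. The variable \<open>(X, k)\<close> stands
  for \<open>x\<^sub>k\<^sub>+\<^sub>1 / x\<^sub>k\<close> and \<open>(S, k)\<close> for \<open>s\<^sub>k\<^sub>+\<^sub>1 / s\<^sub>k\<close>, where \<open>k \<ge> 1\<close>. The definitions below take
  alphabets as arguments, so that exchanging \<open>x\<close> and \<open>s\<close> is exchanging two arguments.
\<close>

datatype alphabet = X | S

type_synonym ratio_series = "(alphabet \<times> nat, complex) mfps"

text \<open>\<open>ratio a i j\<close> is \<open>a\<^sub>j / a\<^sub>i\<close>, for \<open>i \<le> j\<close>.\<close>

definition ratio :: "alphabet \<Rightarrow> nat \<Rightarrow> nat \<Rightarrow> ratio_series"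
  where "ratio a i j = (\<Prod>k\<in>{i..<j}. mfps_var (a, k))"

text \<open>
  \<open>qshift q a e\<close> is \<open>T\<^bsub>q,a\<^esub>\<^sup>e\<close>, i.e. the substitution \<open>a\<^sub>i \<mapsto> q\<^bsup>e\<^sub>i\<^esup> a\<^sub>i\<close> for all \<open>i\<close>; it takes
  \<open>a\<^sub>k\<^sub>+\<^sub>1 / a\<^sub>k\<close> to \<open>q\<^bsup>e\<^sub>k\<^sub>+\<^sub>1 - e\<^sub>k\<^esup> a\<^sub>k\<^sub>+\<^sub>1 / a\<^sub>k\<close> and leaves the other alphabet alone.
\<close>

definition qshift :: "complex \<Rightarrow> alphabet \<Rightarrow> (nat \<Rightarrow> int) \<Rightarrow> ratio_series \<Rightarrow> ratio_series"
  where "qshift q a e =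
    mfps_rescale (\<lambda>(b, k). if b = a then q powi (e (Suc k) - e k) else 1)"

lemma qshift_mult: "qshift q a e (f * g) = qshift q a e f * qshift q a e g"
  by (simp add: qshift_def mfps_rescale_mult)

lemma qshift_ratio:
  assumes "q \<noteq> 0" "i \<le> j"
  shows "qshift q a e (ratio a i j) = mfps_const (q powi (e j - e i)) * ratio a i j"
  using assms(2)
proof (induction j rule: dec_induct)
  case base
  show ?case by (simp add: ratio_def qshift_def mfps_rescale_1 mfps_const_1)
next
  case (step j)
  have r: "ratio a i (Suc j) = ratio a i j * mfps_var (a, j)"
    using step.hyps by (simp add: ratio_def)
  have "q powi (e (Suc j) - e i) = q powi ((e j - e i) + (e (Suc j) - e j))"
    by simp
  also have "\<dots> = q powi (e j - e i) * q powi (e (Suc j) - e j)"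
    using assms(1) by (rule power_int_add[OF disjI1])
  finally have p: "q powi (e (Suc j) - e i) = q powi (e j - e i) * q powi (e (Suc j) - e j)" .
  have v: "qshift q a e (mfps_var (a, j)) = mfps_const (q powi (e (Suc j) - e j)) * mfps_var (a, j)"
    by (simp add: qshift_def mfps_rescale_var)
  show ?case
    unfolding r p qshift_mult step.IH v mfps_const_mult by (simp only: mult_ac)
qed

section \<open>The series and the operators\<close>

definition qpoch_inf :: "complex \<Rightarrow> ratio_series \<Rightarrow> ratio_series"
  where "qpoch_inf q z = prodinf (\<lambda>k. 1 - mfps_const (q ^ k) * z)"

text \<open>
  \<open>(z; q)\<^sub>k\<close> as a finite product. It agrees with \<open>(z; q)\<^sub>\<infinity> / (q\<^sup>k z; q)\<^sub>\<infinity>\<close> (see \<open>qpoch_eq_divide\<close>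
  below) but also covers those constants \<open>z = q\<^sup>-\<^sup>m\<close> for which that quotient reads \<open>0 / 0\<close>.
\<close>

definition qpoch :: "complex \<Rightarrow> ratio_series \<Rightarrow> nat \<Rightarrow> ratio_series"
  where "qpoch q z k = (\<Prod>i<k. 1 - mfps_const (q ^ i) * z)"

lemma qpoch_nth_0 [simp]: "mfps_nth z 0 = 0 \<Longrightarrow> mfps_nth (qpoch q z k) 0 = 1"
  by (induction k) (simp_all add: qpoch_def mfps_nth_1)

lemma qpoch_Suc: "qpoch q z (Suc k) = qpoch q z k - mfps_const (q ^ k) * (z * qpoch q z k)"
  by (simp add: qpoch_def algebra_simps)

lemma qpoch_convergent:
  assumes q: "norm q < 1" and z: "mfps_nth z 0 = 0"
  shows "Bseq (\<lambda>k. mfps_nth (qpoch q z k) m) \<and> convergent (\<lambda>k. mfps_nth (qpoch q z k) m)"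
proof (induction "total_degree m" arbitrary: m rule: less_induct)
  case less
  define d where "d k = mfps_nth (z * qpoch q z k) m" for k
  have "\<forall>p\<in>splits m. \<exists>B. \<forall>k. norm (mfps_nth z (fst p) * mfps_nth (qpoch q z k) (snd p)) \<le> B"
  proof
    fix p assume p: "p \<in> splits m"
    show "\<exists>B. \<forall>k. norm (mfps_nth z (fst p) * mfps_nth (qpoch q z k) (snd p)) \<le> B"
    proof (cases "fst p = 0")
      case True
      then show ?thesis using z by auto
    next
      case False
      then have "total_degree (fst p) > 0"
        by (metis gr_zeroI total_degree_eq_0_iff)
      then have "total_degree (snd p) < total_degree m"
        using p by (auto simp: splits_def total_degree_add)
      then obtain B where "\<And>k. norm (mfps_nth (qpoch q z k) (snd p)) \<le> B"
        using less by (meson BseqE)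
      then have "norm (mfps_nth z (fst p) * mfps_nth (qpoch q z k) (snd p)) \<le> norm (mfps_nth z (fst p)) * B" for k
        by (simp add: norm_mult mult_left_mono)
      then show ?thesis by blast
    qed
  qed
  then obtain B where B: "norm (mfps_nth z (fst p) * mfps_nth (qpoch q z k) (snd p)) \<le> B p"
    if "p \<in> splits m" for p k
    by metis
  have d: "norm (d k) \<le> (\<Sum>p\<in>splits m. B p)" for k
    unfolding d_def mfps_nth_mult by (rule sum_norm_le) (auto simp: case_prod_beta B)
  have "summable (\<lambda>k. q ^ k * d k)"
  proof (rule summable_comparison_test)
    show "summable (\<lambda>k. norm q ^ k * (\<Sum>p\<in>splits m. B p))"
      using q by (intro summable_mult2 summable_geometric) auto
    show "\<exists>N. \<forall>n\<ge>N. norm (q ^ n * d n) \<le> norm q ^ n * (\<Sum>p\<in>splits m. B p)"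
      by (auto simp: norm_mult norm_power intro!: mult_left_mono d)
  qed
  then have "convergent (\<lambda>n. \<Sum>k<n. q ^ k * d k)"
    by (simp add: summable_iff_convergent)
  moreover have "mfps_nth (qpoch q z n) m = mfps_nth 1 m - (\<Sum>k<n. q ^ k * d k)" for n
    by (induction n) (simp_all add: qpoch_Suc d_def, simp add: qpoch_def)
  ultimately have "convergent (\<lambda>k. mfps_nth (qpoch q z k) m)"
    by (simp add: convergent_diff convergent_const)
  then show ?case using convergent_imp_Bseq by blast
qed

lemma qpoch_LIMSEQ:
  assumes q: "norm q < 1" and z: "mfps_nth z 0 = 0"
  shows "qpoch q z \<longlonglongrightarrow> qpoch_inf q z" and "mfps_nth (qpoch_inf q z) 0 = 1"
proof -
  define L where "L = Abs_mfps (\<lambda>m. lim (\<lambda>k. mfps_nth (qpoch q z k) m))"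
  have L: "qpoch q z \<longlonglongrightarrow> L"
    using qpoch_convergent[OF assms] by (auto simp: tendsto_mfps_iff L_def convergent_LIMSEQ_iff)
  have L0: "mfps_nth L 0 = 1"
    using z by (simp add: L_def)
  have "(\<lambda>n. \<Prod>i\<le>n. 1 - mfps_const (q ^ i) * z) \<longlonglongrightarrow> L"
    using L[THEN LIMSEQ_Suc] by (simp add: qpoch_def lessThan_Suc_atMost)
  then have raw: "raw_has_prod (\<lambda>k. 1 - mfps_const (q ^ k) * z) 0 L"
    using L0 by (auto simp: raw_has_prod_def)
  have nz: "1 - mfps_const (q ^ k) * z \<noteq> 0" for k
    using z by (auto simp: mfps_eq_iff mfps_nth_1 intro!: exI[of _ 0])
  have "qpoch_inf q z = L"
    unfolding qpoch_inf_def prodinf_def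
  proof (rule the_equality)
    show "(\<lambda>k. 1 - mfps_const (q ^ k) * z) has_prod L"
      using raw by (simp add: has_prod_def)
    show "p = L" if "(\<lambda>k. 1 - mfps_const (q ^ k) * z) has_prod p" for p
      using that raw nz by (auto simp: has_prod_def raw_has_prod_def intro: LIMSEQ_unique)
  qed
  with L L0 show "qpoch q z \<longlonglongrightarrow> qpoch_inf q z" "mfps_nth (qpoch_inf q z) 0 = 1"
    by simp_all
qed

lemma qpoch_eq_divide:
  assumes q: "norm q < 1" and z: "mfps_nth z 0 = 0"
  shows "qpoch q z k = qpoch_inf q z / qpoch_inf q (mfps_const (q ^ k) * z)"
proof -
  let ?z = "mfps_const (q ^ k) * z"
  have z': "mfps_nth ?z 0 = 0"
    using z by simp
  have "qpoch q z (n + k) = qpoch q z k * qpoch q ?z n" for n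
    by (induction n) (simp_all add: qpoch_def mfps_const_mult power_add mult_ac)
  moreover have "(\<lambda>n. qpoch q z (n + k)) \<longlonglongrightarrow> qpoch_inf q z"
    using qpoch_LIMSEQ(1)[OF q z] by (rule LIMSEQ_ignore_initial_segment)
  moreover have "(\<lambda>n. qpoch q z k * qpoch q ?z n) \<longlonglongrightarrow> qpoch q z k * qpoch_inf q ?z"
    using qpoch_LIMSEQ(1)[OF q z']
    by (auto simp: tendsto_mfps_iff mfps_nth_mult case_prod_beta intro!: tendsto_intros)
  ultimately have "qpoch_inf q z = qpoch q z k * qpoch_inf q ?z"
    by (auto intro: LIMSEQ_unique)
  then show ?thesis
    using mfps_inverse_right[of "qpoch_inf q ?z"] qpoch_LIMSEQ(2)[OF q z']
    by (simp add: divide_mfps_def mult.assoc)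
qed

text \<open>
  Strictly upper triangular matrices and vectors, with entries in the natural numbers, are extended
  by \<open>0\<close> outside their index range \<open>{1..n}\<close>.
\<close>

definition upper_mats :: "nat \<Rightarrow> (nat \<Rightarrow> nat \<Rightarrow> nat) set"
  where "upper_mats n = {\<theta>. \<forall>i j. \<not> (1 \<le> i \<and> i < j \<and> j \<le> n) \<longrightarrow> \<theta> i j = 0}"

definition nat_vecs :: "nat \<Rightarrow> (nat \<Rightarrow> nat) set"
  where "nat_vecs n = {\<nu>. \<forall>i. i \<notin> {1..n} \<longrightarrow> \<nu> i = 0}"

text \<open>\<open>c_coeff n \<theta> b q t\<close> is \<open>c\<^sub>n(\<theta>; b | q, t)\<close>.\<close>

definition c_coeff ::
    "nat \<Rightarrow> (nat \<Rightarrow> nat \<Rightarrow> nat) \<Rightarrow> alphabet \<Rightarrow> complex \<Rightarrow> complex \<Rightarrow> ratio_series"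
  where "c_coeff n \<theta> b q t =
    (let e = (\<lambda>i j k. \<Sum>a\<in>{k+1..n}. int (\<theta> i a) - int (\<theta> j a)) in
      (\<Prod>k\<in>{2..n}. \<Prod>j\<in>{1..k}. \<Prod>i\<in>{1..<j}.
         qpoch q (mfps_const (q powi (e i j k) * t) * ratio b i j) (\<theta> i k) /
         qpoch q (mfps_const (q powi (e i j k) * q) * ratio b i j) (\<theta> i k)) *
      (\<Prod>k\<in>{2..n}. \<Prod>j\<in>{1..<k}. \<Prod>i\<in>{1..j}.
         qpoch q (mfps_const (q powi (- int (\<theta> j k) + e i j k) * q / t) * ratio b i j) (\<theta> i k) /
         qpoch q (mfps_const (q powi (- int (\<theta> j k) + e i j k)) * ratio b i j) (\<theta> i k)))"

text \<open>\<open>p_series n a b q t\<close> is \<open>p\<^sub>n(a; b | q, t)\<close> and \<open>psi n a b q t\<close> is \<open>\<psi>\<^sub>n(a; b | q, t)\<close>.\<close>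

definition p_series ::
    "nat \<Rightarrow> alphabet \<Rightarrow> alphabet \<Rightarrow> complex \<Rightarrow> complex \<Rightarrow> ratio_series"
  where "p_series n a b q t =
    (\<Sum>\<^sub>\<infinity>\<theta>\<in>upper_mats n.
       c_coeff n \<theta> b q t * (\<Prod>j\<in>{1..n}. \<Prod>i\<in>{1..<j}. ratio a i j ^ \<theta> i j))"

definition psi ::
    "nat \<Rightarrow> alphabet \<Rightarrow> alphabet \<Rightarrow> complex \<Rightarrow> complex \<Rightarrow> ratio_series"
  where "psi n a b q t =
    (\<Prod>j\<in>{1..n}. \<Prod>i\<in>{1..<j}.
       qpoch_inf q (mfps_const (q / t) * ratio a i j) /
       qpoch_inf q (mfps_const q * ratio a i j)) *
    p_series n a b q t"

text \<open>
  \<open>K_op n a b q t w\<close> is the operator \<open>K\<^bsup>(a;b|q,t)\<^esup>(u)\<close> in \<open>n\<close> variables, where \<open>w i\<close> is \<open>u / b\<^sub>i\<close>;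
  \<open>u\<close> itself is not a series in the ratios. The variables \<open>a\<^sub>i\<close> with \<open>i > n\<close> are not shifted because
  \<open>\<nu> i = 0\<close> for them; in particular \<open>a\<^sub>n\<^sub>+\<^sub>1 / a\<^sub>i\<close> is taken to \<open>q\<^bsup>\<nu>\<^sub>i\<^esup> a\<^sub>n\<^sub>+\<^sub>1 / a\<^sub>i\<close> for \<open>i \<le> n\<close>.
\<close>

definition K_op ::
    "nat \<Rightarrow> alphabet \<Rightarrow> alphabet \<Rightarrow> complex \<Rightarrow> complex \<Rightarrow> (nat \<Rightarrow> ratio_series) \<Rightarrow>
     ratio_series \<Rightarrow> ratio_series"
  where "K_op n a b q t w f =
    (\<Sum>\<^sub>\<infinity>\<nu>\<in>nat_vecs n.
       (\<Prod>i\<in>{1..n}. w i ^ \<nu> i) *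
       (\<Prod>i\<in>{1..n}. qpoch q (mfps_const t) (\<nu> i) / qpoch q (mfps_const q) (\<nu> i)) *
       (\<Prod>j\<in>{1..n}. \<Prod>i\<in>{1..<j}.
          qpoch q (mfps_const t * ratio a i j) (\<nu> i) /
          qpoch q (mfps_const q * ratio a i j) (\<nu> i) *
          (qpoch q (mfps_const (q powi (- int (\<nu> j) + 1) / t) * ratio a i j) (\<nu> i) /
           qpoch q (mfps_const (q powi (- int (\<nu> j))) * ratio a i j) (\<nu> i))) *
       qshift q a (\<lambda>i. - int (\<nu> i)) f)"

end

theory Submission
  imports Defs "HOL-Computational_Algebra.Polynomial_Factorial"
begin

text \<open>
  Write \<open>y\<close> for the first and \<open>x\<close> for the second argument of \<open>\<psi>\<^sub>n\<close>. Splitting off the last column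
  of \<open>\<theta>\<close> expresses \<open>\<psi>\<^sub>n\<^sub>+\<^sub>1(y;x|q,t)\<close> by \<open>K\<^bsup>(x;y|q,t)\<^esup>(q y\<^sub>n\<^sub>+\<^sub>1/t)\<close> applied to \<open>g\<^sup>-\<^sup>1 \<psi>\<^sub>n(y;x|q,t)\<close>, where
  \<open>g = \<Prod>\<^sub>i (t x\<^sub>n\<^sub>+\<^sub>1/x\<^sub>i;q)\<^sub>\<infinity> / (q x\<^sub>n\<^sub>+\<^sub>1/x\<^sub>i;q)\<^sub>\<infinity>\<close>. The recurrence thus says that \<open>\<psi>\<^sub>n(y;x|q,t)\<close> is an
  eigenfunction of \<open>K\<^bsup>(y;x|q,q/t)\<^esup>(t x\<^sub>n\<^sub>+\<^sub>1)\<close> with eigenvalue \<open>g\<^sup>-\<^sup>1\<close>. This follows from the corresponding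
  statement for the Macdonald operator in \<open>y\<close>, whose shifts are \<open>x\<^sub>i\<^sup>-\<^sup>1 A\<^sub>i(y) T\<^bsub>q,y\<^sub>i\<^esub>\<^sup>-\<^sup>1\<close>: it commutes
  with \<open>K\<close>, its formal eigenfunctions are determined by their constant term in \<open>y\<close>, and the constant
  term of \<open>K \<psi>\<^sub>n\<close> is given by the q-binomial theorem.

  The eigenvalue equation for the Macdonald operator is proved by induction on \<open>n\<close> together with the
  duality \<open>\<psi>\<^sub>n(y;x|q,t) = \<psi>\<^sub>n(x;y|q,q/t)\<close>. Since \<open>K\<^bsup>(x;y|q,t)\<^esup>(q y\<^sub>n\<^sub>+\<^sub>1/t)\<close> and
  \<open>K\<^bsup>(y;x|q,q/t)\<^esup>(t x\<^sub>n\<^sub>+\<^sub>1)\<close> commute, the recurrence is self-dual, which gives the duality for \<open>n + 1\<close>.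
  The dual form of the recursion, in which the shifts act on \<open>y\<close>, intertwines the Macdonald operators in
  \<open>n\<close> and in \<open>n + 1\<close> variables. Both the commutation and the intertwining relation are identities between
  the coefficients of the shifts \<open>T\<^bsub>q,y\<^esub>\<^sup>-\<^sup>\<nu>\<close>; they come from one partial fraction expansion.
\<close>


text \<open>The column recursion shifts only \<open>x\<close> and so says nothing about operators in
  \<open>y\<close>; duality is what makes it usable there, and hence duality and the eigenvalue
  equation share one induction. The Macdonald operator is a better test operator than
  \<open>K\<close> because it is a finite sum of single shifts: its composites with \<open>K\<close>
  can be compared coefficient by coefficient, and the exponents of a lowest term of an eigenfunction
  can be read off from its diagonal action. The coefficient identities involve all quotients y_j /
  y_i, of which only those with i < j are power series. They are therefore proved in the field of
  fractions, and the ring of power series first has to be shown to be a domain; the uniqueness of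
  eigenfunctions uses this a second time. In the field of fractions, quotients of different
  variables are generic for all nonzero q and t, so denominators vanish at most where two poles of
  the same index meet, that is, where a power of q equals t.\<close>

declare One_nat_def [simp del]

section \<open>Multivariate power series\<close>

abbreviation keys where "keys \<equiv> Poly_Mapping.keys"
abbreviation lookup where "lookup \<equiv> Poly_Mapping.lookup"

text \<open>Lexicographically smallest exponents have a sum that is attained in no other way;
  minimising one coordinate of \<open>V\<close> after the other produces them. Outside
  \<open>V\<close> the exponents within each set agree, so a finite \<open>V\<close> suffices
  although there may be infinitely many variables.\<close>

lemma unique_sum_minimum:
  fixes A B :: "('v \<Rightarrow>\<^sub>0 nat) set"
  assumes "finite V" "A \<noteq> {}" "B \<noteq> {}"
    and "\<And>a a' v. a \<in> A \<Longrightarrow> a' \<in> A \<Longrightarrow> v \<notin> V \<Longrightarrow> lookup a v = lookup a' v"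
    and "\<And>b b' v. b \<in> B \<Longrightarrow> b' \<in> B \<Longrightarrow> v \<notin> V \<Longrightarrow> lookup b v = lookup b' v"
  shows "\<exists>a0\<in>A. \<exists>b0\<in>B. \<forall>a\<in>A. \<forall>b\<in>B. a + b = a0 + b0 \<longrightarrow> a = a0 \<and> b = b0"
  using assms
proof (induction V arbitrary: A B rule: finite_induct)
  case empty
  then obtain a0 b0 where ab: "a0 \<in> A" "b0 \<in> B" by blast
  then have "a = a0" if "a \<in> A" for a
    by (intro poly_mapping_eqI empty.prems(3)) (use that in auto)
  moreover have "b = b0" if "b \<in> B" for b
    by (intro poly_mapping_eqI empty.prems(4)) (use ab that in auto)
  ultimately show ?case using ab by blast
next
  case (insert v V)
  \<comment> \<open>Only elements that are minimal in coordinate \<open>v\<close> can sum to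
    \<open>k + l\<close> there, so the other coordinates may be minimised within \<open>A'\<close>
    and \<open>B'\<close>.\<close>
  define k where "k = (LEAST k. k \<in> (\<lambda>a. lookup a v) ` A)"
  define l where "l = (LEAST k. k \<in> (\<lambda>a. lookup a v) ` B)"
  define A' where "A' = {a \<in> A. lookup a v = k}"
  define B' where "B' = {b \<in> B. lookup b v = l}"
  have "k \<in> (\<lambda>a. lookup a v) ` A" "l \<in> (\<lambda>a. lookup a v) ` B"
    unfolding k_def l_def using insert.prems by (auto intro: LeastI)
  then have ne: "A' \<noteq> {}" "B' \<noteq> {}"
    by (auto simp: A'_def B'_def)
  have "\<exists>a0\<in>A'. \<exists>b0\<in>B'. \<forall>a\<in>A'. \<forall>b\<in>B'. a + b = a0 + b0 \<longrightarrow> a = a0 \<and> b = b0"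
  proof (rule insert.IH[OF ne])
    show "lookup a w = lookup a' w" if "a \<in> A'" "a' \<in> A'" "w \<notin> V" for a a' w
      using that insert.prems(3)[of a a' w] by (cases "w = v") (auto simp: A'_def)
    show "lookup a w = lookup a' w" if "a \<in> B'" "a' \<in> B'" "w \<notin> V" for a a' w
      using that insert.prems(4)[of a a' w] by (cases "w = v") (auto simp: B'_def)
  qed
  then obtain a0 b0 where ab: "a0 \<in> A'" "b0 \<in> B'"
    and *: "\<And>a b. a \<in> A' \<Longrightarrow> b \<in> B' \<Longrightarrow> a + b = a0 + b0 \<Longrightarrow> a = a0 \<and> b = b0"
    by blast
  have "a = a0 \<and> b = b0" if "a \<in> A" "b \<in> B" "a + b = a0 + b0" for a b
  proof (rule *)
    have "k \<le> lookup a v" "l \<le> lookup b v"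
      unfolding k_def l_def using that by (auto intro: Least_le)
    moreover have "lookup a v + lookup b v = k + l"
      using ab that(3) by (metis (mono_tags, lifting) A'_def B'_def lookup_add mem_Collect_eq)
    ultimately show "a \<in> A'" "b \<in> B'"
      using that by (auto simp: A'_def B'_def)
  qed (fact that)
  then show ?case
    using ab by (auto simp: A'_def B'_def)
qed

lemma splits_keys: "p \<in> splits m \<Longrightarrow> keys (fst p) \<subseteq> keys m \<and> keys (snd p) \<subseteq> keys m"
  by (auto simp: splits_def lookup_add in_keys_iff)

instance mfps :: (type, idom) idom
proof
  fix f g :: "('a, 'b) mfps"
  assume "f \<noteq> 0" "g \<noteq> 0"
  then obtain m m' where m: "mfps_nth f m \<noteq> 0" "mfps_nth g m' \<noteq> 0"
    by (auto simp: mfps_eq_iff)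
  \<comment> \<open>One monomial of each factor fixes a finite set of variables. Exponents cannot
    cancel, so a monomial in \<open>V\<close> splits only into monomials in \<open>V\<close>, and
    all other terms of \<open>f\<close> and \<open>g\<close> can be ignored.\<close>
  define V where "V = keys m \<union> keys m'"
  define A where "A = {a. keys a \<subseteq> V \<and> mfps_nth f a \<noteq> 0}"
  define B where "B = {a. keys a \<subseteq> V \<and> mfps_nth g a \<noteq> 0}"
  have "\<exists>a0\<in>A. \<exists>b0\<in>B. \<forall>a\<in>A. \<forall>b\<in>B. a + b = a0 + b0 \<longrightarrow> a = a0 \<and> b = b0"
  proof (rule unique_sum_minimum)
    show "finite V" by (simp add: V_def)
    show "A \<noteq> {}" "B \<noteq> {}"
      using m by (auto simp: A_def B_def V_def)
    show "lookup a v = lookup a' v" if "a \<in> A" "a' \<in> A" "v \<notin> V" for a a' v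
      using that by (simp add: A_def in_keys_iff) (metis in_keys_iff subset_iff)
    show "lookup a v = lookup a' v" if "a \<in> B" "a' \<in> B" "v \<notin> V" for a a' v
      using that by (simp add: B_def in_keys_iff) (metis in_keys_iff subset_iff)
  qed
  then obtain a0 b0 where ab: "a0 \<in> A" "b0 \<in> B"
    and *: "\<And>a b. a \<in> A \<Longrightarrow> b \<in> B \<Longrightarrow> a + b = a0 + b0 \<Longrightarrow> a = a0 \<and> b = b0"
    by blast
  have keys: "keys (a0 + b0) \<subseteq> V"
    using ab Poly_Mapping.keys_add[of a0 b0] by (auto simp: A_def B_def)
  have "mfps_nth (f * g) (a0 + b0) = (\<Sum>p\<in>splits (a0 + b0). mfps_nth f (fst p) * mfps_nth g (snd p))"
    by (simp add: mfps_nth_mult case_prod_beta)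
  also have "\<dots> = (\<Sum>p\<in>{(a0, b0)}. mfps_nth f (fst p) * mfps_nth g (snd p))"
  proof (rule sum.mono_neutral_right)
    show "\<forall>p\<in>splits (a0 + b0) - {(a0, b0)}. mfps_nth f (fst p) * mfps_nth g (snd p) = 0"
    proof
      fix p assume p: "p \<in> splits (a0 + b0) - {(a0, b0)}"
      show "mfps_nth f (fst p) * mfps_nth g (snd p) = 0"
      proof (rule ccontr)
        assume "mfps_nth f (fst p) * mfps_nth g (snd p) \<noteq> 0"
        moreover have "keys (fst p) \<subseteq> V" "keys (snd p) \<subseteq> V"
          using p splits_keys[of p "a0 + b0"] keys by auto
        ultimately have "fst p \<in> A" "snd p \<in> B"
          by (auto simp: A_def B_def)
        from *[OF this] p show False
          by (auto simp: splits_def)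
      qed
    qed
  qed auto
  finally have "mfps_nth (f * g) (a0 + b0) \<noteq> 0"
    using ab by (simp add: A_def B_def)
  then show "f * g \<noteq> 0"
    by (metis mfps_nth_0)
qed

section \<open>Division by units and passage to the field of fractions\<close>

lemma mfps_right_inverse_unique: "f * g = (1 :: ('v, 'a :: field) mfps) \<Longrightarrow> g = inverse f"
proof -
  assume fg: "f * g = 1"
  then have "mfps_nth f 0 * mfps_nth g 0 = 1"
    by (metis mfps_nth_mult_0 mfps_nth_1)
  then have *: "f * inverse f = 1"
    by (intro mfps_inverse_right) auto
  have "g = g * (f * inverse f)"
    by (simp add: *)
  also have "\<dots> = (f * g) * inverse f"
    by (simp only: mult_ac)
  finally show ?thesis
    by (simp add: fg)
qed

lemma mfps_nth_inverse_0: "mfps_nth (inverse f) 0 = inverse (mfps_nth (f :: ('v, 'a :: field) mfps) 0)"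
proof (cases "mfps_nth f 0 = 0")
  case False
  then have "mfps_nth (f * inverse f) 0 = 1"
    using mfps_inverse_right[OF False] by (simp add: mfps_nth_1)
  with False show ?thesis
    by (simp add: field_simps)
qed (simp add: inverse_mfps_def)

lemma mfps_nth_divide_0 [simp]:
  "mfps_nth (f / g) 0 = mfps_nth f 0 / mfps_nth (g :: ('v, 'a :: field) mfps) 0"
  by (simp add: divide_mfps_def mfps_nth_inverse_0 divide_inverse)

lemma mfps_divide_eq_iff:
  fixes f g h :: "('v, 'a :: field) mfps"
  assumes "mfps_nth g 0 \<noteq> 0"
  shows "f / g = h \<longleftrightarrow> f = h * g"
proof
  have g: "inverse g * g = 1"
    using mfps_inverse_right[OF assms] by (simp add: mult.commute)
  show "f = h * g" if "f / g = h"
    using that g by (metis divide_mfps_def mult.assoc mult.right_neutral)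
  show "f / g = h" if "f = h * g"
    using that mfps_inverse_right[OF assms] by (simp add: divide_mfps_def mult.assoc)
qed

text \<open>The constant term matters: for a nonzero \<open>g\<close> without one,
  \<open>f / g\<close> is 0 by convention in the ring, but not in the field of fractions unless
  \<open>f = 0\<close>.\<close>

lemma to_fract_divide:
  fixes f g :: "('v, 'a :: field) mfps"
  assumes "mfps_nth g 0 \<noteq> 0"
  shows "to_fract (f / g) = to_fract f / to_fract g"
proof -
  have "to_fract f = to_fract (f / g) * to_fract g"
    using mfps_divide_eq_iff[OF assms, of f "f / g"] by (metis to_fract_mult)
  moreover have "to_fract g \<noteq> 0"
    using assms by auto
  ultimately show ?thesis by simp
qed

lemma to_fract_prod: "to_fract (\<Prod>i\<in>A. f i) = (\<Prod>i\<in>A. to_fract (f i))"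
  by (induction A rule: infinite_finite_induct) auto

lemma to_fract_sum: "to_fract (\<Sum>i\<in>A. f i) = (\<Sum>i\<in>A. to_fract (f i))"
  by (induction A rule: infinite_finite_induct) auto

subsection \<open>Rescaling\<close>

definition rescale_factor :: "('v \<Rightarrow> 'a) \<Rightarrow> ('v \<Rightarrow>\<^sub>0 nat) \<Rightarrow> 'a :: comm_ring_1"
  where "rescale_factor c m = (\<Prod>v\<in>keys m. c v ^ lookup m v)"

lemma mfps_nth_rescale: "mfps_nth (mfps_rescale c f) m = rescale_factor c m * mfps_nth f m"
  by (simp add: mfps_rescale_def rescale_factor_def)

lemma rescale_factor_0 [simp]: "rescale_factor c 0 = 1"
  by (simp add: rescale_factor_def)

lemma mfps_nth_rescale_0 [simp]: "mfps_nth (mfps_rescale c f) 0 = mfps_nth f 0"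
  by (simp add: mfps_nth_rescale)

lemma mfps_rescale_add: "mfps_rescale c (f + g) = mfps_rescale c f + mfps_rescale c g"
  by (rule mfps_eqI) (simp add: mfps_nth_rescale algebra_simps)

lemma mfps_rescale_diff: "mfps_rescale c (f - g) = mfps_rescale c f - mfps_rescale c g"
  by (rule mfps_eqI) (simp add: mfps_nth_rescale algebra_simps)

lemma mfps_rescale_0: "mfps_rescale c 0 = 0"
  by (rule mfps_eqI) (simp add: mfps_nth_rescale)

lemma mfps_rescale_const: "mfps_rescale c (mfps_const d) = mfps_const d"
  by (rule mfps_eqI) (simp add: mfps_nth_rescale mfps_nth_const)

lemma mfps_rescale_sum: "mfps_rescale c (\<Sum>k\<in>A. F k) = (\<Sum>k\<in>A. mfps_rescale c (F k))"
  by (induction A rule: infinite_finite_induct) (auto simp: mfps_rescale_add mfps_rescale_0)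

lemma mfps_rescale_prod: "mfps_rescale c (\<Prod>k\<in>A. F k) = (\<Prod>k\<in>A. mfps_rescale c (F k))"
  by (induction A rule: infinite_finite_induct) (auto simp: mfps_rescale_mult mfps_rescale_1)

lemma mfps_rescale_power: "mfps_rescale c (f ^ k) = mfps_rescale c f ^ k"
  by (induction k) (auto simp: mfps_rescale_mult mfps_rescale_1)

lemma mfps_rescale_inverse: "mfps_rescale c (inverse f) = inverse (mfps_rescale c (f :: ('v, 'a :: field) mfps))"
proof (cases "mfps_nth f 0 = 0")
  case False
  then have "mfps_rescale c (f * inverse f) = 1"
    by (simp add: mfps_inverse_right mfps_rescale_1)
  then show ?thesis
    by (intro mfps_right_inverse_unique) (simp add: mfps_rescale_mult)
qed (simp add: inverse_mfps_def mfps_rescale_0)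

lemma mfps_rescale_divide:
  "mfps_rescale c (f / g) = mfps_rescale c f / mfps_rescale c (g :: ('v, 'a :: field) mfps)"
  by (simp add: divide_mfps_def mfps_rescale_mult mfps_rescale_inverse)

lemma mfps_rescale_rescale: "mfps_rescale c (mfps_rescale d f) = mfps_rescale (\<lambda>v. c v * d v) f"
  by (rule mfps_eqI)
    (simp add: mfps_nth_rescale rescale_factor_def power_mult_distrib prod.distrib mult_ac)

subsection \<open>Order of vanishing\<close>

definition ord_ge :: "nat \<Rightarrow> ('v, 'a :: comm_ring_1) mfps \<Rightarrow> bool"
  where "ord_ge k f \<longleftrightarrow> (\<forall>m. total_degree m < k \<longrightarrow> mfps_nth f m = 0)"

lemma ord_ge_0 [simp]: "ord_ge 0 f"
  by (simp add: ord_ge_def)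

lemma ord_ge_mult:
  assumes "ord_ge k f" "ord_ge l g"
  shows "ord_ge (k + l) (f * g)"
  unfolding ord_ge_def
proof (intro allI impI)
  fix m :: "'a \<Rightarrow>\<^sub>0 nat" assume m: "total_degree m < k + l"
  have "mfps_nth f a * mfps_nth g b = 0" if "a + b = m" for a b
  proof -
    from m that have "total_degree a < k \<or> total_degree b < l"
      by (auto simp: total_degree_add)
    with assms show ?thesis by (auto simp: ord_ge_def)
  qed
  then show "mfps_nth (f * g) m = 0"
    by (auto simp: mfps_nth_mult intro!: sum.neutral)
qed

lemma ord_ge_mult_left: "ord_ge k f \<Longrightarrow> ord_ge k (f * g)"
  using ord_ge_mult[of k f 0 g] by simp

lemma ord_ge_mult_right: "ord_ge k g \<Longrightarrow> ord_ge k (f * g)"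
  using ord_ge_mult[of 0 f k g] by simp

lemma ord_ge_power: "mfps_nth f 0 = 0 \<Longrightarrow> ord_ge k (f ^ k)"
  by (simp add: ord_ge_def mfps_power_nth_eq_0)

lemma ord_ge_prod: "(\<And>i. i \<in> A \<Longrightarrow> ord_ge (k i) (F i)) \<Longrightarrow> ord_ge (\<Sum>i\<in>A. k i) (\<Prod>i\<in>A. F i)"
  by (induction A rule: infinite_finite_induct) (auto intro: ord_ge_mult)

subsection \<open>Locally finite sums\<close>

text \<open>The infinite sums of the proof are of this kind. Each coefficient is then a finite sum,
  so that rescaling, multiplication and exchange of summation need no estimates.\<close>

definition locally_finite :: "('i \<Rightarrow> ('v, 'a :: comm_ring_1) mfps) \<Rightarrow> 'i set \<Rightarrow> bool"
  where "locally_finite f A \<longleftrightarrow> (\<forall>m. finite {i \<in> A. mfps_nth (f i) m \<noteq> 0})"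

lemma locally_finite_ord_ge:
  assumes "\<And>i. i \<in> A \<Longrightarrow> ord_ge (W i) (f i)" "\<And>d. finite {i \<in> A. W i \<le> d}"
  shows "locally_finite f A"
  unfolding locally_finite_def
proof
  fix m
  have "{i \<in> A. mfps_nth (f i) m \<noteq> 0} \<subseteq> {i \<in> A. W i \<le> total_degree m}"
    using assms(1) by (auto simp: ord_ge_def not_less[symmetric])
  then show "finite {i \<in> A. mfps_nth (f i) m \<noteq> 0}"
    using assms(2) finite_subset by blast
qed

lemma locally_finite_rescale: "locally_finite f A \<Longrightarrow> locally_finite (\<lambda>i. mfps_rescale c (f i)) A"
  unfolding locally_finite_def
proof
  fix m assume "\<forall>m. finite {i \<in> A. mfps_nth (f i) m \<noteq> 0}"
  then show "finite {i \<in> A. mfps_nth (mfps_rescale c (f i)) m \<noteq> 0}"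
    by (rule finite_subset[rotated, OF spec[of _ m]]) (auto simp: mfps_nth_rescale)
qed

context
  fixes f :: "'i \<Rightarrow> ('v, 'a :: {comm_ring_1, t2_space}) mfps" and A
  assumes lf: "locally_finite f A"
begin

lemma mfps_nth_infsum: "mfps_nth (infsum f A) m = (\<Sum>i | i \<in> A \<and> mfps_nth (f i) m \<noteq> 0. mfps_nth (f i) m)"
proof -
  have "(f has_sum Abs_mfps (\<lambda>m. \<Sum>i | i \<in> A \<and> mfps_nth (f i) m \<noteq> 0. mfps_nth (f i) m)) A"
    unfolding has_sum_mfps_iff
  proof
    fix m
    show "((\<lambda>i. mfps_nth (f i) m) has_sum
        mfps_nth (Abs_mfps (\<lambda>m. \<Sum>i | i \<in> A \<and> mfps_nth (f i) m \<noteq> 0. mfps_nth (f i) m)) m) A"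
      using lf by (intro has_sum_finite_neutralI[of "{i \<in> A. mfps_nth (f i) m \<noteq> 0}"])
        (auto simp: locally_finite_def)
  qed
  then show ?thesis
    by (simp add: infsumI)
qed

lemma mfps_nth_infsum_finite:
  assumes "finite B" "B \<subseteq> A" "\<And>i. i \<in> A - B \<Longrightarrow> mfps_nth (f i) m = 0"
  shows "mfps_nth (infsum f A) m = (\<Sum>i\<in>B. mfps_nth (f i) m)"
  unfolding mfps_nth_infsum using assms by (intro sum.mono_neutral_left) auto

lemma locally_finite_cmult: "locally_finite (\<lambda>i. g * f i) A"
  unfolding locally_finite_def
proof
  fix m
  have "{i \<in> A. mfps_nth (g * f i) m \<noteq> 0} \<subseteq> (\<Union>p\<in>splits m. {i \<in> A. mfps_nth (f i) (snd p) \<noteq> 0})"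
  proof
    fix i assume i: "i \<in> {i \<in> A. mfps_nth (g * f i) m \<noteq> 0}"
    then obtain p where "p \<in> splits m" "mfps_nth g (fst p) * mfps_nth (f i) (snd p) \<noteq> 0"
      by (auto simp: mfps_nth_mult case_prod_beta elim: sum.not_neutral_contains_not_neutral)
    then have "mfps_nth (f i) (snd p) \<noteq> 0" by auto
    with i \<open>p \<in> splits m\<close> show "i \<in> (\<Union>p\<in>splits m. {i \<in> A. mfps_nth (f i) (snd p) \<noteq> 0})"
      by blast
  qed
  moreover have "finite (\<Union>p\<in>splits m. {i \<in> A. mfps_nth (f i) (snd p) \<noteq> 0})"
    using lf by (auto simp: locally_finite_def)
  ultimately show "finite {i \<in> A. mfps_nth (g * f i) m \<noteq> 0}"
    by (rule finite_subset)
qed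

end

lemma infsum_rescale:
  fixes f :: "'i \<Rightarrow> ('v, 'a :: {comm_ring_1, t2_space}) mfps"
  assumes "locally_finite f A"
  shows "mfps_rescale c (infsum f A) = (\<Sum>\<^sub>\<infinity>i\<in>A. mfps_rescale c (f i))"
proof (rule mfps_eqI)
  fix m
  let ?B = "{i \<in> A. mfps_nth (f i) m \<noteq> 0}"
  have "mfps_nth (\<Sum>\<^sub>\<infinity>i\<in>A. mfps_rescale c (f i)) m = (\<Sum>i\<in>?B. mfps_nth (mfps_rescale c (f i)) m)"
    using assms by (intro mfps_nth_infsum_finite locally_finite_rescale)
      (auto simp: locally_finite_def mfps_nth_rescale)
  then show "mfps_nth (mfps_rescale c (infsum f A)) m = mfps_nth (\<Sum>\<^sub>\<infinity>i\<in>A. mfps_rescale c (f i)) m"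
    using assms by (simp add: mfps_nth_rescale mfps_nth_infsum sum_distrib_left)
qed

lemma infsum_mult_left_mfps:
  fixes f :: "'i \<Rightarrow> ('v, 'a :: {comm_ring_1, t2_space}) mfps"
  assumes lf: "locally_finite f A"
  shows "g * infsum f A = (\<Sum>\<^sub>\<infinity>i\<in>A. g * f i)"
proof (rule mfps_eqI)
  fix m
  define B where "B = (\<Union>p\<in>splits m. {i \<in> A. mfps_nth (f i) (snd p) \<noteq> 0})"
  have B: "finite B" "B \<subseteq> A"
    using lf by (auto simp: locally_finite_def B_def)
  have 0: "mfps_nth (f i) (snd p) = 0" if "i \<in> A - B" "p \<in> splits m" for i p
    using that by (auto simp: B_def)
  have "mfps_nth (g * infsum f A) m = (\<Sum>p\<in>splits m. mfps_nth g (fst p) * (\<Sum>i\<in>B. mfps_nth (f i) (snd p)))"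
    unfolding mfps_nth_mult case_prod_beta
    by (intro sum.cong refl arg_cong2[of _ _ _ _ "(*)"] mfps_nth_infsum_finite lf B 0)
  also have "\<dots> = (\<Sum>i\<in>B. mfps_nth (g * f i) m)"
    unfolding mfps_nth_mult case_prod_beta sum_distrib_left by (rule sum.swap)
  also have "\<dots> = mfps_nth (\<Sum>\<^sub>\<infinity>i\<in>A. g * f i) m"
    by (intro mfps_nth_infsum_finite[symmetric] locally_finite_cmult lf B)
      (simp add: mfps_nth_mult case_prod_beta 0)
  finally show "mfps_nth (g * infsum f A) m = mfps_nth (\<Sum>\<^sub>\<infinity>i\<in>A. g * f i) m" .
qed

lemma locally_finite_sum:
  assumes "finite K" "\<And>k. k \<in> K \<Longrightarrow> locally_finite (f k) A"
  shows "locally_finite (\<lambda>i. \<Sum>k\<in>K. f k i) A"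
  unfolding locally_finite_def
proof
  fix m
  have "{i \<in> A. mfps_nth (\<Sum>k\<in>K. f k i) m \<noteq> 0} \<subseteq> (\<Union>k\<in>K. {i \<in> A. mfps_nth (f k i) m \<noteq> 0})"
    by (auto simp: mfps_nth_sum elim: sum.not_neutral_contains_not_neutral)
  moreover have "finite (\<Union>k\<in>K. {i \<in> A. mfps_nth (f k i) m \<noteq> 0})"
    using assms by (auto simp: locally_finite_def)
  ultimately show "finite {i \<in> A. mfps_nth (\<Sum>k\<in>K. f k i) m \<noteq> 0}"
    by (rule finite_subset)
qed

lemma sum_infsum_mfps:
  fixes f :: "'k \<Rightarrow> 'i \<Rightarrow> ('v, 'a :: {comm_ring_1, t2_space}) mfps"
  assumes "finite K" "\<And>k. k \<in> K \<Longrightarrow> locally_finite (f k) A"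
  shows "(\<Sum>k\<in>K. infsum (f k) A) = (\<Sum>\<^sub>\<infinity>i\<in>A. \<Sum>k\<in>K. f k i)"
proof (rule mfps_eqI)
  fix m
  define B where "B = (\<Union>k\<in>K. {i \<in> A. mfps_nth (f k i) m \<noteq> 0})"
  have B: "finite B" "B \<subseteq> A"
    using assms by (auto simp: locally_finite_def B_def)
  have 0: "mfps_nth (f k i) m = 0" if "i \<in> A - B" "k \<in> K" for i k
    using that by (auto simp: B_def)
  have "mfps_nth (\<Sum>k\<in>K. infsum (f k) A) m = (\<Sum>k\<in>K. \<Sum>i\<in>B. mfps_nth (f k i) m)"
    unfolding mfps_nth_sum by (intro sum.cong refl mfps_nth_infsum_finite assms B 0)
  also have "\<dots> = (\<Sum>i\<in>B. mfps_nth (\<Sum>k\<in>K. f k i) m)"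
    unfolding mfps_nth_sum by (rule sum.swap)
  also have "\<dots> = mfps_nth (\<Sum>\<^sub>\<infinity>i\<in>A. \<Sum>k\<in>K. f k i) m"
    by (intro mfps_nth_infsum_finite[symmetric] locally_finite_sum assms B)
      (auto simp: mfps_nth_sum 0 intro!: sum.neutral)
  finally show "mfps_nth (\<Sum>k\<in>K. infsum (f k) A) m = mfps_nth (\<Sum>\<^sub>\<infinity>i\<in>A. \<Sum>k\<in>K. f k i) m" .
qed

lemma infsum_Times_mfps:
  fixes f :: "'i \<Rightarrow> 'j \<Rightarrow> ('v, 'a :: {comm_ring_1, t2_space}) mfps"
  assumes lf: "locally_finite (\<lambda>(i, j). f i j) (A \<times> B)"
  shows "(\<Sum>\<^sub>\<infinity>i\<in>A. \<Sum>\<^sub>\<infinity>j\<in>B. f i j) = (\<Sum>\<^sub>\<infinity>(i, j)\<in>A \<times> B. f i j)"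
proof -
  \<comment> \<open>For one coefficient only finitely many pairs contribute; the projections of this
    set turn the iterated sum into a sum over a finite rectangle.\<close>
  define C where "C m = {p \<in> A \<times> B. mfps_nth (f (fst p) (snd p)) m \<noteq> 0}" for m
  have C: "finite (C m)" for m
    using lf by (simp add: locally_finite_def C_def case_prod_beta)
  define A' where "A' m = fst ` C m" for m
  define B' where "B' m = snd ` C m" for m
  have fin: "finite (A' m)" "finite (B' m)" "A' m \<subseteq> A" "B' m \<subseteq> B" for m
    using C by (auto simp: A'_def B'_def C_def)
  have 0: "mfps_nth (f i j) m = 0" if "i \<in> A" "j \<in> B" "i \<notin> A' m \<or> j \<notin> B' m" for i j m
    using that by (force simp: A'_def B'_def C_def)
  have lf1: "locally_finite (f i) B" if "i \<in> A" for i
    unfolding locally_finite_def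
  proof
    fix m show "finite {j \<in> B. mfps_nth (f i j) m \<noteq> 0}"
      using that 0 by (intro finite_subset[OF _ fin(2)[of m]]) auto
  qed
  have inner: "mfps_nth (\<Sum>\<^sub>\<infinity>j\<in>B. f i j) m = (\<Sum>j\<in>B' m. mfps_nth (f i j) m)" if "i \<in> A" for i m
    using that 0 by (intro mfps_nth_infsum_finite lf1 fin) auto
  have lf2: "locally_finite (\<lambda>i. \<Sum>\<^sub>\<infinity>j\<in>B. f i j) A"
    unfolding locally_finite_def
  proof
    fix m show "finite {i \<in> A. mfps_nth (\<Sum>\<^sub>\<infinity>j\<in>B. f i j) m \<noteq> 0}"
    proof (rule finite_subset[OF _ fin(1)[of m]], safe, rule ccontr)
      fix i assume i: "i \<in> A" "mfps_nth (\<Sum>\<^sub>\<infinity>j\<in>B. f i j) m \<noteq> 0" "i \<notin> A' m"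
      then have "(\<Sum>j\<in>B' m. mfps_nth (f i j) m) = 0"
        using fin(4)[of m] by (intro sum.neutral) (auto simp: 0 subset_iff)
      with i inner show False by simp
    qed
  qed
  show "(\<Sum>\<^sub>\<infinity>i\<in>A. \<Sum>\<^sub>\<infinity>j\<in>B. f i j) = (\<Sum>\<^sub>\<infinity>(i, j)\<in>A \<times> B. f i j)"
  proof (rule mfps_eqI)
    fix m
    have "mfps_nth (\<Sum>\<^sub>\<infinity>i\<in>A. \<Sum>\<^sub>\<infinity>j\<in>B. f i j) m = (\<Sum>i\<in>A' m. mfps_nth (\<Sum>\<^sub>\<infinity>j\<in>B. f i j) m)"
      using fin(4)[of m]
      by (intro mfps_nth_infsum_finite lf2 fin) (auto simp: inner 0 subset_iff intro!: sum.neutral)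
    also have "\<dots> = (\<Sum>i\<in>A' m. \<Sum>j\<in>B' m. mfps_nth (f i j) m)"
      using fin by (intro sum.cong refl inner) auto
    also have "\<dots> = (\<Sum>p\<in>A' m \<times> B' m. mfps_nth ((\<lambda>(i, j). f i j) p) m)"
      by (simp add: sum.cartesian_product case_prod_beta)
    also have "\<dots> = mfps_nth (\<Sum>\<^sub>\<infinity>(i, j)\<in>A \<times> B. f i j) m"
      using fin(3,4)[of m]
      by (intro mfps_nth_infsum_finite[symmetric] lf finite_cartesian_product Sigma_mono fin)
        (auto simp: subset_iff intro: ccontr[OF notE[OF _ 0]])
    finally show "mfps_nth (\<Sum>\<^sub>\<infinity>i\<in>A. \<Sum>\<^sub>\<infinity>j\<in>B. f i j) m = mfps_nth (\<Sum>\<^sub>\<infinity>(i, j)\<in>A \<times> B. f i j) m" .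
  qed
qed

lemma infsum_swap_mfps:
  fixes f :: "'i \<Rightarrow> 'j \<Rightarrow> ('v, 'a :: {comm_ring_1, t2_space}) mfps"
  assumes "locally_finite (\<lambda>(i, j). f i j) (A \<times> B)"
  shows "(\<Sum>\<^sub>\<infinity>i\<in>A. \<Sum>\<^sub>\<infinity>j\<in>B. f i j) = (\<Sum>\<^sub>\<infinity>j\<in>B. \<Sum>\<^sub>\<infinity>i\<in>A. f i j)"
proof -
  have bij: "bij_betw prod.swap (B \<times> A) (A \<times> B)"
    by (rule bij_betwI[where g = prod.swap]) auto
  have "locally_finite (\<lambda>(j, i). f i j) (B \<times> A)"
    unfolding locally_finite_def
  proof
    fix m
    have "finite (prod.swap ` {p \<in> A \<times> B. mfps_nth (case p of (i, j) \<Rightarrow> f i j) m \<noteq> 0})"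
      using assms by (simp add: locally_finite_def)
    then show "finite {p \<in> B \<times> A. mfps_nth (case p of (j, i) \<Rightarrow> f i j) m \<noteq> 0}"
      by (rule finite_subset[rotated]) (auto simp: image_iff)
  qed
  then have "(\<Sum>\<^sub>\<infinity>j\<in>B. \<Sum>\<^sub>\<infinity>i\<in>A. f i j) = (\<Sum>\<^sub>\<infinity>(j, i)\<in>B \<times> A. f i j)"
    by (rule infsum_Times_mfps)
  also have "\<dots> = (\<Sum>\<^sub>\<infinity>(i, j)\<in>A \<times> B. f i j)"
    using infsum_reindex_bij_betw[OF bij, of "\<lambda>p. f (fst p) (snd p)"] by (simp add: case_prod_beta')
  finally show ?thesis
    using infsum_Times_mfps[OF assms] by simp
qed

lemma mfps_const_uminus: "mfps_const (- c) = - (mfps_const c :: ('v, 'a :: comm_ring_1) mfps)"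
  by (rule mfps_eqI) (simp add: mfps_nth_const)

lemma mfps_const_diff: "mfps_const (c - d) = mfps_const c - (mfps_const d :: ('v, 'a :: comm_ring_1) mfps)"
  by (rule mfps_eqI) (simp add: mfps_nth_const)

lemma tendsto_mult_mfps:
  fixes f g :: "'i \<Rightarrow> ('v, complex) mfps"
  assumes "(f \<longlongrightarrow> a) F" "(g \<longlongrightarrow> b) F"
  shows "((\<lambda>x. f x * g x) \<longlongrightarrow> a * b) F"
  using assms unfolding tendsto_mfps_iff mfps_nth_mult case_prod_beta
  by (auto intro!: tendsto_intros)

lemma infsum_nat_split_0:
  fixes f :: "nat \<Rightarrow> ('v, complex) mfps"
  assumes lf: "locally_finite f UNIV"
  shows "infsum f UNIV = f 0 + (\<Sum>\<^sub>\<infinity>k. f (Suc k))"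
proof (rule mfps_eqI)
  fix m
  have fin: "finite {k. mfps_nth (f k) m \<noteq> 0}" for m
    using lf by (simp add: locally_finite_def)
  then obtain N where N: "mfps_nth (f k) m = 0" if "k \<ge> N" for k
    unfolding finite_nat_set_iff_bounded by (metis mem_Collect_eq not_less)
  have lf': "locally_finite (\<lambda>k. f (Suc k)) UNIV"
    unfolding locally_finite_def
    using finite_vimageI[OF fin, of Suc] by (simp add: vimage_def)
  have "mfps_nth (infsum f UNIV) m = (\<Sum>k<Suc N. mfps_nth (f k) m)"
    by (intro mfps_nth_infsum_finite lf) (auto intro!: N)
  also have "\<dots> = mfps_nth (f 0) m + (\<Sum>k<N. mfps_nth (f (Suc k)) m)"
    by (rule sum.lessThan_Suc_shift)
  also have "(\<Sum>k<N. mfps_nth (f (Suc k)) m) = mfps_nth (\<Sum>\<^sub>\<infinity>k. f (Suc k)) m"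
    by (intro mfps_nth_infsum_finite[symmetric] lf') (auto intro!: N)
  finally show "mfps_nth (infsum f UNIV) m = mfps_nth (f 0 + (\<Sum>\<^sub>\<infinity>k. f (Suc k))) m"
    by simp
qed

section \<open>Ratios, shifts and Pochhammer symbols\<close>

definition ratio_exponent :: "alphabet \<Rightarrow> nat \<Rightarrow> nat \<Rightarrow> (alphabet \<times> nat \<Rightarrow>\<^sub>0 nat)"
  where "ratio_exponent a i j = (\<Sum>k\<in>{i..<j}. Poly_Mapping.single (a, k) 1)"

lemma lookup_ratio_exponent:
  "lookup (ratio_exponent a i j) (b, k) = (if b = a \<and> i \<le> k \<and> k < j then 1 else 0)"
proof -
  have "lookup (ratio_exponent a i j) (b, k) = (\<Sum>l\<in>{i..<j}. if l = k then (if b = a then 1 else 0) else 0)"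
    unfolding ratio_exponent_def lookup_sum by (intro sum.cong) (auto simp: lookup_single when_def)
  then show ?thesis by simp
qed

lemma mfps_nth_ratio: "mfps_nth (ratio a i j) m = (if m = ratio_exponent a i j then 1 else 0)"
proof (cases "i \<le> j")
  case True
  then show ?thesis
  proof (induction j arbitrary: m rule: dec_induct)
    case base
    show ?case by (simp add: ratio_def ratio_exponent_def mfps_nth_1)
  next
    case (step j)
    have "mfps_nth (ratio a i (Suc j)) m = mfps_nth (ratio a i j * mfps_var (a, j)) m"
      using step.hyps by (simp add: ratio_def)
    also have "\<dots> = (\<Sum>p\<in>splits m. if p = (ratio_exponent a i j, Poly_Mapping.single (a, j) 1) then 1 else 0)"
      unfolding mfps_nth_mult
      by (intro sum.cong) (auto simp: step.IH mfps_var_def split: if_splits)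
    also have "\<dots> = (if (ratio_exponent a i j, Poly_Mapping.single (a, j) 1) \<in> splits m then 1 else 0)"
      by (simp only: sum.delta finite_splits)
    also have "ratio_exponent a i j + Poly_Mapping.single (a, j) 1 = ratio_exponent a i (Suc j)"
      using step.hyps by (simp add: ratio_exponent_def)
    then have "((ratio_exponent a i j, Poly_Mapping.single (a, j) 1) \<in> splits m) = (m = ratio_exponent a i (Suc j))"
      by auto
    finally show ?case .
  qed
qed (simp add: ratio_def ratio_exponent_def mfps_nth_1)

lemma ratio_refl [simp]: "ratio a i i = 1"
  by (simp add: ratio_def)

lemma ratio_mult: "i \<le> j \<Longrightarrow> j \<le> k \<Longrightarrow> ratio a i j * ratio a j k = ratio a i k"
  unfolding ratio_def by (subst prod.union_disjoint[symmetric]) (auto simp: ivl_disj_un)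

lemma mfps_nth_ratio_0 [simp]: "i < j \<Longrightarrow> mfps_nth (ratio a i j) 0 = 0"
  using lookup_ratio_exponent[of a i j a i] by (auto simp: mfps_nth_ratio split: if_splits)

lemma ratio_neq_0: "ratio a i j \<noteq> 0"
proof
  assume "ratio a i j = 0"
  then have "mfps_nth (ratio a i j) (ratio_exponent a i j) = 0" by simp
  then show False by (simp add: mfps_nth_ratio)
qed

lemmas qshift_simps =
  mfps_rescale_add mfps_rescale_diff mfps_rescale_const mfps_rescale_1 mfps_rescale_mult
  mfps_rescale_divide mfps_rescale_power mfps_rescale_prod mfps_rescale_sum

lemma qshift_ratio_other: "a \<noteq> b \<Longrightarrow> qshift q a e (ratio b i j) = ratio b i j"
  by (simp add: qshift_def ratio_def mfps_rescale_prod mfps_rescale_var mfps_const_1)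

lemma mfps_rescale_qpoch: "mfps_rescale c (qpoch q z k) = qpoch q (mfps_rescale c z) k"
  by (simp add: qpoch_def qshift_simps)

text \<open>Rescaling multiplies each coefficient by a fixed number, so it is continuous and passes
  through the limit of the finite products.\<close>

lemma mfps_rescale_qpoch_inf:
  assumes q: "norm q < 1" and z: "mfps_nth z 0 = 0"
  shows "mfps_rescale c (qpoch_inf q z) = qpoch_inf q (mfps_rescale c z)"
proof -
  have "(\<lambda>k. mfps_rescale c (qpoch q z k)) \<longlonglongrightarrow> mfps_rescale c (qpoch_inf q z)"
    using qpoch_LIMSEQ(1)[OF assms] unfolding tendsto_mfps_iff mfps_nth_rescale
    by (auto intro!: tendsto_intros)
  moreover have "(\<lambda>k. mfps_rescale c (qpoch q z k)) \<longlonglongrightarrow> qpoch_inf q (mfps_rescale c z)"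
    unfolding mfps_rescale_qpoch using z by (intro qpoch_LIMSEQ q) simp
  ultimately show ?thesis
    by (rule LIMSEQ_unique)
qed

lemma qshift_qshift:
  assumes "q \<noteq> 0"
  shows "qshift q a e (qshift q a e' f) = qshift q a (\<lambda>i. e i + e' i) f"
proof -
  have "(\<lambda>v. (case v of (b, k) \<Rightarrow> if b = a then q powi (e (Suc k) - e k) else 1) *
        (case v of (b, k) \<Rightarrow> if b = a then q powi (e' (Suc k) - e' k) else 1)) =
      (\<lambda>(b, k). if b = a then q powi ((e (Suc k) + e' (Suc k)) - (e k + e' k)) else 1)"
    using assms by (auto simp: fun_eq_iff algebra_simps simp flip: power_int_add)
  then show ?thesis
    unfolding qshift_def mfps_rescale_rescale by simp
qed

lemma qshift_commute: "qshift q a e (qshift q b e' f) = qshift q b e' (qshift q a e f)"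
  unfolding qshift_def mfps_rescale_rescale by (simp add: mult.commute)

lemma mfps_rescale_trivial: "(\<And>v. c v = 1) \<Longrightarrow> mfps_rescale c f = f"
  by (intro mfps_eqI) (simp add: mfps_nth_rescale rescale_factor_def)

lemma qshift_zero [simp]: "qshift q a (\<lambda>_. 0) f = f"
  unfolding qshift_def by (rule mfps_rescale_trivial) auto

lemma qpoch_0 [simp]: "qpoch q z 0 = 1"
  by (simp add: qpoch_def)

lemma qpoch_const: "qpoch q (mfps_const c) k = mfps_const (\<Prod>i<k. 1 - q ^ i * c)"
proof (induction k)
  case (Suc k)
  have "(1 :: ratio_series) - mfps_const d = mfps_const (1 - d)" for d :: complex
    by (rule mfps_eqI) (simp add: mfps_nth_1 mfps_nth_const)
  with Suc show ?case
    by (simp add: qpoch_def flip: mfps_const_mult)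
qed (simp add: mfps_const_1)

text \<open>\<open>q\<close> is not a root of unity, so the finite products \<open>(q; q)_k\<close>
  may stand in denominators.\<close>

lemma one_minus_power_neq_0:
  assumes "norm q < 1" "k > 0"
  shows "1 - q ^ k \<noteq> (0 :: complex)"
proof
  assume "1 - q ^ k = 0"
  then have "norm (q ^ k) = 1" by simp
  moreover have "norm (q ^ k) < 1"
    using assms by (simp add: norm_power power_Suc_less_one power_less_one_iff)
  ultimately show False by simp
qed

lemma qfact_neq_0: "norm q < 1 \<Longrightarrow> (\<Prod>i<k. 1 - q ^ i * q) \<noteq> (0 :: complex)"
  using one_minus_power_neq_0[of q "Suc _"] by (simp add: mult.commute)

lemma qpoch_inf_shift:
  assumes q: "norm q < 1" and z: "mfps_nth z 0 = 0"
  shows "qpoch q z k * qpoch_inf q (mfps_const (q ^ k) * z) = qpoch_inf q z"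
proof -
  have "mfps_nth (qpoch_inf q (mfps_const (q ^ k) * z)) 0 \<noteq> 0"
    using qpoch_LIMSEQ(2)[OF q, of "mfps_const (q ^ k) * z"] z by simp
  then show ?thesis
    using mfps_divide_eq_iff[of "qpoch_inf q (mfps_const (q ^ k) * z)" "qpoch_inf q z" "qpoch q z k"]
      qpoch_eq_divide[OF assms, of k] by simp
qed

subsection \<open>The q-binomial theorem\<close>

text \<open>If F(z) is the left-hand side, the recursion of its coefficients amounts to (1 - z) F(z)
  = (1 - t z) F(q z). Iteration moves the argument to q^N z, where F tends to 1
  coefficientwise.\<close>

lemma q_binomial:
  assumes q: "norm q < 1" and z: "mfps_nth z 0 = 0"
  shows "(\<Sum>\<^sub>\<infinity>k. qpoch q (mfps_const t) k / qpoch q (mfps_const q) k * z ^ k) =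
    qpoch_inf q (mfps_const t * z) / qpoch_inf q z"
proof -
  define c where "c k = (\<Prod>i<k. 1 - q ^ i * t) / (\<Prod>i<k. 1 - q ^ i * q)" for k
  have c_Suc: "c (Suc k) * (1 - q ^ Suc k) = c k * (1 - q ^ k * t)" for k
  proof -
    have "1 - q ^ k * q \<noteq> 0"
      using one_minus_power_neq_0[OF q, of "Suc k"] by (simp add: mult.commute)
    then show ?thesis
      by (simp add: c_def mult.commute)
  qed
  have c: "qpoch q (mfps_const t) k / qpoch q (mfps_const q) k = mfps_const (c k)" for k
    using qfact_neq_0[OF q]
    by (subst mfps_divide_eq_iff) (simp_all add: qpoch_const c_def mfps_nth_const flip: mfps_const_mult)
  \<comment> \<open>The terms of the series with z replaced by q^N z.\<close>
  define T where "T N k = mfps_const (c k * q ^ (N * k)) * z ^ k" for N k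
  have lf: "locally_finite (\<lambda>k. mfps_const (d k) * z ^ k) UNIV" for d :: "nat \<Rightarrow> complex"
    by (rule locally_finite_ord_ge[where W = "\<lambda>k. k"]) (auto intro: ord_ge_mult_right ord_ge_power z)
  define S where "S N = infsum (T N) UNIV" for N
  have lfT: "locally_finite (T N) UNIV" for N
    unfolding T_def by (rule lf)
  have step: "(1 - mfps_const (q ^ N) * z) * S N = (1 - mfps_const (q ^ N) * (mfps_const t * z)) * S (Suc N)" for N
  proof -
    \<comment> \<open>The coefficients of \<open>S N - S (Suc N)\<close>. The factor
      \<open>1 - q ^ k\<close> removes the constant term and, by \<open>c_Suc\<close>, turns
      \<open>c (Suc k)\<close> into \<open>c k\<close>, so that the index can be moved by
      one.\<close>
    define d where "d k = c k * q ^ (N * k) * (1 - q ^ k)" for k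
    let ?f = "\<lambda>k. mfps_const (d k) * z ^ k"
    have eqs: "S N = (\<Sum>\<^sub>\<infinity>k. ?f k + T (Suc N) k)"
      unfolding S_def
      by (intro infsum_cong mfps_eqI)
        (simp only: T_def d_def mfps_nth_add mfps_nth_const_mult, simp add: algebra_simps power_add)
    have add: "(\<Sum>\<^sub>\<infinity>k. f k + g k) = infsum f UNIV + infsum g UNIV"
      if "locally_finite f UNIV" "locally_finite g UNIV" for f g :: "nat \<Rightarrow> ratio_series"
      using sum_infsum_mfps[of "UNIV :: bool set" "\<lambda>b. if b then f else g" UNIV] that
      by (simp add: UNIV_bool add.commute)
    have SN: "S N = infsum ?f UNIV + S (Suc N)"
      by (subst eqs, unfold S_def) (intro add lf lfT)
    have term_eq: "?f (Suc k) = mfps_const (q ^ N) * z * (T N k + mfps_const (- t) * T (Suc N) k)" for k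
    proof -
      have "d (Suc k) = q ^ N * (c k * q ^ (N * k)) - q ^ N * t * (c k * q ^ (Suc N * k))"
      proof -
        have "d (Suc k) = c (Suc k) * (1 - q ^ Suc k) * q ^ (N * Suc k)"
          by (simp add: d_def)
        also have "\<dots> = c k * (1 - q ^ k * t) * (q ^ N * q ^ (N * k))"
          unfolding c_Suc by (simp add: power_add)
        finally show ?thesis
          by (simp add: algebra_simps power_add)
      qed
      then have "mfps_const (d (Suc k)) = mfps_const (q ^ N) *
          (mfps_const (c k * q ^ (N * k)) + mfps_const (- t) * (mfps_const (c k * q ^ (Suc N * k)) :: ratio_series))"
        by (intro mfps_eqI) (simp add: mfps_nth_const algebra_simps)
      then show ?thesis
        unfolding T_def power_Suc by (simp only: algebra_simps)
    qed
    have "infsum ?f UNIV = (\<Sum>\<^sub>\<infinity>k. ?f (Suc k))"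
      using infsum_nat_split_0[OF lf, of d] by (simp add: d_def mfps_const_def zero_mfps_def[symmetric])
    also have "\<dots> = (\<Sum>\<^sub>\<infinity>k. mfps_const (q ^ N) * z * (T N k + mfps_const (- t) * T (Suc N) k))"
      by (intro infsum_cong term_eq)
    also have "\<dots> =
        mfps_const (q ^ N) * z * (S N + mfps_const (- t) * S (Suc N))"
    proof -
      let ?g = "\<lambda>k. T N k + mfps_const (- t) * T (Suc N) k"
      have "locally_finite ?g UNIV"
        using locally_finite_sum[of "UNIV :: bool set" "\<lambda>b. if b then T N else (\<lambda>k. mfps_const (- t) * T (Suc N) k)" UNIV]
        by (simp add: UNIV_bool add.commute lfT locally_finite_cmult)
      from infsum_mult_left_mfps[OF this, of "mfps_const (q ^ N) * z"] show ?thesis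
        by (simp add: S_def add lfT locally_finite_cmult infsum_mult_left_mfps)
    qed
    finally show ?thesis
      using SN by (simp add: algebra_simps mfps_const_uminus)
  qed
  have "qpoch q z N * S 0 = qpoch q (mfps_const t * z) N * S N" for N
  proof (induction N)
    case (Suc N)
    have "qpoch q z (Suc N) * S 0 = (1 - mfps_const (q ^ N) * z) * (qpoch q z N * S 0)"
      by (simp add: qpoch_def mult_ac)
    also have "\<dots> = qpoch q (mfps_const t * z) N * ((1 - mfps_const (q ^ N) * z) * S N)"
      by (simp only: Suc) (simp only: mult_ac)
    also have "\<dots> = qpoch q (mfps_const t * z) (Suc N) * S (Suc N)"
      by (simp only: step) (simp add: qpoch_def mult_ac)
    finally show ?case .
  qed simp
  moreover have "S \<longlonglongrightarrow> 1"
    unfolding tendsto_mfps_iff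
  proof
    fix m :: "alphabet \<times> nat \<Rightarrow>\<^sub>0 nat"
    have "mfps_nth (S N) m = (\<Sum>k\<le>total_degree m. mfps_nth (T N k) m)" for N
      unfolding S_def
      by (intro mfps_nth_infsum_finite lfT) (auto simp: T_def mfps_power_nth_eq_0 z)
    moreover have "(\<lambda>N. \<Sum>k\<le>total_degree m. mfps_nth (T N k) m) \<longlonglongrightarrow>
        (\<Sum>k\<le>total_degree m. if k = 0 then mfps_nth 1 m else 0)"
    proof (intro tendsto_sum)
      fix k
      show "(\<lambda>N. mfps_nth (T N k) m) \<longlonglongrightarrow> (if k = 0 then mfps_nth 1 m else 0)"
      proof (cases "k = 0")
        case False
        then have "norm (q ^ k) < 1"
          using q by (simp add: norm_power power_less_one_iff)
        then have "(\<lambda>N. (q ^ k) ^ N) \<longlonglongrightarrow> 0"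
          by (rule LIMSEQ_power_zero)
        then have "(\<lambda>N. c k * (q ^ k) ^ N * mfps_nth (z ^ k) m) \<longlonglongrightarrow> c k * 0 * mfps_nth (z ^ k) m"
          by (intro tendsto_mult tendsto_const)
        with False show ?thesis
          by (simp add: T_def mult.commute[of _ k] power_mult)
      qed (simp add: T_def c_def mfps_const_1)
    qed
    ultimately show "(\<lambda>N. mfps_nth (S N) m) \<longlonglongrightarrow> mfps_nth 1 m"
      by simp
  qed
  then have "(\<lambda>N. qpoch q (mfps_const t * z) N * S N) \<longlonglongrightarrow> qpoch_inf q (mfps_const t * z) * 1"
    using z by (intro tendsto_mult_mfps qpoch_LIMSEQ q) simp_all
  moreover have "(\<lambda>N. qpoch q z N * S 0) \<longlonglongrightarrow> qpoch_inf q z * S 0"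
    by (intro tendsto_mult_mfps qpoch_LIMSEQ tendsto_const q z)
  ultimately have "qpoch_inf q z * S 0 = qpoch_inf q (mfps_const t * z) * 1"
    by (auto intro: LIMSEQ_unique)
  then have "qpoch_inf q (mfps_const t * z) / qpoch_inf q z = S 0"
    using qpoch_LIMSEQ(2)[OF assms] by (subst mfps_divide_eq_iff) (auto simp: mult.commute)
  then show ?thesis
    by (simp add: S_def T_def[abs_def] c)
qed

subsection \<open>Sums over vectors\<close>

abbreviation vec_size :: "nat \<Rightarrow> (nat \<Rightarrow> nat) \<Rightarrow> nat"
  where "vec_size n \<nu> \<equiv> \<Sum>i\<in>{1..n}. \<nu> i"

lemma finite_nat_vecs_le: "finite {\<nu> \<in> nat_vecs n. vec_size n \<nu> \<le> d}"
proof (rule finite_subset)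
  show "finite {f. \<forall>x. (x \<in> {1..n} \<longrightarrow> f x \<in> {..d}) \<and> (x \<notin> {1..n} \<longrightarrow> f x = (0 :: nat))}"
    by (rule finite_set_of_finite_funs) auto
  show "{\<nu> \<in> nat_vecs n. vec_size n \<nu> \<le> d} \<subseteq>
      {f. \<forall>x. (x \<in> {1..n} \<longrightarrow> f x \<in> {..d}) \<and> (x \<notin> {1..n} \<longrightarrow> f x = (0 :: nat))}"
  proof
    fix \<nu> assume \<nu>: "\<nu> \<in> {\<nu> \<in> nat_vecs n. vec_size n \<nu> \<le> d}"
    have "\<nu> x \<le> vec_size n \<nu>" if "x \<in> {1..n}" for x
      using that by (intro member_le_sum) auto
    then show "\<nu> \<in> {f. \<forall>x. (x \<in> {1..n} \<longrightarrow> f x \<in> {..d}) \<and> (x \<notin> {1..n} \<longrightarrow> f x = (0 :: nat))}"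
      using \<nu> by (fastforce simp: nat_vecs_def intro: order_trans)
  qed
qed

lemma nat_vecs_0 [simp]: "nat_vecs 0 = {\<lambda>_. 0}"
  by (auto simp: nat_vecs_def)

lemma bij_betw_nat_vecs_Suc:
  "bij_betw (\<lambda>(k, \<nu>). \<nu>(Suc n := k)) (UNIV \<times> nat_vecs n) (nat_vecs (Suc n))"
  by (rule bij_betwI[where g = "\<lambda>\<nu>. (\<nu> (Suc n), \<nu>(Suc n := 0))"])
     (auto simp: nat_vecs_def fun_eq_iff)

text \<open>Serves the constant term of \<open>K\<close>, where the sum over all vectors splits into
  one q-binomial series for each variable.\<close>

lemma infsum_nat_vecs_prod:
  fixes f :: "nat \<Rightarrow> nat \<Rightarrow> ratio_series"
  assumes f: "\<And>i k. ord_ge k (f i k)"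
  shows "(\<Sum>\<^sub>\<infinity>\<nu>\<in>nat_vecs n. \<Prod>i\<in>{1..n}. f i (\<nu> i)) = (\<Prod>i\<in>{1..n}. \<Sum>\<^sub>\<infinity>k. f i k)"
proof (induction n)
  case (Suc n)
  let ?P = "\<lambda>\<nu>. \<Prod>i\<in>{1..n}. f i (\<nu> i)"
  have lf1: "locally_finite ?P (nat_vecs n)"
    by (rule locally_finite_ord_ge[where W = "vec_size n"]) (intro ord_ge_prod f finite_nat_vecs_le)+
  have lf2: "locally_finite (f i) UNIV" for i
    by (rule locally_finite_ord_ge[where W = "\<lambda>k. k"]) (auto intro: f)
  have lf: "locally_finite (\<lambda>(k, \<nu>). f (Suc n) k * ?P \<nu>) (UNIV \<times> nat_vecs n)"
  proof (rule locally_finite_ord_ge[where W = "\<lambda>(k, \<nu>). k + vec_size n \<nu>"])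
    show "finite {p \<in> UNIV \<times> nat_vecs n. (case p of (k, \<nu>) \<Rightarrow> k + vec_size n \<nu>) \<le> d}" for d
      by (rule finite_subset[of _ "{..d} \<times> {\<nu> \<in> nat_vecs n. vec_size n \<nu> \<le> d}"])
        (auto intro!: finite_cartesian_product finite_nat_vecs_le)
  qed (auto intro!: ord_ge_mult ord_ge_prod f)
  have "(\<Sum>\<^sub>\<infinity>\<nu>\<in>nat_vecs (Suc n). \<Prod>i\<in>{1..Suc n}. f i (\<nu> i)) =
      (\<Sum>\<^sub>\<infinity>(k, \<nu>)\<in>UNIV \<times> nat_vecs n. f (Suc n) k * ?P \<nu>)"
    by (subst infsum_reindex_bij_betw[OF bij_betw_nat_vecs_Suc, symmetric])
      (auto intro!: infsum_cong simp: mult.commute)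
  also have "\<dots> = (\<Sum>\<^sub>\<infinity>k. \<Sum>\<^sub>\<infinity>\<nu>\<in>nat_vecs n. f (Suc n) k * ?P \<nu>)"
    by (rule infsum_Times_mfps[OF lf, symmetric])
  also have "\<dots> = (\<Sum>\<^sub>\<infinity>k. infsum ?P (nat_vecs n) * f (Suc n) k)"
    by (simp add: infsum_mult_left_mfps[OF lf1, symmetric] mult.commute)
  also have "\<dots> = infsum ?P (nat_vecs n) * (\<Sum>\<^sub>\<infinity>k. f (Suc n) k)"
    by (rule infsum_mult_left_mfps[OF lf2, symmetric])
  finally show ?case
    by (simp add: Suc)
qed simp

section \<open>Partial fractions\<close>

text \<open>The left-hand side has simple poles and tends to 1 at infinity, which explains the
  constant 1. The induction multiplies the expansion by one further quotient, so that only products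
  of two simple poles have to be separated.\<close>

lemma partial_fractions:
  fixes a p :: "'k \<Rightarrow> 'a :: field"
  assumes "finite A" "inj_on p A" "z \<notin> p ` A"
  shows "(\<Prod>k\<in>A. (z - a k) / (z - p k)) =
    1 + (\<Sum>k\<in>A. (p k - a k) / (z - p k) * (\<Prod>j\<in>A - {k}. (p k - a j) / (p k - p j)))"
  using assms
proof (induction A arbitrary: z rule: finite_induct)
  case (insert x A)
  let ?c = "\<lambda>k. (p k - a k) * (\<Prod>j\<in>A - {k}. (p k - a j) / (p k - p j))"
  have px: "p x \<notin> p ` A" and zx: "z \<noteq> p x" and z: "z \<notin> p ` A" and inj: "inj_on p A"
    using insert by auto
  have IH: "(\<Prod>k\<in>A. (w - a k) / (w - p k)) = 1 + (\<Sum>k\<in>A. ?c k / (w - p k))" if "w \<notin> p ` A" for w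
    using insert.IH[OF inj that] by simp
  \<comment> \<open>Separates the poles at \<open>p k\<close> and \<open>p x\<close>. The parts with
    a pole at \<open>p x\<close> add up, by the induction hypothesis at the point \<open>p x\<close>
    itself, to the residue at the new pole.\<close>
  have split: "?c k / (z - p k) * ((z - a x) / (z - p x)) =
      (p k - a k) / (z - p k) * ((p k - a x) / (p k - p x) * (\<Prod>j\<in>A - {k}. (p k - a j) / (p k - p j))) +
      (p x - a x) / (z - p x) * (?c k / (p x - p k))"
    if "k \<in> A" for k
  proof -
    have "p k \<in> p ` A" using that by simp
    then have nz: "z - p k \<noteq> 0" "z - p x \<noteq> 0" "p k - p x \<noteq> 0" "p x - p k \<noteq> 0"
      using z zx px by auto
    have "(z - a x) / ((z - p k) * (z - p x)) =
        (p k - a x) / ((p k - p x) * (z - p k)) + (p x - a x) / ((z - p x) * (p x - p k))"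
    proof -
      have "(p x - a x) / ((z - p x) * (p x - p k)) = (a x - p x) / ((z - p x) * (p k - p x))"
        using nz by (simp add: divide_simps) (simp add: algebra_simps)
      then show ?thesis
        using nz by (simp add: divide_simps) (simp add: algebra_simps)
    qed
    then have "?c k * ((z - a x) / ((z - p k) * (z - p x))) =
        ?c k * ((p k - a x) / ((p k - p x) * (z - p k)) + (p x - a x) / ((z - p x) * (p x - p k)))"
      by simp
    then show ?thesis
      unfolding distrib_left by (simp add: mult_ac)
  qed
  have "(\<Prod>k\<in>insert x A. (z - a k) / (z - p k)) =
      (1 + (\<Sum>k\<in>A. ?c k / (z - p k))) * ((z - a x) / (z - p x))"
    using insert.hyps by (simp add: IH[OF z] mult.commute)
  also have "\<dots> = (z - a x) / (z - p x) + (\<Sum>k\<in>A. ?c k / (z - p k) * ((z - a x) / (z - p x)))"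
    by (simp only: distrib_right sum_distrib_right mult_1)
  also have "\<dots> = (z - a x) / (z - p x) + (p x - a x) / (z - p x) * (\<Sum>k\<in>A. ?c k / (p x - p k)) +
      (\<Sum>k\<in>A. (p k - a k) / (z - p k) * ((p k - a x) / (p k - p x) * (\<Prod>j\<in>A - {k}. (p k - a j) / (p k - p j))))"
    by (simp only: split sum.distrib sum_distrib_left add_ac cong: sum.cong)
  also have "(z - a x) / (z - p x) = 1 + (p x - a x) / (z - p x)"
    using zx by (simp add: divide_simps)
  also have "1 + (p x - a x) / (z - p x) + (p x - a x) / (z - p x) * (\<Sum>k\<in>A. ?c k / (p x - p k)) =
      1 + (p x - a x) / (z - p x) * (\<Prod>k\<in>A. (p x - a k) / (p x - p k))"
    by (simp add: IH[OF px] algebra_simps)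
  also have "A = insert x A - {x}"
    using insert.hyps by auto
  also have "(\<Sum>k\<in>insert x A - {x}. (p k - a k) / (z - p k) *
        ((p k - a x) / (p k - p x) * (\<Prod>j\<in>(insert x A - {x}) - {k}. (p k - a j) / (p k - p j)))) =
      (\<Sum>k\<in>insert x A - {x}. (p k - a k) / (z - p k) * (\<Prod>j\<in>insert x A - {k}. (p k - a j) / (p k - p j)))"
  proof (rule sum.cong[OF refl])
    fix k assume k: "k \<in> insert x A - {x}"
    then have "insert x A - {k} = insert x ((insert x A - {x}) - {k})" by auto
    then have "(\<Prod>j\<in>insert x A - {k}. (p k - a j) / (p k - p j)) =
        (p k - a x) / (p k - p x) * (\<Prod>j\<in>(insert x A - {x}) - {k}. (p k - a j) / (p k - p j))"
      using insert.hyps by simp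
    then show "(p k - a k) / (z - p k) *
        ((p k - a x) / (p k - p x) * (\<Prod>j\<in>(insert x A - {x}) - {k}. (p k - a j) / (p k - p j))) =
        (p k - a k) / (z - p k) * (\<Prod>j\<in>insert x A - {k}. (p k - a j) / (p k - p j))"
      by simp
  qed
  finally show ?case
    using insert.hyps by (simp add: sum.remove[of "insert x A" x] add.assoc)
qed simp

text \<open>
  The factors \<open>left_factor\<close> and \<open>right_factor\<close> are those of the residues of
  \<open>\<Prod>\<^sub>i (z - t y\<^sub>i) (z - y\<^sub>i / u\<^sub>i) / ((z - y\<^sub>i) (z - t y\<^sub>i / u\<^sub>i))\<close> at \<open>y\<^sub>i\<close> and at \<open>t y\<^sub>i / u\<^sub>i\<close>;
  evaluating the partial fraction expansion at \<open>z = 0\<close> and at \<open>z = c\<close> gives the two identities.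
\<close>

definition left_factor :: "'a :: field \<Rightarrow> 'a \<Rightarrow> 'a \<Rightarrow> 'a"
  where "left_factor t r v = (1 - t * r) * (1 - r / v) / ((1 - r) * (1 - t * r / v))"

definition right_factor :: "'a :: field \<Rightarrow> 'a \<Rightarrow> 'a \<Rightarrow> 'a \<Rightarrow> 'a"
  where "right_factor t r u v =
    (1 - u * r) * (1 - u * r / (t * v)) / ((1 - u * r / t) * (1 - u * r / v))"

context
  fixes t :: "'a :: field" and y u :: "'k \<Rightarrow> 'a" and I :: "'k set"
  assumes fin: "finite I" and t: "t \<noteq> 0"
    and y: "\<And>i. i \<in> I \<Longrightarrow> y i \<noteq> 0" and u: "\<And>i. i \<in> I \<Longrightarrow> u i \<noteq> 0"
    and yy: "\<And>i j. i \<in> I \<Longrightarrow> j \<in> I \<Longrightarrow> i \<noteq> j \<Longrightarrow> y i \<noteq> y j"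
    and yw: "\<And>i j. i \<in> I \<Longrightarrow> j \<in> I \<Longrightarrow> i \<noteq> j \<Longrightarrow> y i \<noteq> t * y j / u j"
    and ww: "\<And>i j. i \<in> I \<Longrightarrow> j \<in> I \<Longrightarrow> i \<noteq> j \<Longrightarrow> y i / u i \<noteq> y j / u j"
begin

abbreviation "snd_pole i \<equiv> t * y i / u i"
abbreviation "left_prod i \<equiv> \<Prod>j\<in>I - {i}. left_factor t (y j / y i) (u j)"
abbreviation "right_prod i \<equiv> \<Prod>j\<in>I - {i}. right_factor t (y j / y i) (u i) (u j)"

text \<open>Simple partial fractions over \<open>I \<times> UNIV\<close>, with the poles
  \<open>y i\<close> and \<open>snd_pole i\<close> for each index \<open>i\<close>. The two residues
  of an index share the factor \<open>(1 / t - 1) * ((1 - u i) / (1 - u i / t))\<close> and have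
  opposite signs.\<close>

lemma partial_fractions_pairs:
  assumes ut: "\<And>i. i \<in> I \<Longrightarrow> u i \<noteq> t"
    and z: "\<And>i. i \<in> I \<Longrightarrow> z \<noteq> y i" "\<And>i. i \<in> I \<Longrightarrow> z \<noteq> snd_pole i"
  shows "(\<Prod>i\<in>I. (z - t * y i) * (z - y i / u i) / ((z - y i) * (z - snd_pole i))) =
    1 + (1 / t - 1) * (\<Sum>i\<in>I. (1 - u i) / (1 - u i / t) *
      (left_prod i * (y i / (z - y i)) - right_prod i * (snd_pole i / (z - snd_pole i))))"
proof -
  define p where "p = (\<lambda>(i, b). if b then y i else snd_pole i)"
  define a where "a = (\<lambda>(i, b). if b then t * y i else y i / u i)"
  let ?A = "I \<times> (UNIV :: bool set)"
  have yw': "y i \<noteq> snd_pole i" if "i \<in> I" for i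
    using ut[OF that] y[OF that] u[OF that] by (auto simp: field_simps)
  have ww': "snd_pole i \<noteq> snd_pole j" if "i \<in> I" "j \<in> I" "i \<noteq> j" for i j
    using ww[OF that] t by (auto simp flip: times_divide_eq_right)
  have inj: "inj_on p ?A"
  proof (rule inj_onI)
    fix k l assume k: "k \<in> ?A" "l \<in> ?A" "p k = p l"
    obtain i b where kk: "k = (i, b)" by (cases k)
    obtain j c where ll: "l = (j, c)" by (cases l)
    have ij: "i \<in> I" "j \<in> I" using k kk ll by auto
    have "i = j" 
      using k(3) yy[OF ij] yw[OF ij] yw[OF ij(2) ij(1)] ww'[OF ij]
      unfolding kk ll p_def by (auto split: if_splits)
    moreover have "b = c"
      using k(3) yw'[OF ij(1)] \<open>i = j\<close> unfolding kk ll p_def by (auto split: if_splits)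
    ultimately show "k = l" by (simp add: kk ll)
  qed
  have zA: "z \<notin> p ` ?A"
    using z by (fastforce simp: p_def split: if_splits)
  have prodA: "(\<Prod>k\<in>J \<times> (UNIV :: bool set). F k) = (\<Prod>i\<in>J. F (i, True) * F (i, False))"
    for F :: "'k \<times> bool \<Rightarrow> 'a" and J
    by (simp add: prod.cartesian_product[symmetric, of "\<lambda>i b. F (i, b)", simplified] UNIV_bool mult.commute)
  have sumA: "(\<Sum>k\<in>?A. F k) = (\<Sum>i\<in>I. F (i, True) + F (i, False))" for F :: "'k \<times> bool \<Rightarrow> 'a"
    by (simp add: sum.cartesian_product[symmetric, of "\<lambda>i b. F (i, b)", simplified] UNIV_bool add.commute)
  have remA: "?A - {(i, b)} = insert (i, \<not> b) ((I - {i}) \<times> UNIV)" if "i \<in> I" for i b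
    using that by auto
  have prodrem: "(\<Prod>k\<in>?A - {(i, b)}. F k) = F (i, \<not> b) * (\<Prod>j\<in>I - {i}. F (j, True) * F (j, False))"
    if "i \<in> I" for i b and F :: "'k \<times> bool \<Rightarrow> 'a"
    unfolding remA[OF that] using fin by (subst prod.insert) (auto simp: prodA)
  have c1: "(p (i, True) - a (i, True)) / (z - p (i, True)) *
      (\<Prod>k\<in>?A - {(i, True)}. (p (i, True) - a k) / (p (i, True) - p k)) =
      (1 / t - 1) * ((1 - u i) / (1 - u i / t) * (left_prod i * (y i / (z - y i))))" if i: "i \<in> I" for i
  proof -
    have "(\<Prod>j\<in>I - {i}. (y i - t * y j) / (y i - y j) * ((y i - y j / u j) / (y i - snd_pole j))) = left_prod i"
    proof (rule prod.cong[OF refl])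
      fix j assume "j \<in> I - {i}"
      then have "y i * (1 - y j / y i) \<noteq> 0" "y i * (1 - t * (y j / y i) / u j) \<noteq> 0"
        using i yy[of i j] yw[of i j] y[of i] by (auto simp: field_simps)
      moreover have "y i - t * y j = y i * (1 - t * (y j / y i))" "y i - y j = y i * (1 - y j / y i)"
        "y i - y j / u j = y i * (1 - y j / y i / u j)" "y i - snd_pole j = y i * (1 - t * (y j / y i) / u j)"
        using y[OF i] by (auto simp: field_simps)
      ultimately show "(y i - t * y j) / (y i - y j) * ((y i - y j / u j) / (y i - snd_pole j)) =
          left_factor t (y j / y i) (u j)"
        using y[OF i] by (simp add: left_factor_def)
    qed
    moreover have "(y i - t * y i) / (z - y i) * ((y i - y i / u i) / (y i - snd_pole i)) =
        (1 / t - 1) * ((1 - u i) / (1 - u i / t)) * (y i / (z - y i))"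
    proof -
      have nz: "z - y i \<noteq> 0" "u i - t \<noteq> 0" "t - u i \<noteq> 0" using z(1)[OF i] ut[OF i] by auto
      have "y i - y i / u i = y i / u i * (u i - 1)" "y i - snd_pole i = y i / u i * (u i - t)"
        using u[OF i] by (simp_all add: field_simps)
      then have e1: "(y i - y i / u i) / (y i - snd_pole i) = (u i - 1) / (u i - t)"
        using y[OF i] u[OF i] by simp
      have e2: "(1 - u i) / (1 - u i / t) = t * (u i - 1) / (u i - t)"
        using t nz by (simp add: divide_simps) (simp add: algebra_simps)
      have e3: "y i - t * y i = (1 - t) * y i"
        by (simp add: algebra_simps)
      have e4: "1 / t - 1 = (1 - t) / t"
        using t by (simp add: diff_divide_distrib)
      show ?thesis
        unfolding e1 e2 e3 e4 using t by (simp add: mult_ac)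
    qed
    ultimately show ?thesis
      unfolding prodrem[OF i]
      by (simp only: p_def a_def case_prod_conv if_True if_False not_True_eq_False not_False_eq_True
          mult.assoc[symmetric]) (simp only: mult_ac mult_minus_left mult_minus_right)
  qed
  have c2: "(p (i, False) - a (i, False)) / (z - p (i, False)) *
      (\<Prod>k\<in>?A - {(i, False)}. (p (i, False) - a k) / (p (i, False) - p k)) =
      - ((1 / t - 1) * ((1 - u i) / (1 - u i / t) * (right_prod i * (snd_pole i / (z - snd_pole i)))))" if i: "i \<in> I" for i
  proof -
    have wi: "snd_pole i \<noteq> 0" using y u t i by simp
    have "(\<Prod>j\<in>I - {i}. (snd_pole i - t * y j) / (snd_pole i - y j) * ((snd_pole i - y j / u j) / (snd_pole i - snd_pole j))) = right_prod i"
    proof (rule prod.cong[OF refl])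
      fix j assume j: "j \<in> I - {i}"
      have eqs: "snd_pole i - t * y j = snd_pole i * (1 - u i * (y j / y i))"
        "snd_pole i - y j = snd_pole i * (1 - u i * (y j / y i) / t)"
        "snd_pole i - y j / u j = snd_pole i * (1 - u i * (y j / y i) / (t * u j))"
        "snd_pole i - snd_pole j = snd_pole i * (1 - u i * (y j / y i) / u j)"
        using y[OF i] u[OF i] u[of j] t j by (auto simp: field_simps)
      then show "(snd_pole i - t * y j) / (snd_pole i - y j) * ((snd_pole i - y j / u j) / (snd_pole i - snd_pole j)) =
          right_factor t (y j / y i) (u i) (u j)"
        unfolding eqs using wi by (simp only: mult_divide_mult_cancel_left times_divide_times_eq right_factor_def not_False_eq_True)
    qed
    moreover have "(snd_pole i - y i / u i) / (z - snd_pole i) * ((snd_pole i - t * y i) / (snd_pole i - y i)) =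
        - ((1 / t - 1) * ((1 - u i) / (1 - u i / t)) * (snd_pole i / (z - snd_pole i)))"
    proof -
      have nz: "t - u i \<noteq> 0" "u i - t \<noteq> 0" using ut[OF i] by auto
      have "(snd_pole i - t * y i) / (snd_pole i - y i) = t * (1 - u i) / (t - u i)"
        using y[OF i] u[OF i] nz yw'[OF i] by (simp add: field_simps)
      moreover have "(1 - u i) / (1 - u i / t) = t * (1 - u i) / (t - u i)"
        using t nz by (simp add: divide_simps)
      moreover have "snd_pole i - y i / u i = - ((1 / t - 1) * snd_pole i)"
        using t u[OF i] by (simp add: field_simps)
      ultimately show ?thesis by (simp add: mult_ac)
    qed
    ultimately show ?thesis
      unfolding prodrem[OF i]
      by (simp only: p_def a_def case_prod_conv if_True if_False not_True_eq_False not_False_eq_True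
          mult.assoc[symmetric]) (simp only: mult_ac mult_minus_left mult_minus_right)
  qed
  have "(\<Prod>i\<in>I. (z - t * y i) * (z - y i / u i) / ((z - y i) * (z - snd_pole i))) =
      (\<Prod>k\<in>?A. (z - a k) / (z - p k))"
    unfolding prodA by (simp add: p_def a_def)
  also have "\<dots> = 1 + (\<Sum>k\<in>?A. (p k - a k) / (z - p k) * (\<Prod>j\<in>?A - {k}. (p k - a j) / (p k - p j)))"
    using fin by (intro partial_fractions inj zA) simp
  also have "\<dots> = 1 + (\<Sum>i\<in>I. (1 / t - 1) * ((1 - u i) / (1 - u i / t) *
      (left_prod i * (y i / (z - y i)) - right_prod i * (snd_pole i / (z - snd_pole i)))))"
    unfolding sumA by (intro arg_cong2[of _ _ _ _ "(+)"] sum.cong refl) (simp only: c1 c2, simp add: algebra_simps)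
  finally show ?thesis
    by (simp only: sum_distrib_left)
qed

abbreviation "cofactor i \<equiv> \<Prod>k\<in>I - {i}. (1 - u k / t)"

lemma left_right_factor_eq: "left_factor t r v = right_factor t r t v"
  using t by (simp add: left_factor_def right_factor_def)

text \<open>
  If \<open>u\<^sub>k = t\<close>, then the poles \<open>y\<^sub>k\<close> and \<open>t y\<^sub>k / u\<^sub>k\<close> collide. The denominators \<open>1 - u\<^sub>k / t\<close> are
  therefore cleared in the identities below, which then hold term by term in this case.
\<close>

lemma cofactor_0_or_pole:
  assumes "i \<in> I" "k \<in> I" "u k = t"
  shows "cofactor i = 0 \<or> u i = t"
  using assms fin t by (cases "i = k") auto

text \<open>For \<open>t = 1\<close> the prefactor \<open>1 / t - 1\<close> of the expansion
  vanishes, and nothing can be inferred about the sum behind it. But then zeros and poles cancel and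
  each single factor is 1.\<close>

lemma factors_1:
  assumes "i \<in> I" "j \<in> I" "i \<noteq> j" "t = 1"
  shows "left_factor t (y j / y i) (u j) = 1" "right_factor t (y j / y i) (u i) (u j) = 1"
proof -
  have "1 - y j / y i \<noteq> 0" "1 - y j / y i / u j \<noteq> 0"
    using yy[OF assms(1-3)] yw[OF assms(1-3)] y[OF assms(1)] u[OF assms(2)] assms(4)
    by (auto simp: field_simps)
  moreover have "1 - u i * (y j / y i) \<noteq> 0" "1 - u i * (y j / y i) / u j \<noteq> 0"
    using yw[OF assms(2,1)] ww[OF assms(1-3)] y[OF assms(1)] u[OF assms(2)] u[OF assms(1)] assms(3,4)
    by (auto simp: field_simps)
  ultimately show "left_factor t (y j / y i) (u j) = 1" "right_factor t (y j / y i) (u i) (u j) = 1"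
    using assms(4) by (simp_all add: left_factor_def right_factor_def)
qed

lemma factor_products_1: "i \<in> I \<Longrightarrow> t = 1 \<Longrightarrow> left_prod i = 1 \<and> right_prod i = 1"
  using factors_1 by (auto intro!: prod.neutral)

text \<open>Evaluation of the expansion at 0: numerators and denominators of the product agree
  there, and each \<open>p / (0 - p)\<close> is -1. What remains is \<open>1 / t - 1\<close> times
  the sum.\<close>

lemma residue_sum_0:
  assumes ut: "\<And>i. i \<in> I \<Longrightarrow> u i \<noteq> t" and "t \<noteq> 1"
  shows "(\<Sum>i\<in>I. (1 - u i) / (1 - u i / t) * (left_prod i - right_prod i)) = 0"
proof -
  have "(\<Prod>i\<in>I. (0 - t * y i) * (0 - y i / u i) / ((0 - y i) * (0 - snd_pole i))) = 1"
    using y u t by (intro prod.neutral) simp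
  moreover have "(1 - u i) / (1 - u i / t) * (left_prod i * (y i / (0 - y i)) - right_prod i * (snd_pole i / (0 - snd_pole i))) =
      - ((1 - u i) / (1 - u i / t) * (left_prod i - right_prod i))" if "i \<in> I" for i
  proof -
    have "y i / (0 - y i) = -1" "snd_pole i / (0 - snd_pole i) = -1"
      using y u t that by simp_all
    then show ?thesis by (simp only:) (simp add: algebra_simps)
  qed
  ultimately have "(1 / t - 1) * (\<Sum>i\<in>I. (1 - u i) / (1 - u i / t) * (left_prod i - right_prod i)) = 0"
    using partial_fractions_pairs[of 0, OF ut] y u t by (simp add: sum_negf)
  then show ?thesis
    using assms by simp
qed

lemma E_eq: "i \<in> I \<Longrightarrow> u i \<noteq> t \<Longrightarrow> cofactor i = (\<Prod>k\<in>I. 1 - u k / t) / (1 - u i / t)"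
  using fin t by (subst prod.remove[of I i]) auto

lemma residue_identity_0:
  "(\<Sum>i\<in>I. (1 - u i) * cofactor i * left_prod i) = (\<Sum>i\<in>I. (1 - u i) * cofactor i * right_prod i)"
proof (cases "t = 1 \<or> (\<exists>k\<in>I. u k = t)")
  case True
  have "cofactor i * left_prod i = cofactor i * right_prod i" if i: "i \<in> I" for i
  proof (cases "t = 1")
    case True
    with factor_products_1[OF i] show ?thesis by simp
  next
    case False
    with True cofactor_0_or_pole[OF i] have "cofactor i = 0 \<or> u i = t" by blast
    then show ?thesis
      by (auto simp: left_right_factor_eq)
  qed
  then show ?thesis
    by (intro sum.cong refl) (simp only: mult.assoc)
next
  case False
  then have ut: "u i \<noteq> t" if "i \<in> I" for i using that by auto
  let ?P = "\<Prod>k\<in>I. 1 - u k / t"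
  have "(\<Sum>i\<in>I. (1 - u i) * cofactor i * left_prod i) - (\<Sum>i\<in>I. (1 - u i) * cofactor i * right_prod i) =
      ?P * (\<Sum>i\<in>I. (1 - u i) / (1 - u i / t) * (left_prod i - right_prod i))"
    unfolding sum_subtractf[symmetric] sum_distrib_left
    by (intro sum.cong refl, subst (1 2) E_eq) (use ut in \<open>auto simp: algebra_simps\<close>)
  also have "\<dots> = 0"
    using residue_sum_0[OF ut] False by simp
  finally show ?thesis by simp
qed

text \<open>Evaluation at \<open>c\<close>, which stands for the additional variable y_(n+1); the
  factors containing \<open>c\<close> are those by which the coefficients attached to that variable
  change.\<close>

lemma residue_identity:
  assumes c: "\<And>i. i \<in> I \<Longrightarrow> c \<noteq> y i" "\<And>i. i \<in> I \<Longrightarrow> c \<noteq> snd_pole i"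
  shows "(1 / t) * (\<Sum>i\<in>I. (1 - u i) * cofactor i * (left_prod i * ((1 - t * (c / y i)) / (1 - c / y i)))) +
      (\<Prod>i\<in>I. 1 - u i / t) *
      (\<Prod>i\<in>I. (1 - c / y i / t) * (1 - u i * (c / y i)) / ((1 - c / y i) * (1 - u i * (c / y i) / t))) =
    (1 / t) * (\<Sum>i\<in>I. (1 - u i) * cofactor i *
        (right_prod i * ((1 - u i * (c / y i)) / (1 - u i * (c / y i) / t)))) +
      (\<Prod>i\<in>I. 1 - u i / t)"
proof -
  let ?P = "\<Prod>k\<in>I. 1 - u k / t"
  let ?F = "\<Prod>i\<in>I. (1 - c / y i / t) * (1 - u i * (c / y i)) / ((1 - c / y i) * (1 - u i * (c / y i) / t))"
  let ?l = "\<lambda>i. (1 - t * (c / y i)) / (1 - c / y i)"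
  let ?r = "\<lambda>i. (1 - u i * (c / y i)) / (1 - u i * (c / y i) / t)"
  have nz: "1 - c / y i \<noteq> 0" "1 - u i * (c / y i) / t \<noteq> 0" "c - y i \<noteq> 0" "c - snd_pole i \<noteq> 0" if "i \<in> I" for i
    using c[OF that] y[OF that] u[OF that] t by (auto simp: field_simps)
  show ?thesis
  proof (cases "t = 1 \<or> (\<exists>k\<in>I. u k = t)")
    case True
    have "cofactor i * (left_prod i * ?l i) = cofactor i * (right_prod i * ?r i)" if i: "i \<in> I" for i
    proof (cases "t = 1")
      case True
      with factor_products_1[OF i] nz[OF i] y[OF i] show ?thesis by simp
    next
      case False
      with True cofactor_0_or_pole[OF i] have "cofactor i = 0 \<or> u i = t" by blast
      then show ?thesis
        using t by (auto simp: left_right_factor_eq)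
    qed
    then have "(\<Sum>i\<in>I. (1 - u i) * cofactor i * (left_prod i * ?l i)) = (\<Sum>i\<in>I. (1 - u i) * cofactor i * (right_prod i * ?r i))"
      by (intro sum.cong refl) (simp only: mult.assoc)
    moreover have "?P * ?F = ?P"
    proof (cases "t = 1")
      case True
      then have "?F = 1" using nz by (intro prod.neutral) auto
      then show ?thesis by simp
    next
      case False
      with True have "?P = 0" using fin t by auto
      then show ?thesis by simp
    qed
    ultimately show ?thesis by simp
  next
    case False
    then have ut: "u i \<noteq> t" if "i \<in> I" for i using that by auto
    let ?D = "\<lambda>i. (1 - u i) / (1 - u i / t)"
    \<comment> \<open>The factor is affine in \<open>v / (c - v)\<close>, the quantity that occurs
      in the expansion at \<open>c\<close>. Its constant part \<open>t\<close> contributes nothing,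
      by \<open>residue_sum_0\<close>.\<close>
    have shift: "(1 - t * (c / v)) / (1 - c / v) = t - (1 - t) * (v / (c - v))"
      if "v \<noteq> 0" "c - v \<noteq> 0" for v
    proof -
      have "1 - c / v = - ((c - v) / v)" using that by (simp add: field_simps)
      then show ?thesis using that by (simp add: field_simps)
    qed
    have l: "?l i = t - (1 - t) * (y i / (c - y i))" if i: "i \<in> I" for i
      by (rule shift) (use y[OF i] nz[OF i] in auto)
    have r: "?r i = t - (1 - t) * (snd_pole i / (c - snd_pole i))" if i: "i \<in> I" for i
    proof -
      have "u i * (c / y i) = t * (c / snd_pole i)" "u i * (c / y i) / t = c / snd_pole i"
        using y[OF i] t u[OF i] by (simp_all add: field_simps)
      then have "?r i = (1 - t * (c / snd_pole i)) / (1 - c / snd_pole i)" by (simp only:)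
      also have "\<dots> = t - (1 - t) * (snd_pole i / (c - snd_pole i))"
        by (rule shift) (use y[OF i] t u[OF i] nz[OF i] in auto)
      finally show ?thesis .
    qed
    have F: "?F = (\<Prod>i\<in>I. (c - t * y i) * (c - y i / u i) / ((c - y i) * (c - snd_pole i)))"
    proof (rule prod.cong[OF refl])
      fix i assume i: "i \<in> I"
      have eqs: "c - t * y i = - (t * y i) * (1 - c / y i / t)" "c - y i / u i = - (y i / u i) * (1 - u i * (c / y i))"
        "c - y i = - y i * (1 - c / y i)" "c - snd_pole i = - snd_pole i * (1 - u i * (c / y i) / t)"
        using y[OF i] u[OF i] t by (auto simp: field_simps)
      show "(1 - c / y i / t) * (1 - u i * (c / y i)) / ((1 - c / y i) * (1 - u i * (c / y i) / t)) =
          (c - t * y i) * (c - y i / u i) / ((c - y i) * (c - snd_pole i))"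
        unfolding eqs using y[OF i] u[OF i] t by simp
    qed
    let ?S = "\<Sum>i\<in>I. ?D i * (left_prod i * (y i / (c - y i)) - right_prod i * (snd_pole i / (c - snd_pole i)))"
    have "(\<Sum>i\<in>I. ?D i * (left_prod i * ?l i - right_prod i * ?r i)) =
        (\<Sum>i\<in>I. t * (?D i * (left_prod i - right_prod i)) -
          (1 - t) * (?D i * (left_prod i * (y i / (c - y i)) - right_prod i * (snd_pole i / (c - snd_pole i)))))"
      by (intro sum.cong refl, simp only: l r) (simp only: algebra_simps)
    also have "\<dots> = - ((1 - t) * ?S)"
      using residue_sum_0[OF ut] False
      by (simp only: sum_subtractf sum_distrib_left[symmetric]) simp
    finally have sum_eq: "(\<Sum>i\<in>I. ?D i * (left_prod i * ?l i - right_prod i * ?r i)) = - ((1 - t) * ?S)" .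
    have main: "(1 / t) * (\<Sum>i\<in>I. ?D i * (left_prod i * ?l i - right_prod i * ?r i)) = 1 - ?F"
    proof -
      have "?F = 1 + (1 / t - 1) * ?S"
        unfolding F using c by (intro partial_fractions_pairs ut)
      moreover have "(1 / t) * - ((1 - t) * ?S) = - ((1 / t - 1) * ?S)"
        using t by (simp add: field_simps)
      ultimately have "(1 / t) * - ((1 - t) * ?S) = 1 - ?F" by (simp only:) simp
      with arg_cong[OF sum_eq, of "(*) (1 / t)"] show ?thesis by (rule trans)
    qed
    have "(1 / t) * (\<Sum>i\<in>I. (1 - u i) * cofactor i * (left_prod i * ?l i)) - (1 / t) * (\<Sum>i\<in>I. (1 - u i) * cofactor i * (right_prod i * ?r i)) =
        ?P * ((1 / t) * (\<Sum>i\<in>I. ?D i * (left_prod i * ?l i - right_prod i * ?r i)))"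
      unfolding right_diff_distrib[symmetric] sum_subtractf[symmetric] sum_distrib_left
    proof (intro sum.cong refl, subst E_eq)
      have "s * (a * (p / b) * g) = p * (s * (a / b * g))" for s a p b g :: 'a
        by simp
      then show "1 / t * ((1 - u i) * (?P / (1 - u i / t)) * (left_prod i * ?l i - right_prod i * ?r i)) =
          ?P * (1 / t * (?D i * (left_prod i * ?l i - right_prod i * ?r i)))" for i
        by blast
    qed (use ut in auto)
    also have "\<dots> = ?P - ?P * ?F"
      unfolding main by (simp add: algebra_simps)
    finally show ?thesis
      by (simp add: algebra_simps)
  qed
qed

end

section \<open>Coefficients of the operators over a field\<close>

definition fpoch :: "'a :: field \<Rightarrow> 'a \<Rightarrow> nat \<Rightarrow> 'a"
  where "fpoch q z k = (\<Prod>l<k. 1 - q ^ l * z)"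

lemma fpoch_0 [simp]: "fpoch q z 0 = 1"
  by (simp add: fpoch_def)

lemma fpoch_Suc: "fpoch q z (Suc k) = fpoch q z k * (1 - q ^ k * z)"
  by (simp add: fpoch_def)

lemma fpoch_Suc_left: "fpoch q z (Suc k) = (1 - z) * fpoch q (q * z) k"
  by (simp add: fpoch_def prod.lessThan_Suc_shift mult_ac del: prod.lessThan_Suc)

lemma fpoch_shift: "1 - q ^ k * z \<noteq> 0 \<Longrightarrow> fpoch q z k = (1 - z) * fpoch q (q * z) k / (1 - q ^ k * z)"
  using fpoch_Suc[of q z k] fpoch_Suc_left[of q z k] by (simp add: field_simps)

text \<open>Neither \<open>r\<close> nor \<open>t * r\<close> nor \<open>r / t\<close> is an
  integral power of \<open>q\<close>; this keeps all denominators attached to a pair of variables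
  away from 0.\<close>

definition generic :: "'a :: field \<Rightarrow> 'a \<Rightarrow> 'a \<Rightarrow> bool"
  where "generic q t r \<longleftrightarrow> (\<forall>a b. q ^ a * r \<noteq> q ^ b \<and> t * q ^ a * r \<noteq> q ^ b \<and> q ^ a * r \<noteq> t * q ^ b)"

text \<open>The factor of \<open>K\<close> with parameter \<open>q / t\<close> for two variables
  with quotient \<open>r\<close>; \<open>a\<close> and \<open>b\<close> are the exponents of the
  inverse shifts of the first and of the second variable.\<close>

definition pair_coeff :: "'a :: field \<Rightarrow> 'a \<Rightarrow> 'a \<Rightarrow> nat \<Rightarrow> nat \<Rightarrow> 'a"
  where "pair_coeff q t r a b =
    fpoch q (q / t * r) a / fpoch q (q * r) a * (fpoch q (t * r / q ^ b) a / fpoch q (r / q ^ b) a)"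

definition edge_coeff :: "'a :: field \<Rightarrow> 'a \<Rightarrow> 'a \<Rightarrow> nat \<Rightarrow> 'a"
  where "edge_coeff q t r a = fpoch q (q / t * r) a / fpoch q (q * r) a"

definition mac_factor :: "'a :: field \<Rightarrow> 'a \<Rightarrow> 'a \<Rightarrow> 'a"
  where "mac_factor q t r = (1 - q / t * r) * (1 - t * r) / ((1 - q * r) * (1 - r))"

context
  fixes q t r :: "'a :: field"
  assumes q: "q \<noteq> 0" and t: "t \<noteq> 0" and r: "generic q t r"
begin

lemma generic_nonzero:
  shows "1 - q ^ a * r \<noteq> 0" "1 - q ^ a * r / q ^ b \<noteq> 0"
    "1 - t * (q ^ a * r) / q ^ b \<noteq> 0" "1 - q ^ a * r / t \<noteq> 0" "1 - q ^ a * r / (t * q ^ b) \<noteq> 0"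
  using r q t
  unfolding generic_def
  by (simp_all add: field_simps) (metis mult.assoc mult.commute mult_1 power_0)+

lemma generic_nonzero':
  shows "1 - r \<noteq> 0" "1 - q * r \<noteq> 0" "1 - t * r \<noteq> 0" "1 - r / q ^ b \<noteq> 0" "1 - t * r / q ^ b \<noteq> 0"
    "1 - r / t \<noteq> 0" "1 - q / t * r \<noteq> 0"
  using generic_nonzero(1)[of 0] generic_nonzero(1)[of 1] generic_nonzero(3)[of 0 0] generic_nonzero(2)[of 0 b]
    generic_nonzero(3)[of 0 b] generic_nonzero(4)[of 0] generic_nonzero(4)[of 1]
  by simp_all

text \<open>The four relations of this kind follow one pair when an exponent grows by one. On the
  left the Macdonald shift has acted on the coefficient of \<open>K\<close>, so \<open>r\<close>
  becomes \<open>q * r\<close> or \<open>r / q\<close>; on the right the shift of \<open>K\<close>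
  has acted on the Macdonald coefficient. First and second tell which variable of the pair is
  concerned: the triangular Macdonald coefficient has a factor only for the first.\<close>

lemma pair_coeff_left_first:
  "pair_coeff q t (q * r) a b * mac_factor q t r = pair_coeff q t r (Suc a) b * left_factor t r (q ^ b)"
proof -
  have *: "X / Y * (Z / W) * ((k * c) / (l * d)) = (k * X) / (l * Y) * ((e * Z) / (f * W)) * ((c * f) / (d * e))"
    if "e \<noteq> 0" "f \<noteq> 0" for X Y Z W k c l d e f :: 'a
    using that by (simp add: mult_ac)
  have eqs: "q / t * (q * r) = q * (q / t * r)" "t * (q * r) / q ^ b = q * (t * r / q ^ b)"
    "q * r / q ^ b = q * (r / q ^ b)"
    by simp_all
  show ?thesis
    unfolding pair_coeff_def mac_factor_def left_factor_def fpoch_Suc_left eqs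
    using generic_nonzero' by (intro *)
qed

lemma pair_coeff_right_first:
  "pair_coeff q t r a b * mac_factor q t (q ^ a * r / q ^ b) =
    pair_coeff q t r (Suc a) b * right_factor t r (q ^ Suc a) (q ^ b)"
proof -
  have *: "X / Y * (Z / W) * ((k * c) / (l * d)) = (X * e) / (Y * f) * ((Z * c) / (W * d)) * ((f * k) / (e * l))"
    if "e \<noteq> 0" "f \<noteq> 0" for X Y Z W k c l d e f :: 'a
    using that by (simp add: mult_ac)
  have eqs: "1 - q / t * (q ^ a * r / q ^ b) = 1 - q ^ Suc a * r / (t * q ^ b)"
    "1 - t * (q ^ a * r / q ^ b) = 1 - q ^ a * (t * r / q ^ b)"
    "1 - q * (q ^ a * r / q ^ b) = 1 - q ^ Suc a * r / q ^ b"
    "1 - q ^ a * r / q ^ b = 1 - q ^ a * (r / q ^ b)"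
    "1 - q ^ a * (q / t * r) = 1 - q ^ Suc a * r / t"
    "1 - q ^ a * (q * r) = 1 - q ^ Suc a * r"
    by (simp_all add: mult_ac)
  have "1 - q ^ Suc a * r / t \<noteq> 0" "1 - q ^ Suc a * r \<noteq> 0"
    by (rule generic_nonzero)+
  then show ?thesis
    unfolding pair_coeff_def mac_factor_def right_factor_def fpoch_Suc eqs by (rule *)
qed

lemma edge_coeff_left: "edge_coeff q t (q * r) a * mac_factor q t r = edge_coeff q t r (Suc a) * ((1 - t * r) / (1 - r))"
proof -
  have eqs: "q / t * (q * r) = q * (q / t * r)"
    by simp
  show ?thesis
    unfolding edge_coeff_def mac_factor_def fpoch_Suc_left eqs by (simp add: mult_ac)
qed

lemma edge_coeff_right:
  "edge_coeff q t r a = edge_coeff q t r (Suc a) * ((1 - q ^ Suc a * r) / (1 - q ^ Suc a * r / t))"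
proof -
  have eqs: "1 - q ^ a * (q / t * r) = 1 - q ^ Suc a * r / t"
    "1 - q ^ a * (q * r) = 1 - q ^ Suc a * r"
    by (simp_all add: mult_ac)
  have *: "X / Y = (X * e) / (Y * f) * (f / e)" if "e \<noteq> 0" "f \<noteq> 0" for X Y e f :: 'a
    using that by simp
  show ?thesis
    unfolding edge_coeff_def fpoch_Suc eqs by (rule *) (rule generic_nonzero)+
qed

text \<open>Both Pochhammer symbols move by one step, so that all but the end factors cancel. This
  serves the shift of the additional variable and, in \<open>pair_coeff_left_second\<close>, that of
  the larger variable of a pair.\<close>

lemma edge_coeff_shift:
  "edge_coeff q t (r / q) a =
    edge_coeff q t r a * ((1 - r / t) * (1 - q ^ a * r) / ((1 - r) * (1 - q ^ a * r / t)))"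
proof -
  have eqs: "q / t * (r / q) = r / t" "q * (r / q) = r"
    using q by simp_all
  have 1: "fpoch q (r / t) a = (1 - r / t) * fpoch q (q / t * r) a / (1 - q ^ a * r / t)"
    using fpoch_shift[of q a "r / t"] generic_nonzero(4)[of a] by simp
  have 2: "fpoch q r a = (1 - r) * fpoch q (q * r) a / (1 - q ^ a * r)"
    using fpoch_shift[of q a r] generic_nonzero(1)[of a] by simp
  show ?thesis
    unfolding edge_coeff_def eqs 1 2 by (simp add: mult_ac)
qed

lemma pair_coeff_left_second:
  assumes "r \<noteq> 0"
  shows "pair_coeff q t (r / q) a b = pair_coeff q t r a (Suc b) * left_factor t (1 / r) (q ^ a)"
proof -
  have eqs: "t * (r / q) / q ^ b = t * r / q ^ Suc b" "r / q / q ^ b = r / q ^ Suc b"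
    by simp_all
  have "left_factor t (1 / r) (q ^ a) = (1 - r / t) * (1 - q ^ a * r) / ((1 - r) * (1 - q ^ a * r / t))"
  proof -
    have e: "1 - t * (1 / r) = - (t / r) * (1 - r / t)" "1 - 1 / r / q ^ a = - (1 / (r * q ^ a)) * (1 - q ^ a * r)"
      "1 - 1 / r = - (1 / r) * (1 - r)" "1 - t * (1 / r) / q ^ a = - (t / (r * q ^ a)) * (1 - q ^ a * r / t)"
      using assms q t by (simp_all add: field_simps)
    show ?thesis
      unfolding left_factor_def e using assms q t by (simp add: mult_ac)
  qed
  moreover have "pair_coeff q t (r / q) a b =
      edge_coeff q t (r / q) a * (fpoch q (t * r / q ^ Suc b) a / fpoch q (r / q ^ Suc b) a)"
    unfolding pair_coeff_def edge_coeff_def eqs ..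
  moreover have "pair_coeff q t r a (Suc b) =
      edge_coeff q t r a * (fpoch q (t * r / q ^ Suc b) a / fpoch q (r / q ^ Suc b) a)"
    unfolding pair_coeff_def edge_coeff_def ..
  ultimately show ?thesis
    unfolding edge_coeff_shift by (simp only: mult_ac)
qed

lemma pair_coeff_right_second:
  assumes "r \<noteq> 0"
  shows "pair_coeff q t r a b = pair_coeff q t r a (Suc b) * right_factor t (1 / r) (q ^ Suc b) (q ^ a)"
proof -
  let ?U = "q ^ Suc b"
  have eqs: "t * r / q ^ b = q * (t * r / ?U)" "r / q ^ b = q * (r / ?U)"
    using q by simp_all
  have nz: "1 - q ^ a * (t * r / ?U) \<noteq> 0" "1 - q ^ a * (r / ?U) \<noteq> 0" "1 - t * r / ?U \<noteq> 0" "1 - r / ?U \<noteq> 0"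
    using generic_nonzero(3)[of a "Suc b"] generic_nonzero(2)[of a "Suc b"] generic_nonzero'(4)[of "Suc b"]
      generic_nonzero'(5)[of "Suc b"]
    by (simp_all add: mult_ac del: power_Suc)
  have 1: "fpoch q (q * (t * r / ?U)) a = fpoch q (t * r / ?U) a * (1 - q ^ a * (t * r / ?U)) / (1 - t * r / ?U)"
    using fpoch_shift[OF nz(1)] nz(1,3) by simp
  have 2: "fpoch q (q * (r / ?U)) a = fpoch q (r / ?U) a * (1 - q ^ a * (r / ?U)) / (1 - r / ?U)"
    using fpoch_shift[OF nz(2)] nz(2,4) by simp
  have "right_factor t (1 / r) ?U (q ^ a) =
      (1 - q ^ a * (t * r / ?U)) * (1 - r / ?U) / ((1 - t * r / ?U) * (1 - q ^ a * (r / ?U)))"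
  proof -
    have e: "1 - ?U * (1 / r) = - (?U / r) * (1 - r / ?U)"
      "1 - ?U * (1 / r) / (t * q ^ a) = - (?U / (r * t * q ^ a)) * (1 - q ^ a * (t * r / ?U))"
      "1 - ?U * (1 / r) / t = - (?U / (r * t)) * (1 - t * r / ?U)"
      "1 - ?U * (1 / r) / q ^ a = - (?U / (r * q ^ a)) * (1 - q ^ a * (r / ?U))"
      using assms q t by (simp_all add: field_simps del: power_Suc)
    show ?thesis
      unfolding right_factor_def e using assms q t by (simp add: mult_ac del: power_Suc)
  qed
  then show ?thesis
    unfolding pair_coeff_def eqs 1 2 by (simp add: mult_ac del: power_Suc)
qed

text \<open>Indices with exponent 0 have u = 1, so they drop out of the products and the residue
  identities can be used over the support of the exponent vector.\<close>

lemma factors_trivial: "left_factor t r 1 = 1" "right_factor t r (q ^ a) 1 = 1"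
  using generic_nonzero' generic_nonzero[of a]
  by (simp_all add: left_factor_def right_factor_def)

end

text \<open>A change at the index \<open>i\<close> affects only the pairs containing
  \<open>i\<close>. The factors \<open>h\<close> from the pairs above and below combine to a
  symmetric product over all other indices, while \<open>g\<close> occurs only above
  \<open>i\<close>, as in \<open>mac_coeff\<close>.\<close>

lemma prod_pairs_update:
  fixes f f' :: "nat \<Rightarrow> nat \<Rightarrow> 'a :: comm_ring_1"
  assumes i: "i \<in> {1..n}"
    and other: "\<And>j k. 1 \<le> j \<Longrightarrow> j < k \<Longrightarrow> k \<le> n \<Longrightarrow> j \<noteq> i \<Longrightarrow> k \<noteq> i \<Longrightarrow> f' j k = f j k"
    and above: "\<And>k. i < k \<Longrightarrow> k \<le> n \<Longrightarrow> f' i k * g k = f i k * h k"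
    and below: "\<And>j. 1 \<le> j \<Longrightarrow> j < i \<Longrightarrow> f' j i = f j i * h j"
  shows "(\<Prod>k\<in>{1..n}. \<Prod>j\<in>{1..<k}. f' j k) * (\<Prod>k\<in>{i+1..n}. g k) =
    (\<Prod>k\<in>{1..n}. \<Prod>j\<in>{1..<k}. f j k) * (\<Prod>j\<in>{1..n} - {i}. h j)"
proof -
  have "(\<Prod>k\<in>{1..n}. \<Prod>j\<in>{1..<k}. if j = i then g k else 1) = (\<Prod>k\<in>{1..n}. if i < k then g k else 1)"
    using i by (intro prod.cong refl) (auto simp: prod.delta)
  also have "\<dots> = (\<Prod>k\<in>{i+1..n}. g k)"
    by (subst prod.inter_filter[symmetric]) (auto intro!: prod.cong)
  finally have G: "(\<Prod>k\<in>{1..n}. \<Prod>j\<in>{1..<k}. if j = i then g k else 1) = (\<Prod>k\<in>{i+1..n}. g k)" .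
  have "(\<Prod>k\<in>{1..n}. \<Prod>j\<in>{1..<k}. if j = i then h k else if k = i then h j else 1) =
      (\<Prod>k\<in>{1..n}. (if k = i then \<Prod>j\<in>{1..<i}. h j else 1) * (if i < k then h k else 1))"
  proof (intro prod.cong refl)
    fix k assume "k \<in> {1..n}"
    consider "k < i" | "k = i" | "i < k" by linarith
    then show "(\<Prod>j\<in>{1..<k}. if j = i then h k else if k = i then h j else 1) =
        (if k = i then \<Prod>j\<in>{1..<i}. h j else 1) * (if i < k then h k else 1)"
    proof cases
      case 3
      then have "(\<Prod>j\<in>{1..<k}. if j = i then h k else if k = i then h j else 1) =
          (\<Prod>j\<in>{1..<k}. if j = i then h k else 1)"
        by (intro prod.cong) auto
      with 3 i show ?thesis by (simp add: prod.delta)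
    qed (auto intro!: prod.neutral prod.cong)
  qed
  also have "\<dots> = (\<Prod>j\<in>{1..<i}. h j) * (\<Prod>k\<in>{i+1..n}. h k)"
    using i unfolding prod.distrib
    by (intro arg_cong2[of _ _ _ _ "(*)"]) (simp_all add: prod.delta, subst prod.inter_filter[symmetric], auto intro!: prod.cong)
  also have "\<dots> = (\<Prod>j\<in>{1..<i} \<union> {i+1..n}. h j)"
    by (subst prod.union_disjoint) auto
  also have "{1..<i} \<union> {i+1..n} = {1..n} - {i}"
    using i by auto
  finally have H: "(\<Prod>k\<in>{1..n}. \<Prod>j\<in>{1..<k}. if j = i then h k else if k = i then h j else 1) =
    (\<Prod>j\<in>{1..n} - {i}. h j)" .
  show ?thesis
    unfolding G[symmetric] H[symmetric] prod.distrib[symmetric]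
    by (intro prod.cong refl) (auto simp: other above below)
qed


section \<open>Composites with the Macdonald operator, one shift at a time\<close>

definition kappa_scalar :: "'a :: field \<Rightarrow> 'a \<Rightarrow> nat \<Rightarrow> (nat \<Rightarrow> nat) \<Rightarrow> 'a"
  where "kappa_scalar q t n \<nu> = (\<Prod>i\<in>{1..n}. fpoch q (q / t) (\<nu> i) / fpoch q q (\<nu> i))"

definition kappa_pairs :: "'a :: field \<Rightarrow> 'a \<Rightarrow> (nat \<Rightarrow> 'a) \<Rightarrow> nat \<Rightarrow> (nat \<Rightarrow> nat) \<Rightarrow> 'a"
  where "kappa_pairs q t y n \<nu> = (\<Prod>k\<in>{1..n}. \<Prod>j\<in>{1..<k}. pair_coeff q t (y k / y j) (\<nu> j) (\<nu> k))"

definition kappa :: "'a :: field \<Rightarrow> 'a \<Rightarrow> (nat \<Rightarrow> 'a) \<Rightarrow> nat \<Rightarrow> (nat \<Rightarrow> nat) \<Rightarrow> 'a"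
  where "kappa q t y n \<nu> = kappa_scalar q t n \<nu> * kappa_pairs q t y n \<nu>"

definition kappa_edges :: "'a :: field \<Rightarrow> 'a \<Rightarrow> (nat \<Rightarrow> 'a) \<Rightarrow> 'a \<Rightarrow> nat \<Rightarrow> (nat \<Rightarrow> nat) \<Rightarrow> 'a"
  where "kappa_edges q t y c n \<nu> = (\<Prod>i\<in>{1..n}. edge_coeff q t (c / y i) (\<nu> i))"

text \<open>The Macdonald operator with inverse shifts has the coefficients \<Prod> (1 - t y_j /
  y_i) / (1 - y_j / y_i) over j \<noteq> i. Conjugation by the infinite products in front of p_n
  cancels the factors with j < i up to a power of t, and multiplies those with j > i by (1 - q y_j /
  (t y_i)) / (1 - q y_j / y_i).\<close>

definition mac_coeff :: "'a :: field \<Rightarrow> 'a \<Rightarrow> (nat \<Rightarrow> 'a) \<Rightarrow> nat \<Rightarrow> nat \<Rightarrow> 'a"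
  where "mac_coeff q t y n i = (\<Prod>j\<in>{i+1..n}. mac_factor q t (y j / y i))"

context
  fixes q t :: "'a :: field" and y :: "nat \<Rightarrow> 'a" and n :: nat and \<nu> :: "nat \<Rightarrow> nat"
  assumes q: "q \<noteq> 0" "\<And>k. k > 0 \<Longrightarrow> q ^ k \<noteq> 1" and t: "t \<noteq> 0"
    and y: "\<And>i. i \<in> {1..n} \<Longrightarrow> y i \<noteq> 0"
    and gen: "\<And>i j. i \<in> {1..n} \<Longrightarrow> j \<in> {1..n} \<Longrightarrow> i \<noteq> j \<Longrightarrow> generic q t (y j / y i)"
begin

lemma kappa_pairs_left:
  assumes i: "i \<in> {1..n}" and a: "\<nu> i = Suc a"
  shows "kappa_pairs q t (y(i := y i / q)) n (\<nu>(i := a)) * mac_coeff q t y n i =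
    kappa_pairs q t y n \<nu> * (\<Prod>j\<in>{1..n} - {i}. left_factor t (y j / y i) (q ^ \<nu> j))"
  unfolding kappa_pairs_def mac_coeff_def
proof (rule prod_pairs_update[OF i])
  fix k assume k: "i < k" "k \<le> n"
  have "generic q t (y k / y i)" using k i by (intro gen) auto
  from pair_coeff_left_first[OF q(1) t this, of a "\<nu> k"] k a
  show "pair_coeff q t ((y(i := y i / q)) k / (y(i := y i / q)) i) ((\<nu>(i := a)) i) ((\<nu>(i := a)) k) *
      mac_factor q t (y k / y i) =
      pair_coeff q t (y k / y i) (\<nu> i) (\<nu> k) * left_factor t (y k / y i) (q ^ \<nu> k)"
    by (simp add: mult.commute)
next
  fix j assume j: "1 \<le> j" "j < i"
  have "generic q t (y i / y j)" "y i / y j \<noteq> 0" using j i y by (auto intro!: gen)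
  from pair_coeff_left_second[OF q(1) t this, of "\<nu> j" a] j a
  show "pair_coeff q t ((y(i := y i / q)) i / (y(i := y i / q)) j) ((\<nu>(i := a)) j) ((\<nu>(i := a)) i) =
      pair_coeff q t (y i / y j) (\<nu> j) (\<nu> i) * left_factor t (y j / y i) (q ^ \<nu> j)"
    by (simp add: mult.commute)
qed auto

lemma kappa_pairs_right:
  assumes i: "i \<in> {1..n}" and a: "\<nu> i = Suc a"
  shows "kappa_pairs q t y n (\<nu>(i := a)) * mac_coeff q t (\<lambda>j. y j / q ^ (\<nu>(i := a)) j) n i =
    kappa_pairs q t y n \<nu> * (\<Prod>j\<in>{1..n} - {i}. right_factor t (y j / y i) (q ^ \<nu> i) (q ^ \<nu> j))"
  unfolding kappa_pairs_def mac_coeff_def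
proof (rule prod_pairs_update[OF i])
  fix k assume k: "i < k" "k \<le> n"
  have "generic q t (y k / y i)" using k i by (intro gen) auto
  from pair_coeff_right_first[OF q(1) t this, of a "\<nu> k"] k a
  show "pair_coeff q t (y k / y i) ((\<nu>(i := a)) i) ((\<nu>(i := a)) k) *
      mac_factor q t (y k / q ^ (\<nu>(i := a)) k / (y i / q ^ (\<nu>(i := a)) i)) =
      pair_coeff q t (y k / y i) (\<nu> i) (\<nu> k) * right_factor t (y k / y i) (q ^ \<nu> i) (q ^ \<nu> k)"
    by (simp add: mult_ac)
next
  fix j assume j: "1 \<le> j" "j < i"
  have "generic q t (y i / y j)" "y i / y j \<noteq> 0" using j i y by (auto intro!: gen)
  from pair_coeff_right_second[OF q(1) t this, of "\<nu> j" a] j a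
  show "pair_coeff q t (y i / y j) ((\<nu>(i := a)) j) ((\<nu>(i := a)) i) =
      pair_coeff q t (y i / y j) (\<nu> j) (\<nu> i) * right_factor t (y j / y i) (q ^ \<nu> i) (q ^ \<nu> j)"
    by (simp add: mult.commute)
qed auto

abbreviation "lower i \<equiv> \<nu>(i := \<nu> i - 1)"
abbreviation "shift_y i \<equiv> y(i := y i / q)"
abbreviation "active \<equiv> {i \<in> {1..n}. \<nu> i \<noteq> 0}"
abbreviation "scalar_part \<equiv> \<Prod>k\<in>active. fpoch q (q / t) (\<nu> k - 1) / fpoch q q (\<nu> k)"

lemma fpoch_pred:
  assumes "k \<in> active"
  shows "fpoch q (q / t) (\<nu> k) = fpoch q (q / t) (\<nu> k - 1) * (1 - q ^ \<nu> k / t)"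
    and "fpoch q q (\<nu> k) = fpoch q q (\<nu> k - 1) * (1 - q ^ \<nu> k)"
    and "1 - q ^ \<nu> k \<noteq> 0"
proof -
  obtain a where "\<nu> k = Suc a" using assms by (cases "\<nu> k") auto
  then show "fpoch q (q / t) (\<nu> k) = fpoch q (q / t) (\<nu> k - 1) * (1 - q ^ \<nu> k / t)"
    "fpoch q q (\<nu> k) = fpoch q q (\<nu> k - 1) * (1 - q ^ \<nu> k)"
    by (simp_all add: fpoch_Suc mult_ac)
  show "1 - q ^ \<nu> k \<noteq> 0" using assms q(2)[of "\<nu> k"] by simp
qed

lemma kappa_scalar_eq: "kappa_scalar q t n \<nu> = scalar_part * (\<Prod>k\<in>active. 1 - q ^ \<nu> k / t)"
proof -
  have "kappa_scalar q t n \<nu> = (\<Prod>k\<in>active. fpoch q (q / t) (\<nu> k) / fpoch q q (\<nu> k))"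
    unfolding kappa_scalar_def by (rule prod.mono_neutral_right) auto
  also have "\<dots> = (\<Prod>k\<in>active. fpoch q (q / t) (\<nu> k - 1) / fpoch q q (\<nu> k) * (1 - q ^ \<nu> k / t))"
    by (intro prod.cong refl, subst fpoch_pred(1)) auto
  finally show ?thesis
    by (simp only: prod.distrib)
qed

text \<open>This is where the weights \<open>1 - u i\<close> and the cofactors of the residue
  identities come from, with \<open>u k = q ^ \<nu> k\<close>: \<open>scalar_part\<close> is what
  all the lowered vectors have in common.\<close>

lemma kappa_scalar_pred:
  assumes i: "i \<in> active"
  shows "kappa_scalar q t n (lower i) = scalar_part * ((1 - q ^ \<nu> i) * (\<Prod>k\<in>active - {i}. 1 - q ^ \<nu> k / t))"
proof -
  let ?\<nu> = "lower i"
  have "kappa_scalar q t n ?\<nu> = (\<Prod>k\<in>active. fpoch q (q / t) (?\<nu> k) / fpoch q q (?\<nu> k))"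
    unfolding kappa_scalar_def using i by (intro prod.mono_neutral_right) auto
  also have "\<dots> = (fpoch q (q / t) (\<nu> i - 1) / fpoch q q (\<nu> i - 1)) *
      (\<Prod>k\<in>active - {i}. fpoch q (q / t) (\<nu> k) / fpoch q q (\<nu> k))"
    using i by (subst prod.remove[of _ i]) (auto intro!: arg_cong2[of _ _ _ _ "(*)"] prod.cong)
  also have "fpoch q (q / t) (\<nu> i - 1) / fpoch q q (\<nu> i - 1) =
      fpoch q (q / t) (\<nu> i - 1) / fpoch q q (\<nu> i) * (1 - q ^ \<nu> i)"
    using fpoch_pred(2,3)[OF i] by simp
  also have "(\<Prod>k\<in>active - {i}. fpoch q (q / t) (\<nu> k) / fpoch q q (\<nu> k)) =
      (\<Prod>k\<in>active - {i}. fpoch q (q / t) (\<nu> k - 1) / fpoch q q (\<nu> k)) * (\<Prod>k\<in>active - {i}. 1 - q ^ \<nu> k / t)"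
    unfolding prod.distrib[symmetric] by (intro prod.cong refl, subst fpoch_pred(1)) auto
  finally have "kappa_scalar q t n ?\<nu> = fpoch q (q / t) (\<nu> i - 1) / fpoch q q (\<nu> i) * (1 - q ^ \<nu> i) *
      ((\<Prod>k\<in>active - {i}. fpoch q (q / t) (\<nu> k - 1) / fpoch q q (\<nu> k)) * (\<Prod>k\<in>active - {i}. 1 - q ^ \<nu> k / t))" .
  moreover have "scalar_part = fpoch q (q / t) (\<nu> i - 1) / fpoch q q (\<nu> i) *
      (\<Prod>k\<in>active - {i}. fpoch q (q / t) (\<nu> k - 1) / fpoch q q (\<nu> k))"
    using i by (intro prod.remove) auto
  ultimately show ?thesis
    by (simp only: mult_ac)
qed

lemma restrict_factors:
  assumes "i \<in> active"
  shows "(\<Prod>j\<in>{1..n} - {i}. left_factor t (y j / y i) (q ^ \<nu> j)) =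
      (\<Prod>j\<in>active - {i}. left_factor t (y j / y i) (q ^ \<nu> j))"
    and "(\<Prod>j\<in>{1..n} - {i}. right_factor t (y j / y i) (q ^ \<nu> i) (q ^ \<nu> j)) =
      (\<Prod>j\<in>active - {i}. right_factor t (y j / y i) (q ^ \<nu> i) (q ^ \<nu> j))"
proof -
  have "left_factor t (y j / y i) (q ^ \<nu> j) = 1" "right_factor t (y j / y i) (q ^ \<nu> i) (q ^ \<nu> j) = 1"
    if "j \<in> {1..n} - {i} - (active - {i})" for j
  proof -
    have "generic q t (y j / y i)" "\<nu> j = 0" using that assms gen by auto
    then show "left_factor t (y j / y i) (q ^ \<nu> j) = 1" "right_factor t (y j / y i) (q ^ \<nu> i) (q ^ \<nu> j) = 1"
      using factors_trivial[OF q(1) t] by simp_all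
  qed
  then show "(\<Prod>j\<in>{1..n} - {i}. left_factor t (y j / y i) (q ^ \<nu> j)) =
      (\<Prod>j\<in>active - {i}. left_factor t (y j / y i) (q ^ \<nu> j))"
    "(\<Prod>j\<in>{1..n} - {i}. right_factor t (y j / y i) (q ^ \<nu> i) (q ^ \<nu> j)) =
      (\<Prod>j\<in>active - {i}. right_factor t (y j / y i) (q ^ \<nu> i) (q ^ \<nu> j))"
    by - (rule prod.mono_neutral_right, simp, blast, blast)+
qed

lemma left_term:
  assumes i: "i \<in> active"
  shows "kappa q t (shift_y i) n (lower i) *
      mac_coeff q t y n i =
    scalar_part * kappa_pairs q t y n \<nu> * ((1 - q ^ \<nu> i) * (\<Prod>k\<in>active - {i}. 1 - q ^ \<nu> k / t) *
      (\<Prod>j\<in>active - {i}. left_factor t (y j / y i) (q ^ \<nu> j)))"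
proof -
  have "i \<in> {1..n}" "\<nu> i = Suc (\<nu> i - 1)" using i by auto
  from arg_cong2[of _ _ _ _ "(*)", OF kappa_scalar_pred[OF i] kappa_pairs_left[OF this]] show ?thesis
    unfolding restrict_factors[OF i] kappa_def by (simp only: mult_ac)
qed

lemma right_term:
  assumes i: "i \<in> active"
  shows "kappa q t y n (lower i) *
      mac_coeff q t (\<lambda>j. y j / q ^ lower i j) n i =
    scalar_part * kappa_pairs q t y n \<nu> * ((1 - q ^ \<nu> i) * (\<Prod>k\<in>active - {i}. 1 - q ^ \<nu> k / t) *
      (\<Prod>j\<in>active - {i}. right_factor t (y j / y i) (q ^ \<nu> i) (q ^ \<nu> j)))"
proof -
  have "i \<in> {1..n}" "\<nu> i = Suc (\<nu> i - 1)" using i by auto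
  from arg_cong2[of _ _ _ _ "(*)", OF kappa_scalar_pred[OF i] kappa_pairs_right[OF this]] show ?thesis
    unfolding restrict_factors[OF i] kappa_def by (simp only: mult_ac)
qed

text \<open>Genericity separates poles of different indices. The two poles of a single index are
  left out, because \<open>q ^ \<nu> i = t\<close> may well occur.\<close>

lemma poles_distinct:
  assumes "i \<in> active" "j \<in> active" "i \<noteq> j"
  shows "y i \<noteq> y j" "y i \<noteq> t * y j / q ^ \<nu> j" "y i / q ^ \<nu> i \<noteq> y j / q ^ \<nu> j"
proof -
  have g: "generic q t (y j / y i)" and yi: "y i \<noteq> 0"
    using assms gen y by auto
  have "q ^ 0 * (y j / y i) \<noteq> q ^ 0" "t * q ^ 0 * (y j / y i) \<noteq> q ^ \<nu> j" "q ^ \<nu> i * (y j / y i) \<noteq> q ^ \<nu> j"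
    using g unfolding generic_def by blast+
  then show "y i \<noteq> y j" "y i \<noteq> t * y j / q ^ \<nu> j" "y i / q ^ \<nu> i \<noteq> y j / q ^ \<nu> j"
    using yi q(1) by (auto simp: field_simps)
qed

text \<open>The coefficients of one shift with exponent vector \<open>\<nu>\<close> in the two
  composites of \<open>K\<close> and the Macdonald operator. After removal of the common factor this
  is \<open>residue_identity_0\<close>.\<close>

lemma kappa_mac_commute:
  "(\<Sum>i\<in>active. kappa q t (shift_y i) n (lower i) * mac_coeff q t y n i) =
    (\<Sum>i\<in>active. kappa q t y n (lower i) *
      mac_coeff q t (\<lambda>j. y j / q ^ lower i j) n i)"
proof -
  have "(\<Sum>i\<in>active. (1 - q ^ \<nu> i) * (\<Prod>k\<in>active - {i}. 1 - q ^ \<nu> k / t) *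
        (\<Prod>j\<in>active - {i}. left_factor t (y j / y i) (q ^ \<nu> j))) =
      (\<Sum>i\<in>active. (1 - q ^ \<nu> i) * (\<Prod>k\<in>active - {i}. 1 - q ^ \<nu> k / t) *
        (\<Prod>j\<in>active - {i}. right_factor t (y j / y i) (q ^ \<nu> i) (q ^ \<nu> j)))"
    by (rule residue_identity_0) (use q t y poles_distinct in auto)
  then show ?thesis
    by (simp only: left_term right_term sum_distrib_left[symmetric] cong: sum.cong)
qed

lemma kappa_edges_update:
  assumes "i \<in> {1..n}"
  shows "kappa_edges q t (y(i := v)) c n (\<nu>(i := a)) =
    edge_coeff q t (c / v) a * (\<Prod>j\<in>{1..n} - {i}. edge_coeff q t (c / y j) (\<nu> j))"
  unfolding kappa_edges_def using assms
  by (subst prod.remove[of _ i]) (auto intro!: prod.cong)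

lemma kappa_edges_left:
  assumes i: "i \<in> active" and c: "\<And>i. i \<in> {1..n} \<Longrightarrow> generic q t (c / y i)"
  shows "kappa_edges q t (shift_y i) c n (lower i) * mac_factor q t (c / y i) =
    kappa_edges q t y c n \<nu> * ((1 - t * (c / y i)) / (1 - c / y i))"
proof -
  obtain a where a: "\<nu> i = Suc a" using i by (cases "\<nu> i") auto
  have i': "i \<in> {1..n}" using i by simp
  let ?R = "\<Prod>j\<in>{1..n} - {i}. edge_coeff q t (c / y j) (\<nu> j)"
  have 1: "kappa_edges q t (shift_y i) c n (\<nu>(i := a)) = edge_coeff q t (q * (c / y i)) a * ?R"
    using kappa_edges_update[OF i', of "y i / q" c a] by (simp add: mult.commute)
  have 2: "kappa_edges q t y c n \<nu> = edge_coeff q t (c / y i) (Suc a) * ?R"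
    using kappa_edges_update[OF i', of "y i" c "Suc a"] a by (simp add: fun_upd_idem)
  show ?thesis
    using arg_cong2[of _ _ _ _ "(*)", OF edge_coeff_left[OF q(1) t c[OF i'], of a] refl[of ?R]] a
    unfolding 2 by (simp only: 1 diff_Suc_1 mult_ac)
qed

lemma kappa_edges_right:
  assumes i: "i \<in> active" and c: "\<And>i. i \<in> {1..n} \<Longrightarrow> generic q t (c / y i)"
  shows "kappa_edges q t y c n (lower i) =
    kappa_edges q t y c n \<nu> * ((1 - q ^ \<nu> i * (c / y i)) / (1 - q ^ \<nu> i * (c / y i) / t))"
proof -
  obtain a where a: "\<nu> i = Suc a" using i by (cases "\<nu> i") auto
  have i': "i \<in> {1..n}" using i by simp
  then show ?thesis
    using edge_coeff_right[OF q(1) t c[OF i'], of a] a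
      kappa_edges_update[OF i', of "y i" c a] kappa_edges_update[OF i', of "y i" c "Suc a"]
    by (simp add: fun_upd_idem mult_ac)
qed

lemma kappa_edges_shift:
  assumes c: "\<And>i. i \<in> {1..n} \<Longrightarrow> generic q t (c / y i)"
  shows "kappa_edges q t y (c / q) n \<nu> = kappa_edges q t y c n \<nu> *
    (\<Prod>i\<in>active. (1 - c / y i / t) * (1 - q ^ \<nu> i * (c / y i)) / ((1 - c / y i) * (1 - q ^ \<nu> i * (c / y i) / t)))"
proof -
  let ?f = "\<lambda>i. (1 - c / y i / t) * (1 - q ^ \<nu> i * (c / y i)) / ((1 - c / y i) * (1 - q ^ \<nu> i * (c / y i) / t))"
  have "edge_coeff q t (c / q / y i) (\<nu> i) = edge_coeff q t (c / y i) (\<nu> i) * ?f i" if "i \<in> {1..n}" for i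
    using edge_coeff_shift[OF q(1) t c[OF that], of "\<nu> i"] by (simp add: mult_ac)
  then have "kappa_edges q t y (c / q) n \<nu> = kappa_edges q t y c n \<nu> * (\<Prod>i\<in>{1..n}. ?f i)"
    unfolding kappa_edges_def prod.distrib[symmetric] by (intro prod.cong refl)
  also have "(\<Prod>i\<in>{1..n}. ?f i) = (\<Prod>i\<in>active. ?f i)"
  proof (rule prod.mono_neutral_right)
    show "\<forall>i\<in>{1..n} - active. ?f i = 1"
      using generic_nonzero'(1,6)[OF q(1) t c] by auto
  qed auto
  finally show ?thesis .
qed

text \<open>The summands outside the two sums belong to the index n + 1: on the left its shift
  replaces \<open>c\<close> by \<open>c / q\<close>, on the right it adds the unchanged coefficient.
  The factor \<open>1 / t\<close> compensates the \<open>t\<close> in the weights of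
  \<open>K\<close>.\<close>

lemma kappa_mac_intertwine:
  assumes c: "\<And>i. i \<in> {1..n} \<Longrightarrow> generic q t (c / y i)"
  shows "(1 / t) * (\<Sum>i\<in>active. kappa q t (shift_y i) n (lower i) * kappa_edges q t (shift_y i) c n (lower i) *
        (mac_coeff q t y n i * mac_factor q t (c / y i))) +
      kappa q t y n \<nu> * kappa_edges q t y (c / q) n \<nu> =
    (1 / t) * (\<Sum>i\<in>active. kappa q t y n (lower i) * kappa_edges q t y c n (lower i) *
        mac_coeff q t (\<lambda>j. y j / q ^ lower i j) n i) +
      kappa q t y n \<nu> * kappa_edges q t y c n \<nu>"
    (is "_ * sum ?left _ + _ = _ * sum ?right _ + _")
proof -
  let ?K = "scalar_part * kappa_pairs q t y n \<nu> * kappa_edges q t y c n \<nu>"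
  let ?E = "\<lambda>i. \<Prod>k\<in>active - {i}. 1 - q ^ \<nu> k / t"
  let ?\<alpha> = "\<lambda>i. \<Prod>j\<in>active - {i}. left_factor t (y j / y i) (q ^ \<nu> j)"
  let ?\<beta> = "\<lambda>i. \<Prod>j\<in>active - {i}. right_factor t (y j / y i) (q ^ \<nu> i) (q ^ \<nu> j)"
  let ?F = "\<Prod>i\<in>active. (1 - c / y i / t) * (1 - q ^ \<nu> i * (c / y i)) / ((1 - c / y i) * (1 - q ^ \<nu> i * (c / y i) / t))"
  let ?l = "\<lambda>i. (1 - q ^ \<nu> i) * ?E i * (?\<alpha> i * ((1 - t * (c / y i)) / (1 - c / y i)))"
  let ?r = "\<lambda>i. (1 - q ^ \<nu> i) * ?E i *
      (?\<beta> i * ((1 - q ^ \<nu> i * (c / y i)) / (1 - q ^ \<nu> i * (c / y i) / t)))"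
  let ?P = "\<Prod>k\<in>active. 1 - q ^ \<nu> k / t"
  have cy: "c \<noteq> y i" "c \<noteq> t * y i / q ^ \<nu> i" if "i \<in> active" for i
  proof -
    have "q ^ 0 * (c / y i) \<noteq> q ^ 0" "q ^ \<nu> i * (c / y i) \<noteq> t * q ^ 0"
      using c[of i] that unfolding generic_def by blast+
    then show "c \<noteq> y i" "c \<noteq> t * y i / q ^ \<nu> i"
      using y[of i] that q(1) by (auto simp: field_simps)
  qed
  have main: "(1 / t) * sum ?l active + ?P * ?F = (1 / t) * sum ?r active + ?P"
    by (rule residue_identity) (use q t y poles_distinct cy in auto)
  have "?left i = ?K * ?l i" if i: "i \<in> active" for i
    using arg_cong2[of _ _ _ _ "(*)", OF left_term[OF i] kappa_edges_left[OF i c]]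
    by (simp only: mult_ac)
  then have L: "sum ?left active = ?K * sum ?l active"
    unfolding sum_distrib_left by (rule sum.cong[OF refl])
  have "?right i = ?K * ?r i" if i: "i \<in> active" for i
    using arg_cong2[of _ _ _ _ "(*)", OF right_term[OF i] kappa_edges_right[OF i c]]
    by (simp only: mult_ac)
  then have R: "sum ?right active = ?K * sum ?r active"
    unfolding sum_distrib_left by (rule sum.cong[OF refl])
  have shift: "kappa_edges q t y (c / q) n \<nu> = kappa_edges q t y c n \<nu> * ?F"
    by (rule kappa_edges_shift) (rule c)
  have "(1 / t) * (?K * sum ?l active) + scalar_part * ?P * kappa_pairs q t y n \<nu> * (kappa_edges q t y c n \<nu> * ?F) =
      ?K * ((1 / t) * sum ?l active + ?P * ?F)"
    by (simp only: distrib_left mult_ac)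
  also have "\<dots> = (1 / t) * (?K * sum ?r active) + scalar_part * ?P * kappa_pairs q t y n \<nu> * kappa_edges q t y c n \<nu>"
    unfolding main by (simp only: distrib_left mult_ac)
  finally show ?thesis
    unfolding L R kappa_def[of _ _ y n \<nu>] kappa_scalar_eq shift .
qed

end

section \<open>Coefficients of the operators as power series\<close>

definition K_coeff :: "nat \<Rightarrow> alphabet \<Rightarrow> complex \<Rightarrow> complex \<Rightarrow> (nat \<Rightarrow> nat) \<Rightarrow> ratio_series"
  where "K_coeff n a q t \<nu> =
    (\<Prod>i\<in>{1..n}. qpoch q (mfps_const t) (\<nu> i) / qpoch q (mfps_const q) (\<nu> i)) *
    (\<Prod>j\<in>{1..n}. \<Prod>i\<in>{1..<j}.
       qpoch q (mfps_const t * ratio a i j) (\<nu> i) /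
       qpoch q (mfps_const q * ratio a i j) (\<nu> i) *
       (qpoch q (mfps_const (q powi (- int (\<nu> j) + 1) / t) * ratio a i j) (\<nu> i) /
        qpoch q (mfps_const (q powi (- int (\<nu> j))) * ratio a i j) (\<nu> i)))"

text \<open>In \<open>c_coeff\<close> the last column meets the index n + 1 only in the first
  product, where j runs up to k and not just up to k - 1. Hence there is one quotient for each index
  here, but two for each pair in \<open>K_coeff\<close>.\<close>

definition edge_series :: "nat \<Rightarrow> alphabet \<Rightarrow> complex \<Rightarrow> complex \<Rightarrow> (nat \<Rightarrow> nat) \<Rightarrow> ratio_series"
  where "edge_series n a q t \<nu> =
    (\<Prod>i\<in>{1..n}. qpoch q (mfps_const t * ratio a i (n + 1)) (\<nu> i) /
      qpoch q (mfps_const q * ratio a i (n + 1)) (\<nu> i))"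

definition mac_series_factor :: "complex \<Rightarrow> complex \<Rightarrow> ratio_series \<Rightarrow> ratio_series"
  where "mac_series_factor q t r =
    (1 - mfps_const (q / t) * r) * (1 - mfps_const t * r) / ((1 - mfps_const q * r) * (1 - r))"

definition mac_series :: "nat \<Rightarrow> alphabet \<Rightarrow> complex \<Rightarrow> complex \<Rightarrow> nat \<Rightarrow> ratio_series"
  where "mac_series n a q t i = (\<Prod>j\<in>{i+1..n}. mac_series_factor q t (ratio a i j))"

abbreviation neg_vec :: "(nat \<Rightarrow> nat) \<Rightarrow> nat \<Rightarrow> int"
  where "neg_vec \<nu> \<equiv> \<lambda>i. - int (\<nu> i)"

abbreviation neg_unit :: "nat \<Rightarrow> nat \<Rightarrow> int"
  where "neg_unit i \<equiv> \<lambda>j. if j = i then - 1 else 0"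

section \<open>Transfer of the identities from the field of fractions\<close>

abbreviation fconst :: "complex \<Rightarrow> ratio_series fract"
  where "fconst c \<equiv> to_fract (mfps_const c)"

lemma fconst_simps:
  shows "fconst 1 = 1" "fconst (c * d) = fconst c * fconst d" "fconst (c - d) = fconst c - fconst d"
    and fconst_eq_iff: "fconst c = fconst d \<longleftrightarrow> c = d"
  by (simp_all add: mfps_const_1 mfps_const_mult mfps_const_diff) (auto simp: mfps_eq_iff mfps_nth_const)

lemma fconst_0 [simp]: "fconst 0 = 0"
  by (simp add: mfps_const_def zero_mfps_def[symmetric])

lemma fconst_neq_0: "c \<noteq> 0 \<Longrightarrow> fconst c \<noteq> 0"
  using fconst_eq_iff[of c 0] by simp

lemma fconst_divide: "fconst (c / d) = fconst c / fconst d"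
proof (cases "d = 0")
  case False
  then have "fconst (c / d) * fconst d = fconst c"
    by (simp flip: fconst_simps)
  with fconst_neq_0[OF False] show ?thesis
    by (simp add: field_simps)
qed simp

lemma fconst_power: "fconst (c ^ k) = fconst c ^ k"
  by (induction k) (simp_all add: fconst_simps mfps_const_1 del: to_fract_mult)

lemma fconst_powi: "fconst (c powi k) = fconst c powi k"
  by (simp add: power_int_def fconst_power inverse_eq_divide fconst_divide power_one_over fconst_simps(1))

lemma to_fract_qpoch: "to_fract (qpoch q z k) = fpoch (fconst q) (to_fract z) k"
  by (simp add: qpoch_def fpoch_def to_fract_prod fconst_power[symmetric])

text \<open>Inside the field of fractions the variable \<open>a\<^sub>j\<close> can be replaced by \<open>a\<^sub>j / a\<^sub>1\<close>.\<close>

abbreviation fvar :: "alphabet \<Rightarrow> nat \<Rightarrow> ratio_series fract"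
  where "fvar a j \<equiv> to_fract (ratio a 1 j)"

lemma fvar_neq_0: "fvar a j \<noteq> 0"
  by (simp add: ratio_neq_0)

lemma to_fract_ratio: "1 \<le> i \<Longrightarrow> i \<le> j \<Longrightarrow> to_fract (ratio a i j) = fvar a j / fvar a i"
  using ratio_mult[of 1 i j a, symmetric] by (simp add: ratio_neq_0)

lemma fvar_neq:
  assumes "i \<noteq> j" "1 \<le> i" "1 \<le> j" "c \<noteq> 0"
  shows "fconst c * fvar a j \<noteq> fconst d * fvar a i"
proof
  assume "fconst c * fvar a j = fconst d * fvar a i"
  then have "mfps_const c * ratio a 1 j = mfps_const d * ratio a 1 i"
    by (simp flip: to_fract_mult)
  then have "c * mfps_nth (ratio a 1 j) (ratio_exponent a 1 j) = d * mfps_nth (ratio a 1 i) (ratio_exponent a 1 j)"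
    by (metis mfps_nth_const_mult)
  moreover have "ratio_exponent a 1 j \<noteq> ratio_exponent a 1 i"
  proof
    assume "ratio_exponent a 1 j = ratio_exponent a 1 i"
    then have "lookup (ratio_exponent a 1 j) (a, min i j) = lookup (ratio_exponent a 1 i) (a, min i j)"
      by simp
    then show False
      using assms by (auto simp: lookup_ratio_exponent split: if_splits)
  qed
  ultimately show False
    using assms by (simp add: mfps_nth_ratio)
qed

text \<open>Different variables correspond to different monomials, so no nonzero multiple of their
  quotient is a constant.\<close>

lemma generic_fvar:
  assumes q: "q \<noteq> 0" and t: "t \<noteq> 0" and ij: "i \<noteq> j" "1 \<le> i" "1 \<le> j"
  shows "generic (fconst q) (fconst t) (fvar a j / fvar a i)"
proof -
  have "fconst c * (fvar a j / fvar a i) \<noteq> fconst d" if "c \<noteq> 0" for c d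
    using fvar_neq[OF ij that, of a d] fvar_neq_0[of a i] by (simp add: field_simps)
  from this[of "q ^ _" "q ^ _"] this[of "t * q ^ _" "q ^ _"] this[of "q ^ _" "t * q ^ _"]
  show ?thesis
    using q t unfolding generic_def by (simp add: fconst_power fconst_simps(2) del: to_fract_mult)
qed

lemma qshift_qpoch: "qshift q a e (qpoch q z k) = qpoch q (qshift q a e z) k"
  by (simp add: qshift_def mfps_rescale_qpoch)

lemma qshift_divide: "qshift q a e (f / g) = qshift q a e f / qshift q a e g"
  by (simp add: qshift_def mfps_rescale_divide)

lemma qshift_prod: "qshift q a e (\<Prod>i\<in>A. F i) = (\<Prod>i\<in>A. qshift q a e (F i))"
  by (simp add: qshift_def mfps_rescale_prod)

lemma qshift_const: "qshift q a e (mfps_const c) = mfps_const c"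
  by (simp add: qshift_def mfps_rescale_const)

lemma mfps_nth_qshift_0: "mfps_nth (qshift q a e f) 0 = mfps_nth f 0"
  by (simp add: qshift_def)

context
  fixes q t :: complex and a :: alphabet
  assumes q: "q \<noteq> 0" "norm q < 1" and t: "t \<noteq> 0"
begin

abbreviation "shifted e \<equiv> \<lambda>j. fconst q powi e j * fvar a j"

lemma to_fract_qshift_ratio:
  assumes "1 \<le> i" "i \<le> j"
  shows "to_fract (qshift q a e (mfps_const c * ratio a i j)) = fconst c * (shifted e j / shifted e i)"
proof -
  have "fconst (q powi (e j - e i)) = fconst q powi e j / fconst q powi e i"
    using fconst_neq_0[OF q(1)] by (simp add: fconst_powi power_int_diff)
  then show ?thesis
    unfolding qshift_mult qshift_const qshift_ratio[OF q(1) assms(2)] to_fract_mult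
      to_fract_ratio[OF assms]
    by (simp only: times_divide_times_eq)
qed

lemma to_fract_qshift_qpoch_ratio:
  assumes "1 \<le> i" "i \<le> j"
  shows "to_fract (qshift q a e (qpoch q (mfps_const c * ratio a i j) k)) =
    fpoch (fconst q) (fconst c * (shifted e j / shifted e i)) k"
  by (simp only: qshift_qpoch to_fract_qpoch to_fract_qshift_ratio[OF assms])

lemma to_fract_qshift_divide:
  assumes "mfps_nth g 0 \<noteq> 0"
  shows "to_fract (qshift q a e (f / g)) = to_fract (qshift q a e f) / to_fract (qshift q a e g)"
  unfolding qshift_divide using assms by (intro to_fract_divide) (simp add: mfps_nth_qshift_0)

lemma to_fract_qshift_ratio_divide:
  assumes "1 \<le> i" "i < j"
  shows "to_fract (qshift q a e (qpoch q (mfps_const c * ratio a i j) k / qpoch q (mfps_const d * ratio a i j) k)) =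
    fpoch (fconst q) (fconst c * (shifted e j / shifted e i)) k /
    fpoch (fconst q) (fconst d * (shifted e j / shifted e i)) k"
  using assms by (subst to_fract_qshift_divide) (simp_all add: to_fract_qshift_qpoch_ratio)

lemma to_fract_K_coeff:
  "to_fract (qshift q a e (K_coeff n a q (q / t) \<nu>)) =
    kappa (fconst q) (fconst t) (shifted e) n \<nu>"
proof -
  have "to_fract (qshift q a e (qpoch q (mfps_const (q / t)) k / qpoch q (mfps_const q) k)) =
      fpoch (fconst q) (fconst q / fconst t) k / fpoch (fconst q) (fconst q) k" for k
  proof (subst to_fract_qshift_divide)
    show "mfps_nth (qpoch q (mfps_const q) k) 0 \<noteq> 0"
      using qfact_neq_0[OF q(2)] by (simp add: qpoch_const mfps_nth_const)
  qed (simp_all add: qshift_qpoch to_fract_qpoch qshift_const fconst_divide)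
  moreover have "to_fract (qshift q a e
        (qpoch q (mfps_const (q / t) * ratio a i j) k / qpoch q (mfps_const q * ratio a i j) k *
         (qpoch q (mfps_const (q powi (- int l + 1) / (q / t)) * ratio a i j) k /
          qpoch q (mfps_const (q powi (- int l)) * ratio a i j) k))) =
      pair_coeff (fconst q) (fconst t) (shifted e j / shifted e i) k l" if "1 \<le> i" "i < j" for i j k l
  proof -
    have "q powi (- int l + 1) = q powi (- int l) * q powi 1"
      using q(1) by (intro power_int_add) simp
    then have "q powi (- int l + 1) / (q / t) = t / q ^ l"
      using q(1) t by (simp add: power_int_minus field_simps)
    then have 1: "fconst (q powi (- int l + 1) / (q / t)) = fconst t / fconst q ^ l"
      by (simp only: fconst_divide fconst_power)
    have "q powi (- int l) = 1 / q ^ l"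
      by (simp add: power_int_minus field_simps)
    then have 2: "fconst (q powi (- int l)) = 1 / fconst q ^ l"
      by (simp only: fconst_divide fconst_power fconst_simps)
    show ?thesis
      using that
      by (simp only: qshift_mult to_fract_mult to_fract_qshift_ratio_divide 1 2 pair_coeff_def fconst_divide[of q t]
          times_divide_eq_left mult_1)
  qed
  ultimately show ?thesis
    by (simp add: K_coeff_def kappa_def kappa_scalar_def kappa_pairs_def qshift_mult qshift_prod to_fract_prod)
qed

lemma to_fract_edge_series:
  "to_fract (qshift q a e (edge_series n a q (q / t) \<nu>)) =
    kappa_edges (fconst q) (fconst t) (shifted e) (shifted e (n + 1)) n \<nu>"
  unfolding edge_series_def kappa_edges_def qshift_prod to_fract_prod edge_coeff_def
  by (intro prod.cong refl, subst to_fract_qshift_ratio_divide) (auto simp: fconst_divide)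

lemma to_fract_mac_factor:
  assumes "1 \<le> i" "i < j"
  shows "to_fract (qshift q a e (mac_series_factor q t (ratio a i j))) =
    mac_factor (fconst q) (fconst t) (shifted e j / shifted e i)"
proof -
  have *: "to_fract (qshift q a e (1 - mfps_const c * ratio a i j)) = 1 - fconst c * (shifted e j / shifted e i)" for c
  proof -
    have "qshift q a e (1 - mfps_const c * ratio a i j) = 1 - qshift q a e (mfps_const c * ratio a i j)"
      by (simp add: qshift_def mfps_rescale_diff mfps_rescale_1)
    then show ?thesis
      using assms by (simp only: to_fract_diff to_fract_1 to_fract_qshift_ratio less_imp_le)
  qed
  have "to_fract (qshift q a e (1 - ratio a i j)) = 1 - shifted e j / shifted e i"
    using *[of 1] by (simp add: mfps_const_1)
  then show ?thesis
    unfolding mac_series_factor_def mac_factor_def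
    using assms by (subst to_fract_qshift_divide) (simp_all add: mfps_nth_1 qshift_mult * fconst_divide)
qed

lemma to_fract_mac_series:
  "1 \<le> i \<Longrightarrow> to_fract (qshift q a e (mac_series n a q t i)) = mac_coeff (fconst q) (fconst t) (shifted e) n i"
  unfolding mac_series_def mac_coeff_def qshift_prod to_fract_prod
  by (intro prod.cong refl to_fract_mac_factor) auto

lemma shifted_0: "shifted (\<lambda>_. 0) = fvar a"
  by simp

lemma shifted_neg_unit: "shifted (neg_unit i) = (fvar a)(i := fvar a i / fconst q)"
  by (auto simp: fun_eq_iff power_int_minus field_simps)

lemma shifted_neg_vec: "shifted (neg_vec \<nu>) = (\<lambda>j. fvar a j / fconst q ^ \<nu> j)"
  by (auto simp: fun_eq_iff power_int_minus field_simps)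

lemma fconst_root_of_unity: "k > 0 \<Longrightarrow> fconst q ^ k \<noteq> 1"
  using one_minus_power_neq_0[OF q(2), of k] fconst_eq_iff[of "q ^ k" 1]
  by (auto simp: fconst_power mfps_const_1)

lemmas to_fract_K_coeff' = to_fract_K_coeff[of "\<lambda>_. 0", unfolded qshift_zero shifted_0]
lemmas to_fract_edge_series' = to_fract_edge_series[of "\<lambda>_. 0", unfolded qshift_zero, simplified]
lemmas to_fract_mac_series' = to_fract_mac_series[of _ "\<lambda>_. 0", unfolded qshift_zero shifted_0]
lemmas to_fract_mac_factor' = to_fract_mac_factor[of _ _ "\<lambda>_. 0", unfolded qshift_zero, simplified]

abbreviation "supp (n :: nat) \<nu> \<equiv> {i \<in> {1..n}. \<nu> i \<noteq> (0 :: nat)}"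
abbreviation "pred \<nu> i \<equiv> \<nu>(i := \<nu> i - (1 :: nat))"

lemma to_fract_shift_simps:
  "to_fract (qshift q a (neg_unit i) (K_coeff n a q (q / t) \<mu>)) =
    kappa (fconst q) (fconst t) ((fvar a)(i := fvar a i / fconst q)) n \<mu>"
  "1 \<le> i \<Longrightarrow> to_fract (qshift q a (neg_vec \<mu>) (mac_series n a q t i)) =
    mac_coeff (fconst q) (fconst t) (\<lambda>j. fvar a j / fconst q ^ \<mu> j) n i"
  by (simp_all only: to_fract_K_coeff to_fract_mac_series shifted_neg_unit shifted_neg_vec)

lemma K_coeff_mac_commute:
  "(\<Sum>i\<in>supp n \<nu>. qshift q a (neg_unit i) (K_coeff n a q (q / t) (pred \<nu> i)) * mac_series n a q t i) =
   (\<Sum>i\<in>supp n \<nu>. K_coeff n a q (q / t) (pred \<nu> i) * qshift q a (neg_vec (pred \<nu> i)) (mac_series n a q t i))"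
  (is "?L = ?R")
proof -
  let ?Q = "fconst q" and ?T = "fconst t" and ?y = "fvar a"
  have "to_fract ?L = (\<Sum>i\<in>supp n \<nu>. kappa ?Q ?T (?y(i := ?y i / ?Q)) n (pred \<nu> i) * mac_coeff ?Q ?T ?y n i)"
    unfolding to_fract_sum to_fract_mult
    by (intro sum.cong refl) (simp only: to_fract_shift_simps to_fract_mac_series' mem_Collect_eq atLeastAtMost_iff)
  also have "\<dots> = (\<Sum>i\<in>supp n \<nu>. kappa ?Q ?T ?y n (pred \<nu> i) * mac_coeff ?Q ?T (\<lambda>j. ?y j / ?Q ^ (pred \<nu> i) j) n i)"
    by (rule kappa_mac_commute)
      (use fconst_neq_0[OF q(1)] fconst_neq_0[OF t] fconst_root_of_unity in
        \<open>auto simp: ratio_neq_0 intro!: generic_fvar q(1) t\<close>)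
  also have "\<dots> = to_fract ?R"
    unfolding to_fract_sum to_fract_mult
    by (intro sum.cong refl) (simp only: to_fract_shift_simps to_fract_K_coeff' mem_Collect_eq atLeastAtMost_iff)
  finally show ?thesis by (simp only: to_fract_eq_iff)
qed

lemma K_coeff_mac_intertwine:
  "mfps_const (1 / t) * (\<Sum>i\<in>supp n \<nu>. qshift q a (neg_unit i)
        (K_coeff n a q (q / t) (pred \<nu> i) * edge_series n a q (q / t) (pred \<nu> i)) * mac_series (n + 1) a q t i) +
    qshift q a (neg_unit (n + 1)) (K_coeff n a q (q / t) \<nu> * edge_series n a q (q / t) \<nu>) =
   mfps_const (1 / t) * (\<Sum>i\<in>supp n \<nu>. K_coeff n a q (q / t) (pred \<nu> i) * edge_series n a q (q / t) (pred \<nu> i) *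
        qshift q a (neg_vec (pred \<nu> i)) (mac_series n a q t i)) +
    K_coeff n a q (q / t) \<nu> * edge_series n a q (q / t) \<nu>"
  (is "?L = ?R")
proof -
  let ?Q = "fconst q" and ?T = "fconst t" and ?y = "fvar a" and ?c = "fvar a (n + 1)"
  have edge_unit: "to_fract (qshift q a (neg_unit i) (edge_series n a q (q / t) \<mu>)) =
      kappa_edges ?Q ?T (?y(i := ?y i / ?Q)) ?c n \<mu>" if "i \<in> {1..n}" for i \<mu>
    using that unfolding to_fract_edge_series shifted_neg_unit by simp
  have edge_top: "to_fract (qshift q a (neg_unit (n + 1)) (edge_series n a q (q / t) \<nu>)) =
      kappa_edges ?Q ?T ?y (?c / ?Q) n \<nu>"
    unfolding to_fract_edge_series shifted_neg_unit
    by (auto simp: kappa_edges_def power_int_minus divide_inverse mult_ac intro!: prod.cong)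
  \<comment> \<open>The shift of the variable n + 1 does not reach the first n variables, so it
    changes only the edge factors.\<close>
  have K_top: "to_fract (qshift q a (neg_unit (n + 1)) (K_coeff n a q (q / t) \<nu>)) =
      kappa ?Q ?T ?y n \<nu>"
    unfolding to_fract_K_coeff shifted_neg_unit
    by (auto simp: kappa_def kappa_pairs_def intro!: prod.cong)
  have mac_top: "mac_series (n + 1) a q t i = mac_series n a q t i * mac_series_factor q t (ratio a i (n + 1))"
    if "i \<in> {1..n}" for i
  proof -
    have "{i+1..n+1} = insert (n + 1) {i+1..n}" using that by auto
    then show ?thesis by (simp add: mac_series_def mult.commute)
  qed
  have mac_edge: "to_fract (mac_series_factor q t (ratio a i (n + 1))) = mac_factor ?Q ?T (?c / ?y i)"
    if "i \<in> {1..n}" for i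
    using that by (intro to_fract_mac_factor') auto
  have "to_fract ?L = (1 / ?T) * (\<Sum>i\<in>supp n \<nu>. kappa ?Q ?T (?y(i := ?y i / ?Q)) n (pred \<nu> i) *
        kappa_edges ?Q ?T (?y(i := ?y i / ?Q)) ?c n (pred \<nu> i) *
        (mac_coeff ?Q ?T ?y n i * mac_factor ?Q ?T (?c / ?y i))) +
      kappa ?Q ?T ?y n \<nu> * kappa_edges ?Q ?T ?y (?c / ?Q) n \<nu>"
    unfolding to_fract_add to_fract_mult to_fract_sum qshift_mult K_top edge_top fconst_divide fconst_simps(1)
    by (intro arg_cong2[of _ _ _ _ "(+)"] arg_cong2[of _ _ _ _ "(*)"] sum.cong refl)
      (simp_all only: to_fract_shift_simps edge_unit mac_top to_fract_mult to_fract_mac_series'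
        mac_edge mem_Collect_eq atLeastAtMost_iff)
  also have "\<dots> = (1 / ?T) * (\<Sum>i\<in>supp n \<nu>. kappa ?Q ?T ?y n (pred \<nu> i) * kappa_edges ?Q ?T ?y ?c n (pred \<nu> i) *
        mac_coeff ?Q ?T (\<lambda>j. ?y j / ?Q ^ (pred \<nu> i) j) n i) +
      kappa ?Q ?T ?y n \<nu> * kappa_edges ?Q ?T ?y ?c n \<nu>"
    by (rule kappa_mac_intertwine)
      (use fconst_neq_0[OF q(1)] fconst_neq_0[OF t] fconst_root_of_unity in
        \<open>auto simp: ratio_neq_0 intro!: generic_fvar q(1) t\<close>)
  also have "\<dots> = to_fract ?R"
    unfolding to_fract_add to_fract_mult to_fract_sum to_fract_K_coeff' to_fract_edge_series'
      fconst_divide fconst_simps(1)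
    by (intro arg_cong2[of _ _ _ _ "(+)"] arg_cong2[of _ _ _ _ "(*)"] sum.cong refl)
      (simp_all only: to_fract_shift_simps mem_Collect_eq atLeastAtMost_iff)
  finally show ?thesis by (simp only: to_fract_eq_iff)
qed

end

section \<open>Operators\<close>

abbreviation vec_monom :: "nat \<Rightarrow> (nat \<Rightarrow> ratio_series) \<Rightarrow> (nat \<Rightarrow> nat) \<Rightarrow> ratio_series"
  where "vec_monom n w \<nu> \<equiv> \<Prod>i\<in>{1..n}. w i ^ \<nu> i"

text \<open>The coefficients are left free because the column recursion uses \<open>K_coeff\<close>
  multiplied by the edge factors.\<close>

definition Op :: "nat \<Rightarrow> alphabet \<Rightarrow> complex \<Rightarrow> (nat \<Rightarrow> ratio_series) \<Rightarrow>
    ((nat \<Rightarrow> nat) \<Rightarrow> ratio_series) \<Rightarrow> ratio_series \<Rightarrow> ratio_series"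
  where "Op n a q w c f = (\<Sum>\<^sub>\<infinity>\<nu>\<in>nat_vecs n. vec_monom n w \<nu> * c \<nu> * qshift q a (neg_vec \<nu>) f)"

lemma K_op_eq_Op: "K_op n a b q t w f = Op n a q w (K_coeff n a q t) f"
  unfolding K_op_def Op_def K_coeff_def by (simp only: mult.assoc)

lemma ord_ge_vec_monom:
  "(\<And>i. i \<in> {1..n} \<Longrightarrow> mfps_nth (w i) 0 = 0) \<Longrightarrow> ord_ge (vec_size n \<nu>) (vec_monom n w \<nu>)"
  by (intro ord_ge_prod ord_ge_power)

lemma infsum_nat_vecs_pred:
  assumes i: "i \<in> {1..n}"
  shows "(\<Sum>\<^sub>\<infinity>\<nu>\<in>nat_vecs n. if \<nu> i = 0 then 0 else F (pred \<nu> i)) = (\<Sum>\<^sub>\<infinity>\<nu>\<in>nat_vecs n. F \<nu> :: ratio_series)"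
proof -
  have "bij_betw (\<lambda>\<nu>. \<nu>(i := Suc (\<nu> i))) (nat_vecs n) {\<nu> \<in> nat_vecs n. \<nu> i \<noteq> 0}"
    by (rule bij_betwI[where g = "\<lambda>\<nu>. pred \<nu> i"]) (use i in \<open>auto simp: nat_vecs_def\<close>)
  from infsum_reindex_bij_betw[OF this, of "\<lambda>\<nu>. F (pred \<nu> i)"]
  have "(\<Sum>\<^sub>\<infinity>\<nu>\<in>nat_vecs n. F \<nu>) = (\<Sum>\<^sub>\<infinity>\<nu>\<in>{\<nu> \<in> nat_vecs n. \<nu> i \<noteq> 0}. F (pred \<nu> i))"
    by simp
  also have "\<dots> = (\<Sum>\<^sub>\<infinity>\<nu>\<in>nat_vecs n. if \<nu> i = 0 then 0 else F (pred \<nu> i))"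
    by (rule infsum_cong_neutral) auto
  finally show ?thesis ..
qed

lemma vec_monom_pred:
  assumes "i \<in> {1..n}" "\<nu> i \<noteq> 0"
  shows "vec_monom n w \<nu> = w i * vec_monom n w (pred \<nu> i)"
proof -
  have "vec_monom n w \<nu> = w i ^ \<nu> i * (\<Prod>j\<in>{1..n} - {i}. w j ^ \<nu> j)"
    using assms by (intro prod.remove) auto
  also have "w i ^ \<nu> i = w i * w i ^ (\<nu> i - 1)"
    using assms(2) by (cases "\<nu> i") auto
  also have "(\<Prod>j\<in>{1..n} - {i}. w j ^ \<nu> j) = (\<Prod>j\<in>{1..n} - {i}. w j ^ (pred \<nu> i) j)"
    by (intro prod.cong) auto
  also have "w i * w i ^ (\<nu> i - 1) * \<dots> = w i * (w i ^ (pred \<nu> i) i * (\<Prod>j\<in>{1..n} - {i}. w j ^ (pred \<nu> i) j))"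
    by (simp add: mult.assoc)
  also have "w i ^ (pred \<nu> i) i * (\<Prod>j\<in>{1..n} - {i}. w j ^ (pred \<nu> i) j) = vec_monom n w (pred \<nu> i)"
    using assms by (intro prod.remove[symmetric]) auto
  finally show ?thesis .
qed

lemma neg_vec_pred: "\<nu> i \<noteq> 0 \<Longrightarrow> neg_vec \<nu> = (\<lambda>j. neg_unit i j + neg_vec (pred \<nu> i) j)"
  by (auto simp: fun_eq_iff)

lemma sum_supp:
  fixes \<nu> :: "nat \<Rightarrow> nat"
  shows "(\<Sum>i\<in>supp n \<nu>. F i) = (\<Sum>i\<in>{1..n}. if \<nu> i = 0 then 0 else F i)"
  by (subst sum.inter_filter) (auto intro: sum.cong)

context
  fixes n :: nat and a :: alphabet and q :: complex and w :: "nat \<Rightarrow> ratio_series"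
  assumes q0: "q \<noteq> 0" and w0: "\<And>i. i \<in> {1..n} \<Longrightarrow> mfps_nth (w i) 0 = 0"
    and winv: "\<And>e i. i \<in> {1..n} \<Longrightarrow> qshift q a e (w i) = w i"
begin

lemma locally_finite_vec_monom: "locally_finite (\<lambda>\<nu>. vec_monom n w \<nu> * g \<nu>) (nat_vecs n)"
  by (rule locally_finite_ord_ge[where W = "vec_size n"])
    (use ord_ge_vec_monom[of n w] w0 finite_nat_vecs_le in \<open>auto intro: ord_ge_mult_left\<close>)

lemma locally_finite_Op: "locally_finite (\<lambda>\<nu>. vec_monom n w \<nu> * c \<nu> * g \<nu>) (nat_vecs n)"
  unfolding mult.assoc by (rule locally_finite_vec_monom)

lemma qshift_vec_monom: "qshift q a e (vec_monom n w \<nu>) = vec_monom n w \<nu>"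
proof -
  have "qshift q a e (vec_monom n w \<nu>) = vec_monom n (\<lambda>i. qshift q a e (w i)) \<nu>"
    by (simp add: qshift_def mfps_rescale_prod mfps_rescale_power)
  also have "\<dots> = vec_monom n w \<nu>"
    by (intro prod.cong) (auto simp: winv)
  finally show ?thesis .
qed

lemma Op_cong: "(\<And>\<nu>. \<nu> \<in> nat_vecs n \<Longrightarrow> c \<nu> = c' \<nu>) \<Longrightarrow> Op n a q w c f = Op n a q w c' f"
  unfolding Op_def by (intro infsum_cong) simp

lemma Op_mult_left:
  assumes "\<And>e. qshift q a e g = g"
  shows "Op n a q w c (g * f) = g * Op n a q w c f"
  unfolding Op_def infsum_mult_left_mfps[OF locally_finite_Op]
  by (intro infsum_cong) (simp add: qshift_mult assms mult_ac)

lemma Op_coeff_mult: "Op n a q w (\<lambda>\<nu>. g * c \<nu>) f = g * Op n a q w c f"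
  unfolding Op_def infsum_mult_left_mfps[OF locally_finite_Op]
  by (intro infsum_cong) (simp add: mult_ac)

lemma Op_coeff_sum: "finite K \<Longrightarrow> Op n a q w (\<lambda>\<nu>. \<Sum>k\<in>K. c k \<nu>) f = (\<Sum>k\<in>K. Op n a q w (c k) f)"
  unfolding Op_def
  by (subst sum_infsum_mfps, assumption, rule locally_finite_Op)
    (simp add: sum_distrib_left sum_distrib_right)

lemma Op_coeff_add: "Op n a q w (\<lambda>\<nu>. c \<nu> + d \<nu>) f = Op n a q w c f + Op n a q w d f"
  using Op_coeff_sum[of "UNIV :: bool set" "\<lambda>b. if b then c else d" f] by (simp add: UNIV_bool add.commute)

lemma Op_sum: "finite K \<Longrightarrow> Op n a q w c (\<Sum>k\<in>K. f k) = (\<Sum>k\<in>K. Op n a q w c (f k))"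
  unfolding Op_def
  by (subst sum_infsum_mfps, assumption, rule locally_finite_Op)
    (simp add: qshift_def mfps_rescale_sum sum_distrib_left)

lemma qshift_Op: "qshift q a e (Op n a q w c f) = Op n a q w (\<lambda>\<nu>. qshift q a e (c \<nu>)) (qshift q a e f)"
proof -
  have "qshift q a e (Op n a q w c f) =
      (\<Sum>\<^sub>\<infinity>\<nu>\<in>nat_vecs n. qshift q a e (vec_monom n w \<nu> * c \<nu> * qshift q a (neg_vec \<nu>) f))"
    unfolding Op_def qshift_def[of q a e] by (rule infsum_rescale[OF locally_finite_Op])
  then show ?thesis
    unfolding Op_def qshift_mult qshift_vec_monom by (simp only: qshift_commute[of q a e])
qed

text \<open>A term of the Macdonald operator raises the shift by one unit at \<open>i\<close>, and
  its weight \<open>w i\<close> raises the monomial by the same unit. So the composite has the form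
  \<open>Op\<close> again, the coefficient at \<open>\<nu>\<close> coming from
  \<open>pred \<nu> i\<close>; \<open>Op_shift\<close> treats the opposite order.\<close>

lemma shift_Op:
  assumes i: "i \<in> {1..n}"
  shows "w i * (A * qshift q a (neg_unit i) (Op n a q w c f)) =
    Op n a q w (\<lambda>\<nu>. if \<nu> i = 0 then 0 else qshift q a (neg_unit i) (c (pred \<nu> i)) * A) f"
proof -
  let ?F = "\<lambda>\<nu>. vec_monom n w \<nu> * qshift q a (neg_unit i) (c \<nu>) * qshift q a (neg_vec \<nu>) (qshift q a (neg_unit i) f)"
  have "w i * (A * qshift q a (neg_unit i) (Op n a q w c f)) = w i * A * (\<Sum>\<^sub>\<infinity>\<nu>\<in>nat_vecs n. ?F \<nu>)"
    unfolding qshift_Op by (simp add: Op_def mult.assoc)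
  also have "\<dots> = (\<Sum>\<^sub>\<infinity>\<nu>\<in>nat_vecs n. w i * A * ?F \<nu>)"
    by (rule infsum_mult_left_mfps[OF locally_finite_Op])
  also have "\<dots> = (\<Sum>\<^sub>\<infinity>\<nu>\<in>nat_vecs n. if \<nu> i = 0 then 0 else w i * A * ?F (pred \<nu> i))"
    by (rule infsum_nat_vecs_pred[OF i, symmetric])
  also have "\<dots> = Op n a q w (\<lambda>\<nu>. if \<nu> i = 0 then 0 else qshift q a (neg_unit i) (c (pred \<nu> i)) * A) f"
    unfolding Op_def
  proof (intro infsum_cong)
    fix \<nu> :: "nat \<Rightarrow> nat"
    show "(if \<nu> i = 0 then 0 else w i * A * ?F (pred \<nu> i)) =
        vec_monom n w \<nu> * (if \<nu> i = 0 then 0 else qshift q a (neg_unit i) (c (pred \<nu> i)) * A) *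
        qshift q a (neg_vec \<nu>) f"
    proof (cases "\<nu> i = 0")
      case False
      have "qshift q a (neg_vec \<nu>) f = qshift q a (neg_vec (pred \<nu> i)) (qshift q a (neg_unit i) f)"
        unfolding qshift_qshift[OF q0] neg_vec_pred[of \<nu> i, OF False] by (simp only: add.commute)
      then show ?thesis
        using False unfolding vec_monom_pred[of i n \<nu> w, OF i False] by (simp only: if_False mult_ac)
    qed simp
  qed
  finally show ?thesis .
qed

lemma Op_shift:
  assumes i: "i \<in> {1..n}"
  shows "Op n a q w c (w i * (A * qshift q a (neg_unit i) f)) =
    Op n a q w (\<lambda>\<nu>. if \<nu> i = 0 then 0 else c (pred \<nu> i) * qshift q a (neg_vec (pred \<nu> i)) A) f"
proof -
  let ?F = "\<lambda>\<nu>. vec_monom n w \<nu> * c \<nu> * qshift q a (neg_vec \<nu>) (w i * (A * qshift q a (neg_unit i) f))"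
  have "Op n a q w c (w i * (A * qshift q a (neg_unit i) f)) =
      (\<Sum>\<^sub>\<infinity>\<nu>\<in>nat_vecs n. if \<nu> i = 0 then 0 else ?F (pred \<nu> i))"
    unfolding Op_def by (rule infsum_nat_vecs_pred[OF i, symmetric])
  also have "\<dots> = Op n a q w (\<lambda>\<nu>. if \<nu> i = 0 then 0 else c (pred \<nu> i) * qshift q a (neg_vec (pred \<nu> i)) A) f"
    unfolding Op_def
  proof (intro infsum_cong)
    fix \<nu> :: "nat \<Rightarrow> nat"
    show "(if \<nu> i = 0 then 0 else ?F (pred \<nu> i)) =
        vec_monom n w \<nu> * (if \<nu> i = 0 then 0 else c (pred \<nu> i) * qshift q a (neg_vec (pred \<nu> i)) A) *
        qshift q a (neg_vec \<nu>) f"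
    proof (cases "\<nu> i = 0")
      case False
      have "qshift q a (neg_vec \<nu>) f = qshift q a (neg_vec (pred \<nu> i)) (qshift q a (neg_unit i) f)"
        unfolding qshift_qshift[OF q0] neg_vec_pred[of \<nu> i, OF False] by (simp only: add.commute)
      then show ?thesis
        using False unfolding vec_monom_pred[of i n \<nu> w, OF i False] qshift_mult winv[OF i]
        by (simp only: if_False mult_ac)
    qed simp
  qed
  finally show ?thesis .
qed

lemma Op_mac_commute:
  assumes "norm q < 1" "t \<noteq> 0"
  defines "H \<equiv> \<lambda>f. \<Sum>i\<in>{1..n}. w i * (mac_series n a q t i * qshift q a (neg_unit i) f)"
  shows "H (Op n a q w (K_coeff n a q (q / t)) f) = Op n a q w (K_coeff n a q (q / t)) (H f)"
proof -
  let ?K = "K_coeff n a q (q / t)"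
  let ?c = "\<lambda>i \<nu>. if \<nu> i = 0 then 0 else qshift q a (neg_unit i) (?K (pred \<nu> i)) * mac_series n a q t i"
  let ?d = "\<lambda>i \<nu>. if \<nu> i = 0 then 0 else ?K (pred \<nu> i) * qshift q a (neg_vec (pred \<nu> i)) (mac_series n a q t i)"
  have "H (Op n a q w ?K f) = (\<Sum>i\<in>{1..n}. Op n a q w (?c i) f)"
    unfolding H_def by (intro sum.cong refl shift_Op)
  also have "\<dots> = Op n a q w (\<lambda>\<nu>. \<Sum>i\<in>{1..n}. ?c i \<nu>) f"
    by (rule Op_coeff_sum[symmetric]) simp
  also have "\<dots> = Op n a q w (\<lambda>\<nu>. \<Sum>i\<in>{1..n}. ?d i \<nu>) f"
    by (intro Op_cong) (use K_coeff_mac_commute[OF q0 assms(1,2), unfolded sum_supp] in simp)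
  also have "\<dots> = (\<Sum>i\<in>{1..n}. Op n a q w (?d i) f)"
    by (rule Op_coeff_sum) simp
  also have "\<dots> = (\<Sum>i\<in>{1..n}. Op n a q w ?K (w i * (mac_series n a q t i * qshift q a (neg_unit i) f)))"
    by (intro sum.cong refl Op_shift[symmetric])
  also have "\<dots> = Op n a q w ?K (H f)"
    unfolding H_def by (rule Op_sum[symmetric]) simp
  finally show ?thesis .
qed

lemma Op_mac_intertwine:
  assumes "norm q < 1" "t \<noteq> 0" and f: "qshift q a (neg_unit (n + 1)) f = f"
  defines "c \<equiv> \<lambda>\<nu>. K_coeff n a q (q / t) \<nu> * edge_series n a q (q / t) \<nu>"
  shows "mfps_const (1 / t) * (\<Sum>i\<in>{1..n}. w i * (mac_series (n + 1) a q t i * qshift q a (neg_unit i) (Op n a q w c f))) +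
      qshift q a (neg_unit (n + 1)) (Op n a q w c f) =
    mfps_const (1 / t) * Op n a q w c (\<Sum>i\<in>{1..n}. w i * (mac_series n a q t i * qshift q a (neg_unit i) f)) +
      Op n a q w c f"
proof -
  let ?l = "\<lambda>i \<nu>. if \<nu> i = 0 then 0 else qshift q a (neg_unit i) (c (pred \<nu> i)) * mac_series (n + 1) a q t i"
  let ?r = "\<lambda>i \<nu>. if \<nu> i = 0 then 0 else c (pred \<nu> i) * qshift q a (neg_vec (pred \<nu> i)) (mac_series n a q t i)"
  have L: "(\<Sum>i\<in>{1..n}. w i * (mac_series (n + 1) a q t i * qshift q a (neg_unit i) (Op n a q w c f))) =
      Op n a q w (\<lambda>\<nu>. \<Sum>i\<in>{1..n}. ?l i \<nu>) f"
    by (subst Op_coeff_sum, simp) (intro sum.cong refl shift_Op)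
  have R: "Op n a q w c (\<Sum>i\<in>{1..n}. w i * (mac_series n a q t i * qshift q a (neg_unit i) f)) =
      Op n a q w (\<lambda>\<nu>. \<Sum>i\<in>{1..n}. ?r i \<nu>) f"
    by (subst Op_coeff_sum, simp, subst Op_sum, simp) (intro sum.cong refl Op_shift)
  have top: "qshift q a (neg_unit (n + 1)) (Op n a q w c f) = Op n a q w (\<lambda>\<nu>. qshift q a (neg_unit (n + 1)) (c \<nu>)) f"
    by (simp only: qshift_Op f)
  show ?thesis
    unfolding L R top Op_coeff_mult[symmetric] Op_coeff_add[symmetric]
    by (intro Op_cong) (unfold c_def, rule K_coeff_mac_intertwine[OF q0 assms(1,2), unfolded sum_supp])
qed

end

text \<open>
  The shifts of \<open>a\<close> in the first operator also act on the monomials \<open>(a\<^sub>n\<^sub>+\<^sub>1 / a\<^sub>i)\<^bsup>\<mu>\<^sub>i\<^esup>\<close> of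
  the second one, which gives the factor \<open>q\<^bsup>\<nu>\<^sub>i \<mu>\<^sub>i\<^esup>\<close>; it is symmetric in \<open>\<nu>\<close> and \<open>\<mu>\<close>.
\<close>

lemma Op_Op:
  fixes a b :: alphabet and n :: nat and q u v :: complex and c d :: "(nat \<Rightarrow> nat) \<Rightarrow> ratio_series" and f :: ratio_series
  assumes q0: "q \<noteq> 0" and d: "\<And>e \<nu>. qshift q a e (d \<nu>) = d \<nu>"
  defines "w \<equiv> \<lambda>i. mfps_const u * ratio b i (n + 1)" and "w' \<equiv> \<lambda>i. mfps_const v * ratio a i (n + 1)"
  defines "F \<equiv> \<lambda>\<nu> \<mu>. (\<Prod>i\<in>{1..n}. mfps_const (q powi (int (\<nu> i) * int (\<mu> i)))) *
    (vec_monom n w \<nu> * c \<nu> * (vec_monom n w' \<mu> * d \<mu> * qshift q a (neg_vec \<nu>) (qshift q b (neg_vec \<mu>) f)))"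
  shows "Op n a q w c (Op n b q w' d f) = (\<Sum>\<^sub>\<infinity>\<nu>\<in>nat_vecs n. \<Sum>\<^sub>\<infinity>\<mu>\<in>nat_vecs n. F \<nu> \<mu>)"
    and "locally_finite (\<lambda>(\<nu>, \<mu>). F \<nu> \<mu>) (nat_vecs n \<times> nat_vecs n)"
proof -
  have w0: "mfps_nth (w i) 0 = 0" "mfps_nth (w' i) 0 = 0" if "i \<in> {1..n}" for i
    using that by (simp_all add: w_def w'_def)
  show "locally_finite (\<lambda>(\<nu>, \<mu>). F \<nu> \<mu>) (nat_vecs n \<times> nat_vecs n)"
  proof (rule locally_finite_ord_ge[where W = "\<lambda>(\<nu>, \<mu>). vec_size n \<nu> + vec_size n \<mu>"])
    show "ord_ge (case p of (\<nu>, \<mu>) \<Rightarrow> vec_size n \<nu> + vec_size n \<mu>) (case p of (\<nu>, \<mu>) \<Rightarrow> F \<nu> \<mu>)" for p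
      unfolding F_def case_prod_beta
      by (intro ord_ge_mult_right ord_ge_mult ord_ge_mult_left ord_ge_vec_monom w0)
    show "finite {p \<in> nat_vecs n \<times> nat_vecs n. (case p of (\<nu>, \<mu>) \<Rightarrow> vec_size n \<nu> + vec_size n \<mu>) \<le> d}" for d
      by (rule finite_subset[of _ "{\<nu> \<in> nat_vecs n. vec_size n \<nu> \<le> d} \<times> {\<nu> \<in> nat_vecs n. vec_size n \<nu> \<le> d}"])
        (auto intro!: finite_cartesian_product finite_nat_vecs_le)
  qed
  show "Op n a q w c (Op n b q w' d f) = (\<Sum>\<^sub>\<infinity>\<nu>\<in>nat_vecs n. \<Sum>\<^sub>\<infinity>\<mu>\<in>nat_vecs n. F \<nu> \<mu>)"
    unfolding Op_def[of n a]
  proof (intro infsum_cong)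
    fix \<nu> assume \<nu>: "\<nu> \<in> nat_vecs n"
    have "qshift q a (neg_vec \<nu>) (w' i ^ k) = mfps_const (q powi (int (\<nu> i) * int k)) * w' i ^ k"
      if "i \<in> {1..n}" for i k
    proof -
      \<comment> \<open>The numerator of the ratio is not shifted, so only its denominator
        contributes a power of \<open>q\<close>.\<close>
      have "\<nu> (n + 1) = 0" using \<nu> by (simp add: nat_vecs_def)
      then have "qshift q a (neg_vec \<nu>) (w' i) = mfps_const (q powi int (\<nu> i)) * w' i"
        using that q0 by (simp add: w'_def qshift_mult qshift_const qshift_ratio mult_ac)
      moreover have "qshift q a e (g ^ k) = qshift q a e g ^ k" for e g
        by (simp add: qshift_def mfps_rescale_power)
      moreover have "mfps_const (x ^ k) = (mfps_const x :: ratio_series) ^ k" for x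
        by (induction k) (simp_all add: mfps_const_1 mfps_const_mult)
      ultimately show ?thesis
        by (simp only: power_mult_distrib power_int_mult power_int_of_nat)
    qed
    then have shift_monom: "qshift q a (neg_vec \<nu>) (vec_monom n w' \<mu>) =
        (\<Prod>i\<in>{1..n}. mfps_const (q powi (int (\<nu> i) * int (\<mu> i)))) * vec_monom n w' \<mu>" for \<mu>
      by (simp add: qshift_prod prod.distrib)
    have lf: "locally_finite (\<lambda>\<mu>. vec_monom n w' \<mu> * d \<mu> * g \<mu>) (nat_vecs n)" for g
      unfolding mult.assoc
      by (rule locally_finite_ord_ge[where W = "vec_size n"])
        (use ord_ge_vec_monom[of n w'] w0 finite_nat_vecs_le in \<open>auto intro: ord_ge_mult_left\<close>)
    have "vec_monom n w \<nu> * c \<nu> * qshift q a (neg_vec \<nu>) (Op n b q w' d f) = vec_monom n w \<nu> * c \<nu> *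
        (\<Sum>\<^sub>\<infinity>\<mu>\<in>nat_vecs n. qshift q a (neg_vec \<nu>) (vec_monom n w' \<mu> * d \<mu> * qshift q b (neg_vec \<mu>) f))"
      unfolding Op_def qshift_def[of q a] by (rule arg_cong[OF infsum_rescale[OF lf]])
    also have "\<dots> = (\<Sum>\<^sub>\<infinity>\<mu>\<in>nat_vecs n. vec_monom n w \<nu> * c \<nu> *
        qshift q a (neg_vec \<nu>) (vec_monom n w' \<mu> * d \<mu> * qshift q b (neg_vec \<mu>) f))"
      unfolding qshift_def[of q a] by (intro infsum_mult_left_mfps locally_finite_rescale lf)
    also have "\<dots> = (\<Sum>\<^sub>\<infinity>\<mu>\<in>nat_vecs n. F \<nu> \<mu>)"
      by (intro infsum_cong) (simp only: qshift_mult shift_monom d F_def mult_ac)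
    finally show "vec_monom n w \<nu> * c \<nu> * qshift q a (neg_vec \<nu>) (Op n b q w' d f) =
        (\<Sum>\<^sub>\<infinity>\<mu>\<in>nat_vecs n. F \<nu> \<mu>)" .
  qed
qed

text \<open>Exchanging \<open>\<nu>\<close> and \<open>\<mu>\<close> carries the summands of one
  composite into those of the other.\<close>

lemma Op_commute:
  assumes q0: "q \<noteq> 0"
    and c: "\<And>e \<nu>. qshift q b e (c \<nu>) = c \<nu>" and d: "\<And>e \<nu>. qshift q a e (d \<nu>) = d \<nu>"
  shows "Op n a q (\<lambda>i. mfps_const u * ratio b i (n + 1)) c (Op n b q (\<lambda>i. mfps_const v * ratio a i (n + 1)) d f) =
    Op n b q (\<lambda>i. mfps_const v * ratio a i (n + 1)) d (Op n a q (\<lambda>i. mfps_const u * ratio b i (n + 1)) c f)"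
proof -
  note 1 = Op_Op[where n = n and u = u and v = v and c = c and f = f, OF q0 d] and 2 = Op_Op(1)[where n = n and u = v and v = u and c = d and f = f, OF q0 c]
  show ?thesis
    unfolding 1(1) 2 by (subst infsum_swap_mfps[OF 1(2)], intro infsum_cong)
      (simp only: qshift_commute[of q b _ a] mult_ac)
qed

section \<open>The recursion for the series p\<close>

definition append_column :: "nat \<Rightarrow> (nat \<Rightarrow> nat) \<Rightarrow> (nat \<Rightarrow> nat \<Rightarrow> nat) \<Rightarrow> nat \<Rightarrow> nat \<Rightarrow> nat"
  where "append_column n \<nu> \<theta> = (\<lambda>i j. if j = n + 1 then \<nu> i else \<theta> i j)"

lemma bij_betw_append_column:
  "bij_betw (\<lambda>(\<nu>, \<theta>). append_column n \<nu> \<theta>) (nat_vecs n \<times> upper_mats n) (upper_mats (n + 1))"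
proof (rule bij_betwI[where g = "\<lambda>\<theta>. (\<lambda>i. \<theta> i (n + 1), \<lambda>i j. if j = n + 1 then 0 else \<theta> i j)"])
  show "(\<lambda>(\<nu>, \<theta>). append_column n \<nu> \<theta>) \<in> nat_vecs n \<times> upper_mats n \<rightarrow> upper_mats (n + 1)"
    by (auto simp: append_column_def nat_vecs_def upper_mats_def)
  show "(\<lambda>\<theta>. (\<lambda>i. \<theta> i (n + 1), \<lambda>i j. if j = n + 1 then 0 else \<theta> i j)) \<in> upper_mats (n + 1) \<rightarrow> nat_vecs n \<times> upper_mats n"
    by (auto simp: append_column_def nat_vecs_def upper_mats_def)
qed (auto simp: append_column_def upper_mats_def fun_eq_iff)

abbreviation mat_size :: "nat \<Rightarrow> (nat \<Rightarrow> nat \<Rightarrow> nat) \<Rightarrow> nat"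
  where "mat_size n \<theta> \<equiv> \<Sum>j\<in>{1..n}. \<Sum>i\<in>{1..<j}. \<theta> i j"

lemma interval_Suc: "{1..n + 1} = insert (n + 1) {1..n :: nat}" "{1..<n + 1} = {1..n :: nat}"
  by auto

lemma mat_size_append_column: "mat_size (n + 1) (append_column n \<nu> \<theta>) = vec_size n \<nu> + mat_size n \<theta>"
proof -
  have "(\<Sum>j\<in>{1..n}. \<Sum>i\<in>{1..<j}. append_column n \<nu> \<theta> i j) = mat_size n \<theta>"
    by (intro sum.cong refl) (auto simp: append_column_def)
  moreover have "(\<Sum>i\<in>{1..<n+1}. append_column n \<nu> \<theta> i (n + 1)) = vec_size n \<nu>"
    by (intro sum.cong) (auto simp: append_column_def)
  ultimately show ?thesis
    by (simp add: interval_Suc)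
qed

lemma upper_mats_0: "upper_mats 0 = {\<lambda>_ _. 0}"
  by (auto simp: upper_mats_def fun_eq_iff)

lemma finite_upper_mats_le: "finite {\<theta> \<in> upper_mats n. mat_size n \<theta> \<le> d}"
proof (induction n)
  case (Suc n)
  have "{\<theta> \<in> upper_mats (Suc n). mat_size (Suc n) \<theta> \<le> d} \<subseteq>
      (\<lambda>(\<nu>, \<theta>). append_column n \<nu> \<theta>) ` ({\<nu> \<in> nat_vecs n. vec_size n \<nu> \<le> d} \<times> {\<theta> \<in> upper_mats n. mat_size n \<theta> \<le> d})"
  proof
    fix \<theta> assume \<theta>: "\<theta> \<in> {\<theta> \<in> upper_mats (Suc n). mat_size (Suc n) \<theta> \<le> d}"
    then have \<theta>': "\<theta> \<in> upper_mats (n + 1)" "mat_size (n + 1) \<theta> \<le> d"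
      unfolding Suc_eq_plus1 by blast+
    from \<theta>'(1) obtain \<nu> \<theta>' where *: "\<nu> \<in> nat_vecs n" "\<theta>' \<in> upper_mats n" "\<theta> = append_column n \<nu> \<theta>'"
      unfolding bij_betw_imp_surj_on[OF bij_betw_append_column[of n], symmetric] by auto
    have "vec_size n \<nu> + mat_size n \<theta>' \<le> d"
      using \<theta>'(2) unfolding *(3) mat_size_append_column .
    then have "vec_size n \<nu> \<le> d" "mat_size n \<theta>' \<le> d"
      by simp_all
    with * show "\<theta> \<in> (\<lambda>(\<nu>, \<theta>). append_column n \<nu> \<theta>) `
        ({\<nu> \<in> nat_vecs n. vec_size n \<nu> \<le> d} \<times> {\<theta> \<in> upper_mats n. mat_size n \<theta> \<le> d})"
      by blast
  qed
  then show ?case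
    by (rule finite_subset) (intro finite_imageI finite_cartesian_product finite_nat_vecs_le Suc)
qed (simp add: upper_mats_0)

abbreviation mat_monom :: "nat \<Rightarrow> alphabet \<Rightarrow> (nat \<Rightarrow> nat \<Rightarrow> nat) \<Rightarrow> ratio_series"
  where "mat_monom n a \<theta> \<equiv> \<Prod>j\<in>{1..n}. \<Prod>i\<in>{1..<j}. ratio a i j ^ \<theta> i j"

lemma ord_ge_mat_monom: "ord_ge (mat_size n \<theta>) (mat_monom n a \<theta>)"
  by (intro ord_ge_prod ord_ge_power) auto

lemma locally_finite_mat_monom: "locally_finite (\<lambda>\<theta>. g \<theta> * mat_monom n a \<theta>) (upper_mats n)"
  by (rule locally_finite_ord_ge[where W = "mat_size n"])
    (intro ord_ge_mult_right ord_ge_mat_monom finite_upper_mats_le)+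

definition mat_excess :: "nat \<Rightarrow> (nat \<Rightarrow> nat \<Rightarrow> nat) \<Rightarrow> nat \<Rightarrow> nat \<Rightarrow> nat \<Rightarrow> int"
  where "mat_excess n \<theta> i j k = (\<Sum>a\<in>{k+1..n}. int (\<theta> i a) - int (\<theta> j a))"

definition c_factor :: "alphabet \<Rightarrow> complex \<Rightarrow> complex \<Rightarrow> int \<Rightarrow> nat \<Rightarrow> nat \<Rightarrow> nat \<Rightarrow> ratio_series"
  where "c_factor b q t e i j m =
    qpoch q (mfps_const (q powi e * t) * ratio b i j) m / qpoch q (mfps_const (q powi e * q) * ratio b i j) m"

definition c_factor' :: "alphabet \<Rightarrow> complex \<Rightarrow> complex \<Rightarrow> int \<Rightarrow> nat \<Rightarrow> nat \<Rightarrow> nat \<Rightarrow> ratio_series"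
  where "c_factor' b q t e i j m =
    qpoch q (mfps_const (q powi e * q / t) * ratio b i j) m / qpoch q (mfps_const (q powi e) * ratio b i j) m"

text \<open>Starting with k = 1 instead of 2 adds only empty products and lets every column be split
  off in the same way.\<close>

lemma c_coeff_eq:
  "c_coeff n \<theta> b q t =
    (\<Prod>k\<in>{1..n}. \<Prod>j\<in>{1..k}. \<Prod>i\<in>{1..<j}. c_factor b q t (mat_excess n \<theta> i j k) i j (\<theta> i k)) *
    (\<Prod>k\<in>{1..n}. \<Prod>j\<in>{1..<k}. \<Prod>i\<in>{1..j}.
       c_factor' b q t (- int (\<theta> j k) + mat_excess n \<theta> i j k) i j (\<theta> i k))"
  unfolding c_coeff_def Let_def mat_excess_def[symmetric] c_factor_def c_factor'_def
  by (intro arg_cong2[of _ _ _ _ "(*)"] prod.mono_neutral_left) (auto simp: le_less_Suc_eq)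

text \<open>An appended column \<open>\<nu>\<close> raises the exponent sums of the older columns by
  \<nu>_i - \<nu>_j, which is also the effect of shifting \<open>b\<close> by
  \<open>neg_vec \<nu>\<close> on b_j / b_i. This is how shift operators enter the
  recursion.\<close>

lemma qshift_c_factors:
  assumes "q \<noteq> 0" "i \<le> j"
  shows "qshift q b (neg_vec \<nu>) (c_factor b q t e i j m) = c_factor b q t (e + (int (\<nu> i) - int (\<nu> j))) i j m"
    and "qshift q b (neg_vec \<nu>) (c_factor' b q t e i j m) = c_factor' b q t (e + (int (\<nu> i) - int (\<nu> j))) i j m"
proof -
  let ?d = "int (\<nu> i) - int (\<nu> j)"
  have "qshift q b (neg_vec \<nu>) (qpoch q (mfps_const c * ratio b i j) m) =
      qpoch q (mfps_const (q powi ?d * c) * ratio b i j) m" for c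
    using assms by (simp add: qshift_qpoch qshift_mult qshift_const qshift_ratio mfps_const_mult mult_ac)
  moreover have "q powi (e + ?d) = q powi ?d * q powi e"
    using assms by (simp add: power_int_add mult.commute)
  ultimately show "qshift q b (neg_vec \<nu>) (c_factor b q t e i j m) = c_factor b q t (e + ?d) i j m"
    "qshift q b (neg_vec \<nu>) (c_factor' b q t e i j m) = c_factor' b q t (e + ?d) i j m"
    unfolding c_factor_def c_factor'_def by (simp_all only: qshift_divide mult.assoc times_divide_eq_right)
qed

lemma mat_excess_append_column:
  assumes "k \<le> n"
  shows "mat_excess (n + 1) (append_column n \<nu> \<theta>) i j k = mat_excess n \<theta> i j k + (int (\<nu> i) - int (\<nu> j))"
proof -
  have "{k+1..n+1} = insert (n + 1) {k+1..n}" using assms by auto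
  moreover have "(\<Sum>a\<in>{k+1..n}. int (append_column n \<nu> \<theta> i a) - int (append_column n \<nu> \<theta> j a)) = mat_excess n \<theta> i j k"
    unfolding mat_excess_def by (intro sum.cong refl) (auto simp: append_column_def)
  ultimately show ?thesis
    by (simp add: mat_excess_def append_column_def)
qed

lemma mat_excess_last: "mat_excess n \<theta> i j n = 0"
  by (simp add: mat_excess_def)

text \<open>The factors of \<open>c_coeff\<close> with i = j, where the ratio is 1. They supply the
  scalar quotients of \<open>K\<close>, and the power of \<open>q / t\<close> explains the argument
  q y_(n+1) / t.\<close>

lemma qpoch_diagonal:
  assumes q: "q \<noteq> 0" "norm q < 1" and t: "t \<noteq> 0"
  shows "qpoch q (mfps_const (q powi (- int k) * q / t)) k / qpoch q (mfps_const (q powi (- int k))) k =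
    mfps_const (q / t) ^ k * (qpoch q (mfps_const t) k / qpoch q (mfps_const q) k)"
proof -
  \<comment> \<open>Reversing the factors makes the exponents of \<open>q\<close> run from -1 to -k;
    in particular none of them is 0.\<close>
  have rev: "(\<Prod>i<k. 1 - q ^ i * (q powi (- int k) * c)) = (\<Prod>i<k. 1 - c / q ^ Suc i)" for c
  proof -
    have "(\<Prod>i<k. 1 - q ^ i * (q powi (- int k) * c)) = (\<Prod>i<k. 1 - q ^ (k - Suc i) * (q powi (- int k) * c))"
      by (rule prod.nat_diff_reindex[symmetric])
    also have "\<dots> = (\<Prod>i<k. 1 - c / q ^ Suc i)"
    proof (intro prod.cong refl)
      fix i assume "i \<in> {..<k}"
      then have "q ^ k = q ^ (k - Suc i) * q ^ Suc i"
        by (simp flip: power_add del: power_Suc)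
      then show "1 - q ^ (k - Suc i) * (q powi (- int k) * c) = 1 - c / q ^ Suc i"
        using q(1) by (simp add: power_int_minus field_simps del: power_Suc)
    qed
    finally show ?thesis .
  qed
  have num: "(\<Prod>i<k. 1 - (q / t) / q ^ Suc i) = (\<Prod>i<k. - 1 / (t * q ^ i)) * (\<Prod>i<k. 1 - q ^ i * t)"
    unfolding prod.distrib[symmetric] using q(1) t by (intro prod.cong refl) (simp add: field_simps)
  have den: "(\<Prod>i<k. 1 - 1 / q ^ Suc i) = (\<Prod>i<k. - 1 / (q * q ^ i)) * (\<Prod>i<k. 1 - q ^ i * q)"
    unfolding prod.distrib[symmetric] using q(1) by (intro prod.cong refl) (simp add: field_simps)
  have pre: "(\<Prod>i<k. - 1 / (t * q ^ i)) = (q / t) ^ k * (\<Prod>i<k. - 1 / (q * q ^ i))"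
  proof -
    have "(q / t) ^ k = (\<Prod>i<k. q / t)" by simp
    then show ?thesis
      using q(1) t by (simp only: prod.distrib[symmetric]) (intro prod.cong refl, simp add: field_simps)
  qed
  have nz: "(\<Prod>i<k. - 1 / (q * q ^ i)) \<noteq> 0" "(\<Prod>i<k. 1 - q ^ i * q) \<noteq> 0"
    using q(1) qfact_neq_0[OF q(2)] by auto
  have cpow: "mfps_const (x ^ k) = (mfps_const x :: ratio_series) ^ k" for x
    by (induction k) (simp_all add: mfps_const_1 mfps_const_mult)
  have cdiv: "mfps_const x / mfps_const y = (mfps_const (x / y) :: ratio_series)" if "y \<noteq> 0" for x y
    using that by (subst mfps_divide_eq_iff) (simp_all add: mfps_nth_const flip: mfps_const_mult)
  have n: "qpoch q (mfps_const (q powi (- int k) * q / t)) k =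
      mfps_const ((q / t) ^ k * (\<Prod>i<k. - 1 / (q * q ^ i)) * (\<Prod>i<k. 1 - q ^ i * t))"
  proof -
    have "q powi (- int k) * q / t = q powi (- int k) * (q / t)" by simp
    then show ?thesis by (simp only: qpoch_const rev num pre)
  qed
  have d: "qpoch q (mfps_const (q powi (- int k))) k = mfps_const ((\<Prod>i<k. - 1 / (q * q ^ i)) * (\<Prod>i<k. 1 - q ^ i * q))"
    using rev[of 1] den by (simp only: qpoch_const mult_1_right)
  show ?thesis
    unfolding n d using nz by (simp add: cdiv qpoch_const cpow[symmetric] flip: mfps_const_mult)
qed

text \<open>The new column yields three groups of factors: pairs of indices up to n, the diagonal,
  and pairs with n + 1. The older columns are merely shifted.\<close>

lemma c_coeff_append_column:
  assumes q: "q \<noteq> 0" "norm q < 1" and t: "t \<noteq> 0" and \<nu>: "\<nu> \<in> nat_vecs n"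
  shows "c_coeff (n + 1) (append_column n \<nu> \<theta>) b q t =
    (\<Prod>i\<in>{1..n}. mfps_const (q / t) ^ \<nu> i) * (K_coeff n b q t \<nu> * edge_series n b q t \<nu>) *
    qshift q b (neg_vec \<nu>) (c_coeff n \<theta> b q t)"
proof -
  let ?\<theta> = "append_column n \<nu> \<theta>"
  let ?A = "\<lambda>n \<theta> k. \<Prod>j\<in>{1..k}. \<Prod>i\<in>{1..<j}. c_factor b q t (mat_excess n \<theta> i j k) i j (\<theta> i k)"
  let ?B = "\<lambda>n \<theta> k. \<Prod>j\<in>{1..<k}. \<Prod>i\<in>{1..j}.
      c_factor' b q t (- int (\<theta> j k) + mat_excess n \<theta> i j k) i j (\<theta> i k)"
  have col_old: "?\<theta> i k = \<theta> i k" if "k \<in> {1..n}" for i k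
    using that by (simp add: append_column_def)
  have A: "?A (n + 1) ?\<theta> k = qshift q b (neg_vec \<nu>) (?A n \<theta> k)" if "k \<in> {1..n}" for k
    unfolding qshift_prod using that q(1)
    by (intro prod.cong refl) (simp add: col_old mat_excess_append_column qshift_c_factors)
  have B: "?B (n + 1) ?\<theta> k = qshift q b (neg_vec \<nu>) (?B n \<theta> k)" if "k \<in> {1..n}" for k
    unfolding qshift_prod using that q(1)
    by (intro prod.cong refl) (simp add: col_old mat_excess_append_column qshift_c_factors diff_add_eq)
  let ?p = "\<lambda>i j. qpoch q (mfps_const t * ratio b i j) (\<nu> i) / qpoch q (mfps_const q * ratio b i j) (\<nu> i)"
  let ?r = "\<lambda>i j. qpoch q (mfps_const (q powi (- int (\<nu> j) + 1) / t) * ratio b i j) (\<nu> i) /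
      qpoch q (mfps_const (q powi (- int (\<nu> j))) * ratio b i j) (\<nu> i)"
  have col: "?\<theta> i (n + 1) = \<nu> i" for i
    by (simp add: append_column_def)
  have A': "?A (n + 1) ?\<theta> (n + 1) = (\<Prod>j\<in>{1..n}. \<Prod>i\<in>{1..<j}. ?p i j) * edge_series n b q t \<nu>"
    by (simp add: c_factor_def col mat_excess_last interval_Suc edge_series_def mult.commute)
  have B': "?B (n + 1) ?\<theta> (n + 1) = (\<Prod>j\<in>{1..n}. \<Prod>i\<in>{1..<j}. ?r i j) *
      ((\<Prod>i\<in>{1..n}. mfps_const (q / t) ^ \<nu> i) *
       (\<Prod>i\<in>{1..n}. qpoch q (mfps_const t) (\<nu> i) / qpoch q (mfps_const q) (\<nu> i)))"
  proof -
    have e: "q powi (1 - int k) = q * q powi (- int k)" for k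
    proof -
      have "q powi (1 + - int k) = q powi 1 * q powi (- int k)"
        by (rule power_int_add) (use q(1) in simp)
      then show ?thesis by simp
    qed
    have "?B (n + 1) ?\<theta> (n + 1) = (\<Prod>j\<in>{1..n}. (\<Prod>i\<in>{1..<j}. ?r i j) *
        (mfps_const (q / t) ^ \<nu> j * (qpoch q (mfps_const t) (\<nu> j) / qpoch q (mfps_const q) (\<nu> j))))"
      unfolding interval_Suc
    proof (intro prod.cong refl)
      fix j assume "j \<in> {1..n}"
      then have "{1..j} = insert j {1..<j}" by auto
      then show "(\<Prod>i\<in>{1..j}. c_factor' b q t (- int (?\<theta> j (n + 1)) + mat_excess (n + 1) ?\<theta> i j (n + 1)) i j (?\<theta> i (n + 1))) =
          (\<Prod>i\<in>{1..<j}. ?r i j) *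
          (mfps_const (q / t) ^ \<nu> j * (qpoch q (mfps_const t) (\<nu> j) / qpoch q (mfps_const q) (\<nu> j)))"
        using qpoch_diagonal[OF q t, of "\<nu> j"] by (simp add: c_factor'_def col mat_excess_last e mult.commute)
    qed
    then show ?thesis
      by (simp only: prod.distrib)
  qed
  have prodA: "(\<Prod>k\<in>{1..n}. ?A (n + 1) ?\<theta> k) = qshift q b (neg_vec \<nu>) (\<Prod>k\<in>{1..n}. ?A n \<theta> k)"
    by (subst qshift_prod) (intro prod.cong refl A)
  have prodB: "(\<Prod>k\<in>{1..n}. ?B (n + 1) ?\<theta> k) = qshift q b (neg_vec \<nu>) (\<Prod>k\<in>{1..n}. ?B n \<theta> k)"
    by (subst qshift_prod) (intro prod.cong refl B)
  have split: "(\<Prod>k\<in>{1..n + 1}. f k) = f (n + 1) * (\<Prod>k\<in>{1..n}. f k)" for f :: "nat \<Rightarrow> ratio_series"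
    by (simp add: interval_Suc)
  have "c_coeff (n + 1) ?\<theta> b q t =
      (?A (n + 1) ?\<theta> (n + 1) * (\<Prod>k\<in>{1..n}. ?A (n + 1) ?\<theta> k)) *
      (?B (n + 1) ?\<theta> (n + 1) * (\<Prod>k\<in>{1..n}. ?B (n + 1) ?\<theta> k))"
    unfolding c_coeff_eq by (rule arg_cong2[of _ _ _ _ "(*)", OF split split])
  also have "\<dots> = (?A (n + 1) ?\<theta> (n + 1) * ?B (n + 1) ?\<theta> (n + 1)) * qshift q b (neg_vec \<nu>) (c_coeff n \<theta> b q t)"
    unfolding c_coeff_eq[of n \<theta>] qshift_mult prodA prodB by (simp only: mult_ac)
  also have "?A (n + 1) ?\<theta> (n + 1) * ?B (n + 1) ?\<theta> (n + 1) =
      (\<Prod>i\<in>{1..n}. mfps_const (q / t) ^ \<nu> i) * (K_coeff n b q t \<nu> * edge_series n b q t \<nu>)"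
    unfolding A' B' K_coeff_def prod.distrib by (simp only: mult_ac)
  finally show ?thesis .
qed

text \<open>The sum is arranged by the last column. The monomials of the remaining columns contain
  only \<open>a\<close>, so the shift of \<open>b\<close> passes them and can be taken out of the
  inner sum.\<close>

lemma p_series_Suc:
  assumes q: "q \<noteq> 0" "norm q < 1" and t: "t \<noteq> 0" and ab: "a \<noteq> b"
  shows "p_series (n + 1) a b q t =
    Op n b q (\<lambda>i. mfps_const (q / t) * ratio a i (n + 1)) (\<lambda>\<nu>. K_coeff n b q t \<nu> * edge_series n b q t \<nu>)
      (p_series n a b q t)"
proof -
  let ?w = "\<lambda>i. mfps_const (q / t) * ratio a i (n + 1)"
  let ?c = "\<lambda>\<nu>. K_coeff n b q t \<nu> * edge_series n b q t \<nu>"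
  let ?P = "\<lambda>\<theta>. c_coeff n \<theta> b q t * mat_monom n a \<theta>"
  define F where "F \<nu> \<theta> = vec_monom n ?w \<nu> * ?c \<nu> * qshift q b (neg_vec \<nu>) (?P \<theta>)" for \<nu> \<theta>
  have w0: "mfps_nth (?w i) 0 = 0" if "i \<in> {1..n}" for i
    using that by simp
  have monom_inv: "qshift q b e (mat_monom n a \<theta>) = mat_monom n a \<theta>" for e \<theta>
  proof -
    have "qshift q b e (g ^ k) = qshift q b e g ^ k" for g k
      by (simp add: qshift_def mfps_rescale_power)
    then show ?thesis
      using ab by (simp add: qshift_prod qshift_ratio_other)
  qed
  have term_eq: "c_coeff (n + 1) (append_column n \<nu> \<theta>) b q t * mat_monom (n + 1) a (append_column n \<nu> \<theta>) = F \<nu> \<theta>"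
    if "\<nu> \<in> nat_vecs n" for \<nu> \<theta>
  proof -
    have "(\<Prod>j\<in>{1..n}. \<Prod>i\<in>{1..<j}. ratio a i j ^ append_column n \<nu> \<theta> i j) = mat_monom n a \<theta>"
      by (intro prod.cong refl) (auto simp: append_column_def)
    moreover have "(\<Prod>i\<in>{1..<n+1}. ratio a i (n + 1) ^ append_column n \<nu> \<theta> i (n + 1)) = (\<Prod>i\<in>{1..n}. ratio a i (n + 1) ^ \<nu> i)"
      by (intro prod.cong) (auto simp: append_column_def)
    ultimately have m: "mat_monom (n + 1) a (append_column n \<nu> \<theta>) = (\<Prod>i\<in>{1..n}. ratio a i (n + 1) ^ \<nu> i) * mat_monom n a \<theta>"
      unfolding interval_Suc(1)[of n] by (subst prod.insert) auto
    show ?thesis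
      unfolding F_def c_coeff_append_column[OF q t that] m qshift_mult monom_inv power_mult_distrib prod.distrib
      by (simp only: mult_ac)
  qed
  have lf: "locally_finite (\<lambda>(\<nu>, \<theta>). F \<nu> \<theta>) (nat_vecs n \<times> upper_mats n)"
  proof (rule locally_finite_ord_ge[where W = "\<lambda>(\<nu>, \<theta>). vec_size n \<nu> + mat_size n \<theta>"])
    show "ord_ge (case p of (\<nu>, \<theta>) \<Rightarrow> vec_size n \<nu> + mat_size n \<theta>) (case p of (\<nu>, \<theta>) \<Rightarrow> F \<nu> \<theta>)" for p
      unfolding F_def case_prod_beta qshift_mult monom_inv
      by (intro ord_ge_mult ord_ge_mult_left ord_ge_vec_monom w0 ord_ge_mult_right[OF ord_ge_mat_monom])
    show "finite {p \<in> nat_vecs n \<times> upper_mats n. (case p of (\<nu>, \<theta>) \<Rightarrow> vec_size n \<nu> + mat_size n \<theta>) \<le> d}" for d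
      by (rule finite_subset[of _ "{\<nu> \<in> nat_vecs n. vec_size n \<nu> \<le> d} \<times> {\<theta> \<in> upper_mats n. mat_size n \<theta> \<le> d}"])
        (auto intro!: finite_cartesian_product finite_nat_vecs_le finite_upper_mats_le)
  qed
  have "p_series (n + 1) a b q t =
      (\<Sum>\<^sub>\<infinity>(\<nu>, \<theta>)\<in>nat_vecs n \<times> upper_mats n.
        c_coeff (n + 1) (append_column n \<nu> \<theta>) b q t * mat_monom (n + 1) a (append_column n \<nu> \<theta>))"
    unfolding p_series_def
    by (subst infsum_reindex_bij_betw[OF bij_betw_append_column, symmetric]) (simp only: case_prod_unfold)
  also have "\<dots> = (\<Sum>\<^sub>\<infinity>(\<nu>, \<theta>)\<in>nat_vecs n \<times> upper_mats n. F \<nu> \<theta>)"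
    by (intro infsum_cong) (auto simp: term_eq)
  also have "\<dots> = (\<Sum>\<^sub>\<infinity>\<nu>\<in>nat_vecs n. \<Sum>\<^sub>\<infinity>\<theta>\<in>upper_mats n. F \<nu> \<theta>)"
    by (rule infsum_Times_mfps[OF lf, symmetric])
  also have "\<dots> = Op n b q ?w ?c (p_series n a b q t)"
    unfolding Op_def p_series_def F_def
  proof (intro infsum_cong)
    fix \<nu>
    show "(\<Sum>\<^sub>\<infinity>\<theta>\<in>upper_mats n. vec_monom n ?w \<nu> * ?c \<nu> * qshift q b (neg_vec \<nu>) (?P \<theta>)) =
        vec_monom n ?w \<nu> * ?c \<nu> * qshift q b (neg_vec \<nu>) (\<Sum>\<^sub>\<infinity>\<theta>\<in>upper_mats n. ?P \<theta>)"
      unfolding qshift_def infsum_rescale[OF locally_finite_mat_monom]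
      by (rule infsum_mult_left_mfps[OF locally_finite_rescale[OF locally_finite_mat_monom], symmetric])
  qed
  finally show ?thesis .
qed

section \<open>Uniqueness of eigenfunctions of the Macdonald operator\<close>

lemma rescale_factor_finite:
  assumes "finite V" "\<And>v. v \<notin> V \<Longrightarrow> c v = 1"
  shows "rescale_factor c m = (\<Prod>v\<in>V. c v ^ lookup m v)"
proof -
  have "rescale_factor c m = (\<Prod>v\<in>keys m \<union> V. c v ^ lookup m v)"
    unfolding rescale_factor_def using assms
    by (intro prod.mono_neutral_left) (auto simp: in_keys_iff)
  also have "\<dots> = (\<Prod>v\<in>V. c v ^ lookup m v)"
    using assms by (intro prod.mono_neutral_right) auto
  finally show ?thesis .
qed

text \<open>The constant term in the ratios of \<open>a\<close>, written as a rescaling by 0, so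
  that its compatibility with the ring operations, quotients and infinite sums is inherited.\<close>

definition kill :: "alphabet \<Rightarrow> ratio_series \<Rightarrow> ratio_series"
  where "kill a = mfps_rescale (\<lambda>(c, k). if c = a then 0 else 1)"

lemma kill_simps:
  "kill a (f + g) = kill a f + kill a g" "kill a (f - g) = kill a f - kill a g"
  "kill a (f * g) = kill a f * kill a g" "kill a (f / g) = kill a f / kill a g"
  "kill a (mfps_const c) = mfps_const c" "kill a 1 = 1" "kill a (f ^ m) = kill a f ^ m"
  "kill a (\<Sum>i\<in>A. F i) = (\<Sum>i\<in>A. kill a (F i))" "kill a (\<Prod>i\<in>A. F i) = (\<Prod>i\<in>A. kill a (F i))"
  by (simp_all only: kill_def qshift_simps)

lemma mfps_nth_kill: "mfps_nth (kill a f) m = (if \<forall>k. lookup m (a, k) = 0 then mfps_nth f m else 0)"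
proof (cases "\<forall>k. lookup m (a, k) = 0")
  case True
  then have "rescale_factor (\<lambda>(c, k). if c = a then 0 else 1 :: complex) m = 1"
    unfolding rescale_factor_def by (intro prod.neutral) (auto simp: in_keys_iff)
  with True show ?thesis by (simp add: kill_def mfps_nth_rescale)
next
  case False
  then obtain k where k: "lookup m (a, k) \<noteq> 0" by blast
  then have "rescale_factor (\<lambda>(c, k). if c = a then 0 else 1 :: complex) m = 0"
    unfolding rescale_factor_def by (intro prod_zero) (auto simp: in_keys_iff intro!: bexI[of _ "(a, k)"])
  with False show ?thesis by (simp only: kill_def mfps_nth_rescale if_False mult_zero_left)
qed

lemma kill_qshift: "kill a (qshift q a e f) = kill a f"
  unfolding kill_def qshift_def mfps_rescale_rescale
  by (intro arg_cong2[of _ _ _ _ mfps_rescale] refl ext) (auto split: if_splits)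

lemma kill_ratio: "i < j \<Longrightarrow> kill a (ratio a i j) = 0"
  unfolding ratio_def kill_def mfps_rescale_prod
  by (intro prod_zero) (auto simp: mfps_rescale_var mfps_const_def zero_mfps_def[symmetric])

lemma kill_ratio_other: "a \<noteq> b \<Longrightarrow> kill a (ratio b i j) = ratio b i j"
  by (simp add: kill_def ratio_def mfps_rescale_prod mfps_rescale_var mfps_const_1)

lemma mfps_divide_1 [simp]: "f / 1 = (f :: ratio_series)"
  by (subst mfps_divide_eq_iff) (simp_all add: mfps_nth_1)

lemma kill_mac_series: "kill a (mac_series n a q t i) = 1"
  unfolding mac_series_def kill_simps
  by (intro prod.neutral) (auto simp: mac_series_factor_def kill_simps kill_ratio)

definition alph_degree :: "alphabet \<Rightarrow> (alphabet \<times> nat \<Rightarrow>\<^sub>0 nat) \<Rightarrow> nat"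
  where "alph_degree a m = (\<Sum>v | v \<in> keys m \<and> fst v = a. lookup m v)"

lemma alph_degree_add: "alph_degree a (p + r) = alph_degree a p + alph_degree a r"
proof -
  have *: "alph_degree a m = (\<Sum>v | v \<in> keys p \<union> keys r \<and> fst v = a. lookup m v)"
    if "keys m \<subseteq> keys p \<union> keys r" for m
    unfolding alph_degree_def
    by (intro sum.mono_neutral_left) (use that in \<open>auto simp: in_keys_iff subset_iff\<close>)
  show ?thesis
    using Poly_Mapping.keys_add[of p r] by (simp add: * lookup_add sum.distrib)
qed

lemma alph_degree_eq_0_iff: "alph_degree a m = 0 \<longleftrightarrow> (\<forall>k. lookup m (a, k) = 0)"
  by (auto simp: alph_degree_def in_keys_iff)

text \<open>\<open>A - 1\<close> has positive degree in the ratios of \<open>a\<close>, so it cannot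
  reach the lowest degree \<open>N\<close> of the product.\<close>

lemma mult_lowest_coeff:
  assumes A: "kill a A = 1" and h: "\<And>m. mfps_nth h m \<noteq> 0 \<Longrightarrow> N \<le> alph_degree a m" and m: "alph_degree a m = N"
  shows "mfps_nth (A * h) m = mfps_nth h m"
proof -
  have "mfps_nth ((A - 1) * h) m = 0"
    unfolding mfps_nth_mult
  proof (intro sum.neutral ballI)
    fix p assume p: "p \<in> splits m"
    show "(case p of (u, v) \<Rightarrow> mfps_nth (A - 1) u * mfps_nth h v) = 0"
    proof (rule ccontr)
      assume nz: "(case p of (u, v) \<Rightarrow> mfps_nth (A - 1) u * mfps_nth h v) \<noteq> 0"
      have "kill a (A - 1) = 0" by (simp add: kill_simps A)
      then have "mfps_nth (kill a (A - 1)) (fst p) = 0" by simp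
      with nz have "alph_degree a (fst p) \<noteq> 0"
        unfolding alph_degree_eq_0_iff mfps_nth_kill by (auto simp: case_prod_beta split: if_splits)
      moreover have "N \<le> alph_degree a (snd p)"
        using nz h by (auto simp: case_prod_beta)
      moreover have "alph_degree a (fst p) + alph_degree a (snd p) = N"
        using p m by (auto simp: splits_def alph_degree_add)
      ultimately show False by simp
    qed
  qed
  moreover have "A * h = h + (A - 1) * h"
    by (simp add: algebra_simps)
  ultimately show ?thesis by simp
qed

lemma powi_eq_1_iff:
  assumes "norm q < 1" "q \<noteq> 0"
  shows "q powi z = (1 :: complex) \<longleftrightarrow> z = 0"
proof
  assume *: "q powi z = 1"
  have "q ^ nat \<bar>z\<bar> = 1"
    using * by (cases "z \<ge> 0") (auto simp: power_int_def inverse_eq_1_iff power_inverse)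
  then show "z = 0"
    using one_minus_power_neq_0[OF assms(1), of "nat \<bar>z\<bar>"] by (cases "nat \<bar>z\<bar> = 0") auto
qed simp

text \<open>Only the ratios a_(i+1) / a_i and a_i / a_(i-1) contain a_i, with opposite exponents.
  For i = 1 the second one is the variable \<open>(a, 0)\<close>, which the index type contains
  although it stands for no ratio.\<close>

lemma qshift_neg_unit_factor:
  assumes "q \<noteq> 0" "1 \<le> i"
  shows "mfps_nth (qshift q a (neg_unit i) f) m =
    q powi (int (lookup m (a, i)) - int (lookup m (a, i - 1))) * mfps_nth f m"
proof -
  let ?c = "\<lambda>(b, k). if b = a then q powi (neg_unit i (Suc k) - neg_unit i k) else 1"
  have "rescale_factor ?c m = (\<Prod>v\<in>{(a, i), (a, i - 1)}. ?c v ^ lookup m v)"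
    using assms by (intro rescale_factor_finite) (auto split: if_splits)
  also have "\<dots> = q ^ lookup m (a, i) * (inverse q) ^ lookup m (a, i - 1)"
    using assms by (auto simp: power_int_minus)
  also have "\<dots> = q powi (int (lookup m (a, i)) - int (lookup m (a, i - 1)))"
    using assms by (simp add: power_int_diff power_inverse divide_inverse)
  finally show ?thesis
    unfolding qshift_def mfps_nth_rescale by simp
qed

text \<open>
  On the part of \<open>f\<close> of lowest degree in the ratios of \<open>a\<close> only the leading terms \<open>1\<close> of the
  coefficients of the Macdonald operator matter, so that the operator is diagonal there.
\<close>

lemma mac_eigenfunction_unique:
  assumes q: "q \<noteq> 0" "norm q < 1" and ab: "a \<noteq> b"
    and eigen: "(\<Sum>i\<in>{1..n}. ratio b i (n + 1) * (mac_series n a q t i * qshift q a (neg_unit i) f)) =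
      (\<Sum>i\<in>{1..n}. ratio b i (n + 1)) * f"
    and kill: "kill a f = 0"
    and inv: "\<And>e. (\<And>i. i \<in> {1..n} \<Longrightarrow> e i = 0) \<Longrightarrow> qshift q a e f = f"
  shows "f = 0"
proof (rule ccontr)
  assume "f \<noteq> 0"
  then have "\<exists>N m. mfps_nth f m \<noteq> 0 \<and> alph_degree a m = N"
    by (auto simp: mfps_eq_iff)
  define N where "N = (LEAST N. \<exists>m. mfps_nth f m \<noteq> 0 \<and> alph_degree a m = N)"
  have "\<exists>m. mfps_nth f m \<noteq> 0 \<and> alph_degree a m = N"
    unfolding N_def by (rule LeastI_ex) fact
  then obtain m0 where m0: "mfps_nth f m0 \<noteq> 0" "alph_degree a m0 = N" by blast
  have min: "N \<le> alph_degree a m" if "mfps_nth f m \<noteq> 0" for m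
    unfolding N_def using that by (intro Least_le) auto
  define \<beta> where "\<beta> k = lookup m0 (a, k)" for k
  have high: "\<beta> k = 0" if "k \<ge> n" for k
  proof -
    \<comment> \<open>This shift multiplies the single ratio a_(k+1) / a_k by \<open>q\<close> and
      fixes all others, so invariance of \<open>f\<close> excludes that ratio.\<close>
    let ?e = "\<lambda>j. if k < j then 1 else 0"
    let ?c = "\<lambda>(b, l). if b = a then q powi (?e (Suc l) - ?e l) else 1"
    have "qshift q a ?e f = f" using that by (intro inv) auto
    then have "mfps_nth (qshift q a ?e f) m0 = mfps_nth f m0" by simp
    then have "rescale_factor ?c m0 * mfps_nth f m0 = mfps_nth f m0"
      unfolding qshift_def mfps_nth_rescale .
    moreover have "rescale_factor ?c m0 = (\<Prod>v\<in>{(a, k)}. ?c v ^ lookup m0 v)"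
      by (rule rescale_factor_finite) (auto split: if_splits)
    ultimately have "q ^ \<beta> k = 1"
      using m0(1) by (simp add: \<beta>_def)
    then show ?thesis
      using one_minus_power_neq_0[OF q(2), of "\<beta> k"] by (cases "\<beta> k = 0") auto
  qed
  \<comment> \<open>\<open>d i\<close> is the difference between the factor by which the shift of
    a_i acts on terms with \<open>a\<close>-exponents \<open>\<beta>\<close> and the value 1
    required by the eigenvalue equation.\<close>
  define d where "d i = q powi (int (\<beta> i) - int (\<beta> (i - 1))) - 1" for i
  define D where "D = (\<Sum>i\<in>{1..n}. mfps_const (d i) * ratio b i (n + 1))"
  have Df: "mfps_nth (D * f) m = 0" if m: "\<And>k. lookup m (a, k) = \<beta> k" for m
  proof -
    have deg: "alph_degree a m = N"
    proof -
      have "(\<Sum>v | v \<in> keys m \<and> fst v = a. lookup m v) = (\<Sum>v | v \<in> keys m0 \<and> fst v = a. lookup m0 v)"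
        using m by (intro sum.cong) (auto simp: \<beta>_def in_keys_iff)
      with m0 show ?thesis by (simp add: alph_degree_def)
    qed
    have "mfps_nth (ratio b i (n + 1) * (mac_series n a q t i * qshift q a (neg_unit i) f)) m =
        q powi (int (\<beta> i) - int (\<beta> (i - 1))) * mfps_nth (ratio b i (n + 1) * f) m" if "i \<in> {1..n}" for i
    proof -
      have shift: "qshift q a (neg_unit i) (ratio b i (n + 1) * f) = ratio b i (n + 1) * qshift q a (neg_unit i) f"
        using ab by (simp add: qshift_mult qshift_ratio_other)
      have low: "N \<le> alph_degree a m'" if "mfps_nth (ratio b i (n + 1) * qshift q a (neg_unit i) f) m' \<noteq> 0" for m'
      proof -
        have "\<exists>p\<in>splits m'. (case p of (u, v) \<Rightarrow> mfps_nth (ratio b i (n + 1)) u * mfps_nth (qshift q a (neg_unit i) f) v) \<noteq> 0"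
          using that unfolding mfps_nth_mult by (metis (no_types, lifting) sum.neutral)
        then obtain p where "p \<in> splits m'" "mfps_nth f (snd p) \<noteq> 0"
          by (auto simp: qshift_def mfps_nth_rescale)
        then show ?thesis
          using min[of "snd p"] by (auto simp: splits_def alph_degree_add)
      qed
      have "mfps_nth (ratio b i (n + 1) * (mac_series n a q t i * qshift q a (neg_unit i) f)) m =
          mfps_nth (mac_series n a q t i * (ratio b i (n + 1) * qshift q a (neg_unit i) f)) m"
        by (simp only: mult_ac)
      also have "\<dots> = mfps_nth (qshift q a (neg_unit i) (ratio b i (n + 1) * f)) m"
        unfolding shift by (rule mult_lowest_coeff[OF kill_mac_series low deg])
      also have "\<dots> = q powi (int (\<beta> i) - int (\<beta> (i - 1))) * mfps_nth (ratio b i (n + 1) * f) m"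
        using that q(1) by (subst qshift_neg_unit_factor) (auto simp: m)
      finally show ?thesis .
    qed
    then have "(\<Sum>i\<in>{1..n}. q powi (int (\<beta> i) - int (\<beta> (i - 1))) * mfps_nth (ratio b i (n + 1) * f) m) =
        (\<Sum>i\<in>{1..n}. mfps_nth (ratio b i (n + 1) * f) m)"
      using arg_cong[OF eigen, of "\<lambda>g. mfps_nth g m"] by (simp add: mfps_nth_sum sum_distrib_right)
    then show ?thesis
      by (simp add: D_def d_def mfps_nth_sum sum_distrib_right mult.assoc left_diff_distrib sum_subtractf)
  qed
  \<comment> \<open>The part of \<open>f\<close> whose exponents in \<open>a\<close> are exactly
    \<open>\<beta>\<close>. Since \<open>D\<close> is free of \<open>a\<close>, it acts on this part
    separately, and the absence of zero divisors gives \<open>D = 0\<close>.\<close>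
  define g where "g = Abs_mfps (\<lambda>m. if \<forall>k. lookup m (a, k) = \<beta> k then mfps_nth f m else 0)"
  have Dsupp: "lookup p (a, k) = 0" if "mfps_nth D p \<noteq> 0" for p k
  proof -
    have "kill a D = D"
      using ab by (simp add: D_def kill_simps kill_ratio_other)
    with that show ?thesis
      by (metis mfps_nth_kill)
  qed
  have "D * g = 0"
  proof (rule mfps_eqI)
    fix m
    show "mfps_nth (D * g) m = mfps_nth 0 m"
    proof (cases "\<forall>k. lookup m (a, k) = \<beta> k")
      case True
      have "mfps_nth (D * g) m = mfps_nth (D * f) m"
        unfolding mfps_nth_mult
      proof (intro sum.cong refl)
        fix p assume "p \<in> splits m"
        then have "lookup m v = lookup (fst p) v + lookup (snd p) v" for v
          by (auto simp: splits_def lookup_add)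
        then show "(case p of (u, v) \<Rightarrow> mfps_nth D u * mfps_nth g v) = (case p of (u, v) \<Rightarrow> mfps_nth D u * mfps_nth f v)"
          using Dsupp[of "fst p"] True by (cases "mfps_nth D (fst p) = 0") (auto simp: g_def case_prod_beta)
      qed
      with Df True show ?thesis by simp
    next
      case False
      have "mfps_nth (D * g) m = 0"
        unfolding mfps_nth_mult
      proof (intro sum.neutral ballI)
        fix p assume "p \<in> splits m"
        then have "lookup m v = lookup (fst p) v + lookup (snd p) v" for v
          by (auto simp: splits_def lookup_add)
        then show "(case p of (u, v) \<Rightarrow> mfps_nth D u * mfps_nth g v) = 0"
          using Dsupp[of "fst p"] False by (cases "mfps_nth D (fst p) = 0") (auto simp: g_def case_prod_beta)
      qed
      then show ?thesis by simp
    qed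
  qed
  moreover have "g \<noteq> 0"
    using m0(1) by (auto simp: mfps_eq_iff g_def \<beta>_def intro!: exI[of _ m0])
  ultimately have "D = 0" by simp
  have d0: "d i = 0" if i: "i \<in> {1..n}" for i
  proof -
    have "ratio_exponent b i (n + 1) \<noteq> ratio_exponent b j (n + 1)" if "j \<in> {1..n}" "i \<noteq> j" for j
    proof
      assume "ratio_exponent b i (n + 1) = ratio_exponent b j (n + 1)"
      then have "lookup (ratio_exponent b i (n + 1)) (b, min i j) = lookup (ratio_exponent b j (n + 1)) (b, min i j)"
        by simp
      then show False
        using i that by (auto simp: lookup_ratio_exponent split: if_splits)
    qed
    then have "mfps_nth D (ratio_exponent b i (n + 1)) = (\<Sum>j\<in>{1..n}. if j = i then d i else 0)"
      unfolding D_def mfps_nth_sum by (intro sum.cong) (auto simp: mfps_nth_ratio)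
    then show ?thesis
      using \<open>D = 0\<close> i by simp
  qed
  \<comment> \<open>The ratios b_(n+1) / b_i are different monomials, so each \<open>d i\<close> is
    0 and neighbouring exponents agree. As \<open>\<beta> n = 0\<close>, all of them vanish, and
    \<open>m0\<close> is a term of \<open>kill a f\<close>.\<close>
  have step: "\<beta> i = \<beta> (i - 1)" if "i \<in> {1..n}" for i
    using d0[OF that] powi_eq_1_iff[OF q(2,1), of "int (\<beta> i) - int (\<beta> (i - 1))"] by (simp add: d_def)
  have "\<beta> k = 0" for k
  proof (cases "k \<le> n")
    case True
    then show ?thesis
    proof (induction k rule: inc_induct)
      case base
      show ?case by (rule high) simp
    next
      case (step k)
      with \<open>\<And>i. i \<in> {1..n} \<Longrightarrow> \<beta> i = \<beta> (i - 1)\<close>[of "Suc k"] show ?case by simp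
    qed
  qed (simp add: high)
  then have "mfps_nth (kill a f) m0 = mfps_nth f m0"
    by (simp add: mfps_nth_kill \<beta>_def)
  with m0(1) kill show False by simp
qed

section \<open>Duality and the recurrence\<close>

lemma mfps_divide_times:
  fixes f g h k :: ratio_series
  assumes "mfps_nth g 0 \<noteq> 0" "mfps_nth k 0 \<noteq> 0"
  shows "(f / g) * (h / k) = (f * h) / (g * k)"
proof -
  have "f = f / g * g" "h = h / k * k"
    using mfps_divide_eq_iff[OF assms(1), of f "f / g"] mfps_divide_eq_iff[OF assms(2), of h "h / k"] by auto
  then have "f * h = (f / g * (h / k)) * (g * k)"
    by (metis (no_types, lifting) mult.assoc mult.commute)
  then have "(f * h) / (g * k) = f / g * (h / k)"
    using assms by (subst mfps_divide_eq_iff) auto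
  then show ?thesis ..
qed

lemma mfps_divide_self:
  fixes f :: ratio_series
  shows "mfps_nth f 0 \<noteq> 0 \<Longrightarrow> f / f = 1"
  by (subst mfps_divide_eq_iff) auto

lemma mfps_nth_qpoch_inf_0: "norm q < 1 \<Longrightarrow> mfps_nth z 0 = 0 \<Longrightarrow> mfps_nth (qpoch_inf q z) 0 = 1"
  by (rule qpoch_LIMSEQ)

lemma kill_qpoch_inf:
  "norm q < 1 \<Longrightarrow> mfps_nth z 0 = 0 \<Longrightarrow> kill a (qpoch_inf q z) = qpoch_inf q (kill a z)"
  unfolding kill_def by (rule mfps_rescale_qpoch_inf)

section \<open>Infinite products attached to the additional variable\<close>

definition edge_inf :: "nat \<Rightarrow> alphabet \<Rightarrow> complex \<Rightarrow> complex \<Rightarrow> ratio_series"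
  where "edge_inf n a q t = (\<Prod>i\<in>{1..n}.
    qpoch_inf q (mfps_const t * ratio a i (n + 1)) / qpoch_inf q (mfps_const q * ratio a i (n + 1)))"

definition psi_prefactor :: "nat \<Rightarrow> alphabet \<Rightarrow> complex \<Rightarrow> complex \<Rightarrow> ratio_series"
  where "psi_prefactor n a q t = (\<Prod>j\<in>{1..n}. \<Prod>i\<in>{1..<j}.
    qpoch_inf q (mfps_const (q / t) * ratio a i j) / qpoch_inf q (mfps_const q * ratio a i j))"

lemma psi_eq: "psi n a b q t = psi_prefactor n a q t * p_series n a b q t"
  by (simp add: psi_def psi_prefactor_def)

lemma qshift_ratio_trivial:
  "q \<noteq> 0 \<Longrightarrow> i \<le> j \<Longrightarrow> e i = 0 \<Longrightarrow> e j = 0 \<Longrightarrow> qshift q a e (ratio a i j) = ratio a i j"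
  by (simp add: qshift_ratio mfps_const_1)

lemma qshift_qpoch_inf:
  "norm q < 1 \<Longrightarrow> mfps_nth z 0 = 0 \<Longrightarrow> qshift q a e (qpoch_inf q z) = qpoch_inf q (qshift q a e z)"
  unfolding qshift_def by (rule mfps_rescale_qpoch_inf)

lemma qshift_power: "qshift q a e (f ^ k) = qshift q a e f ^ k"
  by (simp add: qshift_def mfps_rescale_power)

context
  fixes q t :: complex and n :: nat
  assumes q: "q \<noteq> 0" "norm q < 1" and t: "t \<noteq> 0"
begin

lemma qshift_edge_inf_other:
  assumes "a \<noteq> b"
  shows "qshift q b e (edge_inf n a q s) = edge_inf n a q s"
  unfolding edge_inf_def qshift_prod
  using assms q by (intro prod.cong refl)
    (simp add: qshift_divide qshift_qpoch_inf qshift_mult qshift_const qshift_ratio_other)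

lemma qshift_K_coeff_other:
  assumes "a \<noteq> b"
  shows "qshift q b e (K_coeff n a q s \<nu>) = K_coeff n a q s \<nu>"
  unfolding K_coeff_def qshift_prod qshift_mult qshift_divide qshift_qpoch qshift_const
    qshift_ratio_other[OF not_sym[OF assms]] ..

lemma qshift_K_coeff_trivial:
  assumes "\<And>i. i \<in> {1..n} \<Longrightarrow> e i = 0"
  shows "qshift q a e (K_coeff n a q s \<nu>) = K_coeff n a q s \<nu>"
  unfolding K_coeff_def qshift_prod qshift_mult qshift_divide qshift_qpoch qshift_const
  using assms q(1) by (intro arg_cong2[of _ _ _ _ "(*)"] prod.cong refl) (simp_all add: qshift_ratio_trivial)

lemma qshift_psi_prefactor_other: "a \<noteq> b \<Longrightarrow> qshift q b e (psi_prefactor n a q t) = psi_prefactor n a q t"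
  unfolding psi_prefactor_def qshift_prod
  using q by (intro prod.cong refl)
    (simp add: qshift_divide qshift_qpoch_inf qshift_mult qshift_const qshift_ratio_other)

text \<open>The series involves only the first n variables of \<open>a\<close>. This bounds the
  exponents in the uniqueness argument and frees \<open>psi\<close> from the shift of the variable n
  + 1.\<close>

lemma qshift_psi_trivial:
  assumes ab: "a \<noteq> b" and e: "\<And>i. i \<in> {1..n} \<Longrightarrow> e i = 0"
  shows "qshift q a e (psi n a b q t) = psi n a b q t"
proof -
  have "qshift q a e (psi_prefactor n a q t) = psi_prefactor n a q t"
    unfolding psi_prefactor_def qshift_prod
    using q e by (intro prod.cong refl)
      (simp add: qshift_divide qshift_qpoch_inf qshift_mult qshift_const qshift_ratio_trivial)
  moreover have "qshift q a e (c_coeff n \<theta> b q t) = c_coeff n \<theta> b q t" for \<theta>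
    unfolding c_coeff_eq c_factor_def c_factor'_def qshift_prod qshift_mult qshift_divide qshift_qpoch qshift_const
      qshift_ratio_other[OF ab] ..
  moreover have "qshift q a e (mat_monom n a \<theta>) = mat_monom n a \<theta>" for \<theta>
    unfolding qshift_prod qshift_power using q e by (intro prod.cong refl) (simp add: qshift_ratio_trivial)
  ultimately have "qshift q a e (p_series n a b q t) = p_series n a b q t"
    unfolding p_series_def qshift_def infsum_rescale[OF locally_finite_mat_monom] mfps_rescale_mult
    by (intro infsum_cong) simp
  then show ?thesis
    using \<open>qshift q a e (psi_prefactor n a q t) = psi_prefactor n a q t\<close>
    by (simp add: psi_eq qshift_mult)
qed

text \<open>The prefactor depends only on \<open>a\<close>, so the shifts of \<open>b\<close> pass
  it; enlarging n by one adds exactly \<open>edge_inf n a q (q / t)\<close>.\<close>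

lemma psi_Suc:
  assumes ab: "a \<noteq> b"
  shows "psi (n + 1) a b q t = edge_inf n a q (q / t) *
    Op n b q (\<lambda>i. mfps_const (q / t) * ratio a i (n + 1)) (\<lambda>\<nu>. K_coeff n b q t \<nu> * edge_series n b q t \<nu>)
      (psi n a b q t)"
proof -
  let ?w = "\<lambda>i. mfps_const (q / t) * ratio a i (n + 1)"
  have w: "mfps_nth (?w i) 0 = 0" "qshift q b e (?w i) = ?w i" if "i \<in> {1..n}" for e i
    using that ab by (simp_all add: qshift_mult qshift_const qshift_ratio_other)
  have "psi_prefactor (n + 1) a q t = edge_inf n a q (q / t) * psi_prefactor n a q t"
    by (simp add: psi_prefactor_def edge_inf_def interval_Suc)
  then show ?thesis
    unfolding psi_eq p_series_Suc[OF q t ab]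
    by (subst Op_mult_left[OF q(1) w qshift_psi_prefactor_other[OF ab]]) (simp_all add: mult.assoc)
qed

lemma edge_inf_shift:
  assumes "\<nu> \<in> nat_vecs n"
  shows "edge_series n b q s \<nu> * qshift q b (neg_vec \<nu>) (edge_inf n b q s) = edge_inf n b q s"
  unfolding edge_series_def edge_inf_def qshift_prod prod.distrib[symmetric]
proof (intro prod.cong refl)
  fix i assume i: "i \<in> {1..n}"
  have "\<nu> (n + 1) = 0" using assms by (simp add: nat_vecs_def)
  then have shift: "qshift q b (neg_vec \<nu>) (qpoch_inf q (mfps_const c * ratio b i (n + 1))) =
      qpoch_inf q (mfps_const (q ^ \<nu> i) * (mfps_const c * ratio b i (n + 1)))" for c
    using i q by (simp add: qshift_qpoch_inf qshift_mult qshift_const qshift_ratio mult_ac)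
  have z: "mfps_nth (mfps_const c * ratio b i (n + 1)) 0 = 0" for c
    using i by simp
  show "qpoch q (mfps_const s * ratio b i (n + 1)) (\<nu> i) / qpoch q (mfps_const q * ratio b i (n + 1)) (\<nu> i) *
      qshift q b (neg_vec \<nu>) (qpoch_inf q (mfps_const s * ratio b i (n + 1)) / qpoch_inf q (mfps_const q * ratio b i (n + 1))) =
      qpoch_inf q (mfps_const s * ratio b i (n + 1)) / qpoch_inf q (mfps_const q * ratio b i (n + 1))"
    unfolding qshift_divide shift
    using z by (subst mfps_divide_times) (simp_all add: mfps_nth_qpoch_inf_0 q qpoch_inf_shift)
qed

text \<open>The edge factors measure how \<open>edge_inf\<close> changes under the shifts.
  Conjugation by \<open>edge_inf\<close> therefore removes them and leaves the pure operator
  \<open>K\<close>.\<close>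

lemma Op_edge:
  "Op n b q w (\<lambda>\<nu>. c \<nu> * edge_series n b q s \<nu>) (edge_inf n b q s * f) =
    Op n b q w (\<lambda>\<nu>. edge_inf n b q s * c \<nu>) f"
  unfolding Op_def
proof (intro infsum_cong)
  fix \<nu> assume \<nu>: "\<nu> \<in> nat_vecs n"
  have "vec_monom n w \<nu> * (c \<nu> * edge_series n b q s \<nu>) * qshift q b (neg_vec \<nu>) (edge_inf n b q s * f) =
      vec_monom n w \<nu> * ((edge_series n b q s \<nu> * qshift q b (neg_vec \<nu>) (edge_inf n b q s)) * c \<nu>) *
      qshift q b (neg_vec \<nu>) f"
    unfolding qshift_mult by (simp only: mult_ac)
  then show "vec_monom n w \<nu> * (c \<nu> * edge_series n b q s \<nu>) * qshift q b (neg_vec \<nu>) (edge_inf n b q s * f) =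
      vec_monom n w \<nu> * (edge_inf n b q s * c \<nu>) * qshift q b (neg_vec \<nu>) f"
    unfolding edge_inf_shift[OF \<nu>] .
qed

text \<open>Without the ratios of \<open>a\<close> the shifts act trivially and the coefficient of
  \<open>K\<close> reduces to its scalar part, so the sum is a product of q-binomial series, which
  is inverse to \<open>edge_inf n b q t\<close>.\<close>

lemma kill_Op:
  assumes ab: "a \<noteq> b"
  shows "kill a (Op n a q (\<lambda>i. mfps_const t * ratio b i (n + 1)) (K_coeff n a q (q / t)) f) * edge_inf n b q t =
    kill a f"
proof -
  let ?w = "\<lambda>i. mfps_const t * ratio b i (n + 1)"
  let ?g = "\<lambda>k. qpoch q (mfps_const (q / t)) k / qpoch q (mfps_const q) k"
  \<comment> \<open>Extended by 0 because \<open>infsum_nat_vecs_prod\<close> asks for the order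
    estimate at every index, whereas the weight has constant term 0 only for indices in the
    range.\<close>
  define W where "W i = (if i \<in> {1..n} then ?w i else 0)" for i
  have W0: "mfps_nth (W i) 0 = 0" for i
    by (simp add: W_def)
  have w: "mfps_nth (?w i) 0 = 0" "qshift q a e (?w i) = ?w i" if "i \<in> {1..n}" for e i
    using that ab by (simp_all add: qshift_mult qshift_const qshift_ratio_other)
  have lfw: "locally_finite (\<lambda>\<nu>. vec_monom n ?w \<nu> * h \<nu> * h' \<nu>) (nat_vecs n)" for h h'
    by (rule locally_finite_Op[OF q(1) w])
  have kill_poch: "kill a (qpoch q z k) = qpoch q (kill a z) k" for z k
    by (simp add: kill_def mfps_rescale_qpoch)
  have killK: "kill a (K_coeff n a q (q / t) \<nu>) = (\<Prod>i\<in>{1..n}. ?g (\<nu> i))" for \<nu>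
  proof -
    have "qpoch q 0 k = 1" for k by (simp add: qpoch_def)
    then show ?thesis
      unfolding K_coeff_def kill_simps kill_poch by (simp add: kill_ratio)
  qed
  have killw: "kill a (vec_monom n ?w \<nu>) = vec_monom n ?w \<nu>" for \<nu>
    using ab by (simp add: kill_simps kill_ratio_other)
  have "kill a (Op n a q ?w (K_coeff n a q (q / t)) f) =
      (\<Sum>\<^sub>\<infinity>\<nu>\<in>nat_vecs n. kill a (vec_monom n ?w \<nu> * K_coeff n a q (q / t) \<nu> * qshift q a (neg_vec \<nu>) f))"
    unfolding Op_def kill_def by (rule infsum_rescale[OF lfw])
  also have "\<dots> = (\<Sum>\<^sub>\<infinity>\<nu>\<in>nat_vecs n. kill a f * (\<Prod>i\<in>{1..n}. ?g (\<nu> i) * W i ^ \<nu> i))"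
  proof (intro infsum_cong)
    fix \<nu>
    have *: "vec_monom n ?w \<nu> = (\<Prod>i\<in>{1..n}. W i ^ \<nu> i)"
      by (intro prod.cong) (auto simp: W_def)
    show "kill a (vec_monom n ?w \<nu> * K_coeff n a q (q / t) \<nu> * qshift q a (neg_vec \<nu>) f) =
        kill a f * (\<Prod>i\<in>{1..n}. ?g (\<nu> i) * W i ^ \<nu> i)"
      unfolding kill_simps(3) killw killK kill_qshift prod.distrib
      unfolding * by (simp only: mult_ac)
  qed
  also have "\<dots> = kill a f * (\<Sum>\<^sub>\<infinity>\<nu>\<in>nat_vecs n. \<Prod>i\<in>{1..n}. ?g (\<nu> i) * W i ^ \<nu> i)"
  proof (rule infsum_mult_left_mfps[symmetric])
    show "locally_finite (\<lambda>\<nu>. \<Prod>i\<in>{1..n}. ?g (\<nu> i) * W i ^ \<nu> i) (nat_vecs n)"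
      by (rule locally_finite_ord_ge[where W = "vec_size n"])
        (intro ord_ge_prod ord_ge_mult_right ord_ge_power W0 finite_nat_vecs_le)+
  qed
  also have "(\<Sum>\<^sub>\<infinity>\<nu>\<in>nat_vecs n. \<Prod>i\<in>{1..n}. ?g (\<nu> i) * W i ^ \<nu> i) = (\<Prod>i\<in>{1..n}. \<Sum>\<^sub>\<infinity>k. ?g k * W i ^ k)"
    by (rule infsum_nat_vecs_prod) (intro ord_ge_mult_right ord_ge_power W0)
  also have "\<dots> = (\<Prod>i\<in>{1..n}. qpoch_inf q (mfps_const q * ratio b i (n + 1)) / qpoch_inf q (?w i))"
  proof (intro prod.cong refl)
    fix i assume i: "i \<in> {1..n}"
    have "mfps_const (q / t) * ?w i = mfps_const q * ratio b i (n + 1)"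
      using t by (simp add: mult.assoc[symmetric] flip: mfps_const_mult)
    moreover have "W i = ?w i" using i by (simp add: W_def)
    ultimately show "(\<Sum>\<^sub>\<infinity>k. ?g k * W i ^ k) = qpoch_inf q (mfps_const q * ratio b i (n + 1)) / qpoch_inf q (?w i)"
      using q_binomial[OF q(2) W0[of i], of "q / t"] by (simp only:)
  qed
  finally have "kill a (Op n a q ?w (K_coeff n a q (q / t)) f) * edge_inf n b q t = kill a f *
      ((\<Prod>i\<in>{1..n}. qpoch_inf q (mfps_const q * ratio b i (n + 1)) / qpoch_inf q (?w i)) * edge_inf n b q t)"
    by (simp only: mult.assoc)
  also have "(\<Prod>i\<in>{1..n}. qpoch_inf q (mfps_const q * ratio b i (n + 1)) / qpoch_inf q (?w i)) * edge_inf n b q t = 1"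
    unfolding edge_inf_def prod.distrib[symmetric]
  proof (intro prod.neutral ballI)
    fix i assume i: "i \<in> {1..n}"
    let ?x = "qpoch_inf q (mfps_const q * ratio b i (n + 1))" and ?y = "qpoch_inf q (?w i)"
    have "mfps_nth ?x 0 = 1" "mfps_nth ?y 0 = 1"
      using i by (simp_all add: mfps_nth_qpoch_inf_0 q)
    then show "?x / ?y * (?y / ?x) = 1"
      by (subst mfps_divide_times) (simp_all add: mult.commute[of ?x] mfps_divide_self)
  qed
  finally show ?thesis by simp
qed

text \<open>The natural weights are 1 / b_i; the common factor b_(n+1) turns them into ratios, hence
  into power series.\<close>

definition mac_eigen :: "alphabet \<Rightarrow> alphabet \<Rightarrow> bool"
  where "mac_eigen a b \<longleftrightarrow>
    (\<Sum>i\<in>{1..n}. ratio b i (n + 1) * (mac_series n a q t i * qshift q a (neg_unit i) (psi n a b q t))) =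
    (\<Sum>i\<in>{1..n}. ratio b i (n + 1)) * psi n a b q t"

lemma psi_eigen:
  assumes ab: "a \<noteq> b" and mac: "mac_eigen a b"
  shows "edge_inf n b q t * Op n a q (\<lambda>i. mfps_const t * ratio b i (n + 1)) (K_coeff n a q (q / t)) (psi n a b q t) =
    psi n a b q t"
proof -
  let ?w = "\<lambda>i. mfps_const t * ratio b i (n + 1)" and ?r = "\<lambda>i. ratio b i (n + 1)"
  let ?K = "Op n a q ?w (K_coeff n a q (q / t))" and ?g = "edge_inf n b q t" and ?psi = "psi n a b q t"
  let ?H = "\<lambda>f. \<Sum>i\<in>{1..n}. ?r i * (mac_series n a q t i * qshift q a (neg_unit i) f)"
  have w: "mfps_nth (?w i) 0 = 0" "qshift q a e (?w i) = ?w i" if "i \<in> {1..n}" for e i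
    using that ab by (simp_all add: qshift_mult qshift_const qshift_ratio_other)
  have g: "qshift q a e ?g = ?g" for e
    using ab by (intro qshift_edge_inf_other) auto
  have tH: "mfps_const t * ?H f = (\<Sum>i\<in>{1..n}. ?w i * (mac_series n a q t i * qshift q a (neg_unit i) f))" for f
    by (simp add: sum_distrib_left mult.assoc)
  have tr: "qshift q a e (mfps_const t * (\<Sum>i\<in>{1..n}. ?r i)) = mfps_const t * (\<Sum>i\<in>{1..n}. ?r i)" for e
    using ab by (simp add: qshift_def mfps_rescale_mult mfps_rescale_const mfps_rescale_sum)
      (simp add: qshift_ratio_other[unfolded qshift_def])
  have "mfps_const t * ?H (?K ?psi) = ?K (mfps_const t * ?H ?psi)"
    unfolding tH by (rule Op_mac_commute[OF q(1) w q(2) t])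
  also have "mfps_const t * ?H ?psi = mfps_const t * (\<Sum>i\<in>{1..n}. ?r i) * ?psi"
    using mac by (simp only: mac_eigen_def mult.assoc)
  also have "?K (mfps_const t * (\<Sum>i\<in>{1..n}. ?r i) * ?psi) = mfps_const t * (\<Sum>i\<in>{1..n}. ?r i) * ?K ?psi"
    by (rule Op_mult_left[OF q(1) w tr])
  finally have "mfps_const t * ?H (?K ?psi) = mfps_const t * ((\<Sum>i\<in>{1..n}. ?r i) * ?K ?psi)"
    by (simp only: mult.assoc)
  moreover have "mfps_const t \<noteq> (0 :: ratio_series)"
    using t by (auto simp: mfps_eq_iff mfps_nth_const intro!: exI[of _ 0])
  ultimately have HK: "?H (?K ?psi) = (\<Sum>i\<in>{1..n}. ?r i) * ?K ?psi"
    by simp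
  have H_diff: "?H (f - h) = ?H f - ?H h" for f h
    by (simp add: qshift_def mfps_rescale_diff right_diff_distrib sum_subtractf)
  have H_mult: "?H (?g * f) = ?g * ?H f" for f
    unfolding qshift_mult g sum_distrib_left by (intro sum.cong refl) (simp only: mult_ac)
  \<comment> \<open>The Macdonald operator commutes with \<open>?K\<close> and with multiplication
    by \<open>?g\<close>, so both terms satisfy the same eigenvalue equation; by
    \<open>kill_Op\<close> they also have the same constant term in \<open>a\<close>.\<close>
  have "?g * ?K ?psi - ?psi = 0"
  proof (rule mac_eigenfunction_unique[OF q ab])
    show "?H (?g * ?K ?psi - ?psi) = (\<Sum>i\<in>{1..n}. ?r i) * (?g * ?K ?psi - ?psi)"
      unfolding H_diff H_mult HK using mac
      by (simp only: mac_eigen_def right_diff_distrib) (simp only: mult_ac)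
    have "kill a ?g = ?g"
      using ab q unfolding edge_inf_def kill_simps
      by (intro prod.cong refl)
        (simp add: kill_qpoch_inf kill_simps kill_ratio_other)
    then show "kill a (?g * ?K ?psi - ?psi) = 0"
      using kill_Op[OF ab, of ?psi] by (simp add: kill_simps mult.commute)
    show "qshift q a e (?g * ?K ?psi - ?psi) = ?g * ?K ?psi - ?psi" if "\<And>i. i \<in> {1..n} \<Longrightarrow> e i = 0" for e
    proof -
      have K: "qshift q a e (K_coeff n a q (q / t) \<nu>) = K_coeff n a q (q / t) \<nu>" for \<nu>
        by (rule qshift_K_coeff_trivial) (rule that)
      have psi: "qshift q a e ?psi = ?psi"
        by (rule qshift_psi_trivial[OF ab]) (rule that)
      have "qshift q a e (?K ?psi) = ?K ?psi"
        by (subst qshift_Op[OF q(1) w]) (simp_all only: K psi)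
      moreover have "qshift q a e (f - h) = qshift q a e f - qshift q a e h" for f h
        by (simp add: qshift_def mfps_rescale_diff)
      ultimately show ?thesis
        by (simp only: qshift_mult g psi)
    qed
  qed
  then show ?thesis by simp
qed

text \<open>By \<open>psi_eigen\<close> the argument of the column recursion may be written as
  \<open>edge_inf n b q t\<close> times a series. \<open>Op_edge\<close> then exchanges the edge
  factors for this product, which is invisible to the recursion in its original form.\<close>

lemma psi_recurrence:
  assumes ab: "a \<noteq> b" and mac: "mac_eigen a b"
  shows "psi (n + 1) a b q t = edge_inf n a q (q / t) * edge_inf n b q t *
    Op n b q (\<lambda>i. mfps_const (q / t) * ratio a i (n + 1)) (K_coeff n b q t)
      (Op n a q (\<lambda>i. mfps_const t * ratio b i (n + 1)) (K_coeff n a q (q / t)) (psi n a b q t))"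
proof -
  let ?w = "\<lambda>i. mfps_const (q / t) * ratio a i (n + 1)"
  let ?f = "Op n a q (\<lambda>i. mfps_const t * ratio b i (n + 1)) (K_coeff n a q (q / t)) (psi n a b q t)"
  have w: "mfps_nth (?w i) 0 = 0" "qshift q b e (?w i) = ?w i" if "i \<in> {1..n}" for e i
    using that ab by (simp_all add: qshift_mult qshift_const qshift_ratio_other)
  have "psi (n + 1) a b q t = edge_inf n a q (q / t) *
      Op n b q ?w (\<lambda>\<nu>. K_coeff n b q t \<nu> * edge_series n b q t \<nu>) (edge_inf n b q t * ?f)"
    unfolding psi_eigen[OF ab mac] by (rule psi_Suc[OF ab])
  also have "Op n b q ?w (\<lambda>\<nu>. K_coeff n b q t \<nu> * edge_series n b q t \<nu>) (edge_inf n b q t * ?f) =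
      edge_inf n b q t * Op n b q ?w (K_coeff n b q t) ?f"
    unfolding Op_edge by (rule Op_coeff_mult[OF q(1) w])
  finally show ?thesis
    by (simp only: mult.assoc)
qed

end

text \<open>Duality exchanges the alphabets and replaces \<open>t\<close> by \<open>q / t\<close>,
  so the induction has to vary all three. The recurrence is applied in both orders, which uses the
  eigenvalue equation for n in both alphabets.\<close>

lemma mac_eigen_and_duality:
  assumes q: "q \<noteq> 0" "norm q < 1" and t: "t \<noteq> 0" and ab: "a \<noteq> b"
  shows "mac_eigen q t n a b \<and> psi n a b q t = psi n b a q (q / t)"
  using t ab
proof (induction n arbitrary: a b t)
  case 0
  show ?case
    by (simp add: mac_eigen_def[OF q 0(1)] psi_def p_series_def upper_mats_0 c_coeff_eq)
next
  case (Suc n)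
  note t = Suc.prems(1) and ab = Suc.prems(2)
  have t': "q / t \<noteq> 0" "q / (q / t) = t" and ba: "b \<noteq> a"
    using q t ab by auto
  note IH = Suc.IH[OF t ab] and IH' = Suc.IH[OF t'(1) ba]
  let ?w = "\<lambda>i. mfps_const t * ratio b i (n + 1)"
  let ?A = "Op n a q ?w (K_coeff n a q (q / t))"
  let ?B = "Op n b q (\<lambda>i. mfps_const (q / t) * ratio a i (n + 1)) (K_coeff n b q t)"
  let ?psi = "psi n a b q t"
  have "psi (n + 1) a b q t = edge_inf n a q (q / t) * edge_inf n b q t * ?B (?A ?psi)"
    using IH by (intro psi_recurrence[OF q t ab]) simp
  \<comment> \<open>In this order the expression is the recurrence with the alphabets exchanged,
    once \<open>?psi\<close> is replaced by its dual.\<close>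
  also have "?B (?A ?psi) = ?A (?B ?psi)"
    by (rule Op_commute[OF q(1) qshift_K_coeff_other[OF q t ba] qshift_K_coeff_other[OF q t ab]])
  also have "edge_inf n a q (q / t) * edge_inf n b q t * ?A (?B ?psi) =
      edge_inf n b q t * edge_inf n a q (q / t) * ?A (?B (psi n b a q (q / t)))"
    using IH by (simp only: mult.commute)
  also have "\<dots> = psi (n + 1) b a q (q / t)"
    using psi_recurrence[OF q t'(1) ba] IH' by (simp only: t'(2))
  finally have duality: "psi (n + 1) a b q t = psi (n + 1) b a q (q / t)" .
  let ?c = "\<lambda>\<nu>. K_coeff n a q (q / t) \<nu> * edge_series n a q (q / t) \<nu>"
  let ?P = "Op n a q ?w ?c ?psi" and ?g = "edge_inf n b q t"
  have w: "mfps_nth (?w i) 0 = 0" "qshift q a e (?w i) = ?w i" if "i \<in> {1..n}" for e i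
    using that ab by (simp_all add: qshift_mult qshift_const qshift_ratio_other)
  \<comment> \<open>By duality the recursion is now available with shifts of \<open>a\<close>, the
    alphabet of the Macdonald operator, and it can be intertwined.\<close>
  have psi_P: "psi (n + 1) a b q t = ?g * ?P"
    unfolding duality psi_Suc[OF q t'(1) ba] t'(2) using IH by simp
  have g: "qshift q a e ?g = ?g" for e
    using ab by (intro qshift_edge_inf_other q t) auto
  let ?r = "\<lambda>i. ratio b i (n + 1)"
  have tt: "mfps_const (1 / t) * mfps_const t = (1 :: ratio_series)"
    using t by (simp add: mfps_const_1 flip: mfps_const_mult)
  have psi_shift: "qshift q a (neg_unit (n + 1)) ?psi = ?psi"
    by (rule qshift_psi_trivial[OF q t ab]) auto
  have lambda_inv: "qshift q a e (\<Sum>i\<in>{1..n}. ?w i) = (\<Sum>i\<in>{1..n}. ?w i)" for e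
    unfolding qshift_def mfps_rescale_sum using w(2) by (intro sum.cong refl) (simp add: qshift_def)
  have "(\<Sum>i\<in>{1..n}. ?w i * (mac_series n a q t i * qshift q a (neg_unit i) ?psi)) = (\<Sum>i\<in>{1..n}. ?w i) * ?psi"
    using IH[THEN conjunct1] unfolding mac_eigen_def[OF q t]
    by (simp only: mult.assoc sum_distrib_left[symmetric])
  then have "Op n a q ?w ?c (\<Sum>i\<in>{1..n}. ?w i * (mac_series n a q t i * qshift q a (neg_unit i) ?psi)) =
      (\<Sum>i\<in>{1..n}. ?w i) * ?P"
    by (simp only: Op_mult_left[OF q(1) w lambda_inv])
  then have "mfps_const (1 / t) * (\<Sum>i\<in>{1..n}. ?w i * (mac_series (n + 1) a q t i * qshift q a (neg_unit i) ?P)) +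
      qshift q a (neg_unit (n + 1)) ?P = mfps_const (1 / t) * ((\<Sum>i\<in>{1..n}. ?w i) * ?P) + ?P"
    using Op_mac_intertwine[OF q(1) w q(2) t psi_shift] by simp
  then have "(\<Sum>i\<in>{1..n}. ?r i * (mac_series (n + 1) a q t i * qshift q a (neg_unit i) ?P)) +
      qshift q a (neg_unit (n + 1)) ?P = (\<Sum>i\<in>{1..n}. ?r i) * ?P + ?P"
    by (simp only: sum_distrib_left sum_distrib_right mult.assoc[symmetric] tt mult_1_left)
  moreover have split: "(\<Sum>i\<in>{1..n + 1}. F i) = (\<Sum>i\<in>{1..n}. F i) + F (n + 1)" for F :: "nat \<Rightarrow> ratio_series"
    by (subst interval_Suc) simp
  \<comment> \<open>The coefficient and the weight of the index n + 1 are both 1, so the isolated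
    shift is the missing summand of the operator in n + 1 variables.\<close>
  moreover have "mac_series (n + 1) a q t (n + 1) = 1"
    by (simp add: mac_series_def)
  ultimately have P: "(\<Sum>i\<in>{1..n+1}. ?r i * (mac_series (n + 1) a q t i * qshift q a (neg_unit i) ?P)) =
      (\<Sum>i\<in>{1..n+1}. ?r i) * ?P"
    by (simp only: split ratio_refl mult_1_left distrib_right)
  \<comment> \<open>For n + 1 variables \<open>mac_eigen\<close> normalises the weights by b_(n+2)
    instead of b_(n+1); the common factor b_(n+2) / b_(n+1) makes up the difference.\<close>
  have lift: "ratio b i (n + 1 + 1) = ratio b (n + 1) (n + 1 + 1) * ?r i" if "i \<in> {1..n+1}" for i
    using that by (subst mult.commute, subst ratio_mult) auto
  have "(\<Sum>i\<in>{1..n+1}. ratio b i (n + 1 + 1) * (mac_series (n + 1) a q t i * qshift q a (neg_unit i) (?g * ?P))) =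
      (\<Sum>i\<in>{1..n+1}. ratio b (n + 1) (n + 1 + 1) * ?g * (?r i * (mac_series (n + 1) a q t i * qshift q a (neg_unit i) ?P)))"
    by (intro sum.cong refl) (simp only: lift qshift_mult g mult_ac)
  also have "\<dots> = ratio b (n + 1) (n + 1 + 1) * ?g * ((\<Sum>i\<in>{1..n+1}. ?r i) * ?P)"
    by (simp only: sum_distrib_left[symmetric] P)
  also have "\<dots> = (\<Sum>i\<in>{1..n+1}. ratio b (n + 1) (n + 1 + 1) * ?r i) * (?g * ?P)"
    by (simp only: sum_distrib_left[symmetric]) (simp only: mult_ac)
  also have "(\<Sum>i\<in>{1..n+1}. ratio b (n + 1) (n + 1 + 1) * ?r i) = (\<Sum>i\<in>{1..n+1}. ratio b i (n + 1 + 1))"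
    by (intro sum.cong refl) (simp only: lift)
  finally have "mac_eigen q t (n + 1) a b"
    unfolding mac_eigen_def[OF q t] psi_P .
  with duality show ?case by (simp only: Suc_eq_plus1 simp_thms)
qed

theorem theorem1p5:
  fixes q t :: complex and n :: nat
  assumes "q \<noteq> 0" and "norm q < 1" and "t \<noteq> 0" and "n \<ge> 1"
  shows "psi (n + 1) S X q t =
    (\<Prod>i\<in>{1..n}.
       qpoch_inf q (mfps_const t * ratio X i (n + 1)) /
       qpoch_inf q (mfps_const q * ratio X i (n + 1)) *
       (qpoch_inf q (mfps_const (q / t) * ratio S i (n + 1)) /
        qpoch_inf q (mfps_const q * ratio S i (n + 1)))) *
    K_op n X S q t (\<lambda>i. mfps_const (q / t) * ratio S i (n + 1))
      (K_op n S X q (q / t) (\<lambda>i. mfps_const t * ratio X i (n + 1))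
        (psi n S X q t))"
proof -
  have "mac_eigen q t n S X"
    using mac_eigen_and_duality[OF assms(1-3), of S X n] by simp
  from psi_recurrence[OF assms(1-3) _ this] show ?thesis
    unfolding K_op_eq_Op prod.distrib by (simp add: edge_inf_def mult.commute)
qed

end
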